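(* Under the standing hypotheses (H1)–(H6) below, suppose $\tau$ is in the limit-circle case at $a$ and in the limit-point case at $b$. Then a linear relation $S$ is a self-adjoint restriction of $T_{\max}$ if and only if there is $v\in T_{\max}\setminus T_{\min}$ with $W(v,v^\ast)(a)=0$ such that $$S=\{f\in T_{\max}\,:\,W(f,v^\ast)(a)=0\}.$$ The analogous statement holds if $\tau$ is in the limit-circle case at $b$ and in the limit-point case at $a$.
   Context: Let $-\infty\le a<b\le\infty$ and $\varrho,\varsigma,\chi$ locally finite Borel measures on $(a,b)$ with: (H1) $\varrho$ positive; (H2) $\chi$ real-valued; (H3) $\varsigma$ real-valued with $\operatorname{supp}\varsigma=(a,b)$; (H4) $\varsigma(\{x\})\chi(\{x\})=\varsigma(\{x\})\varrho(\{x\})=0$ for all $x$; (H5) for every gap $(\alpha,\beta)$ of $\operatorname{supp}\varrho$ (open interval in the complement with $\alpha,\beta\in\operatorname{supp}\varrho$) and every $f\in\mathfrak{D}_\tau$ with $f(\alpha-)=f(\beta+)=0$ one has $f=0$ on $(\alpha,\beta)$; (H6) $\operatorname{supp}\varrho$ has more than one point. Notation: $\int_c^x h\,d\mu=\int_{[c,x)}h\,d\mu$ ($x>c$), $0$ ($x=c$), $-\int_{[x,c)}h\,d\mu$ ($x<c$); $AC_{loc}((a,b);\mu)$: functions $f(x)=f(c)+\int_c^x h\,d\mu$, $h=\frac{df}{d\mu}\in L^1_{loc}$. $\mathfrak{D}_\tau$: $f\in AC_{loc}((a,b);\varsigma)$ for which there is $F\in AC_{loc}((a,b);\varrho)$ with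 $F=-\frac{df}{d\varsigma}+\int_c^{\cdot}f\,d\chi$ $|\varsigma|$-a.e.; $\tau f:=\frac{dF}{d\varrho}$, $f^{[1]}:=\int_c^{\cdot}f\,d\chi-F$, $W(f,g)=fg^{[1]}-f^{[1]}g$. In $L^2((a,b);\varrho)$: $T_{\max}=\{(f,\tau f): f\in\mathfrak{D}_\tau,\ f,\tau f\in L^2\}$, elements identified with functions in $\mathfrak{D}_\tau$; $f^\ast$ is complex conjugation; $T_0=\{f\in T_{\max}:\operatorname{supp}f\text{ compact in }(a,b)\}$, $T_{\min}=\overline{T_0}$. For $f,g\in T_{\max}$, $W(f,g)(a)=\lim_{x\downarrow a}W(f,g)(x)$ exists. $\tau$ is l.c. at $a$ if for all $z\in\mathbb{C}$ all solutions of $\tau u=zu$ lie in $L^2((a,c);\varrho)$ for each $c$, and l.p. at $a$ otherwise (similarly at $b$). A self-adjoint restriction of $T_{\max}$ is a linear relation $S\subseteq T_{\max}$ with $S=S^\ast$ (adjoint in $L^2((a,b);\varrho)$). *)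

theory Defs
  imports "HOL-Analysis.Analysis"
begin

definition Iab :: "ereal \<Rightarrow> ereal \<Rightarrow> real set" where
  "Iab a b = {x. a < ereal x \<and> ereal x < b}"

definition locfin :: "ereal \<Rightarrow> ereal \<Rightarrow> real measure \<Rightarrow> bool" where
  "locfin a b M \<longleftrightarrow> sets M = sets borel \<and> emeasure M (- Iab a b) = 0 \<and>
     (\<forall>c\<in>Iab a b. \<forall>d\<in>Iab a b. emeasure M {c..d} < \<infinity>)"

text \<open>A real-valued (signed) locally finite Borel measure, represented by its Jordan
  decomposition (positive part, negative part): two mutually singular positive
  locally finite measures.\<close>
type_synonym rmeas = "real measure \<times> real measure"

definition real_meas :: "ereal \<Rightarrow> ereal \<Rightarrow> rmeas \<Rightarrow> bool" where
  "real_meas a b \<mu> \<longleftrightarrow> locfin a b (fst \<mu>) \<and> locfin a b (snd \<mu>) \<and>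
     (\<exists>A\<in>sets borel. emeasure (fst \<mu>) A = 0 \<and> emeasure (snd \<mu>) (- A) = 0)"

definition pos_rm :: "real measure \<Rightarrow> rmeas" where
  "pos_rm M = (M, null_measure M)"

definition sval :: "rmeas \<Rightarrow> real set \<Rightarrow> real" where
  "sval \<mu> A = measure (fst \<mu>) A - measure (snd \<mu>) A"

definition rint :: "rmeas \<Rightarrow> real set \<Rightarrow> (real \<Rightarrow> complex) \<Rightarrow> complex" where
  "rint \<mu> A h = set_lebesgue_integral (fst \<mu>) A h - set_lebesgue_integral (snd \<mu>) A h"

definition sint :: "rmeas \<Rightarrow> real \<Rightarrow> real \<Rightarrow> (real \<Rightarrow> complex) \<Rightarrow> complex" where
  "sint \<mu> c x h = (if c < x then rint \<mu> {c..<x} h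
                    else if x = c then 0 else - rint \<mu> {x..<c} h)"

definition loc_int :: "ereal \<Rightarrow> ereal \<Rightarrow> rmeas \<Rightarrow> (real \<Rightarrow> complex) \<Rightarrow> bool" where
  "loc_int a b \<mu> h \<longleftrightarrow> (\<forall>c\<in>Iab a b. \<forall>d\<in>Iab a b.
      set_integrable (fst \<mu>) {c..d} h \<and> set_integrable (snd \<mu>) {c..d} h)"

definition has_rn :: "ereal \<Rightarrow> ereal \<Rightarrow> rmeas \<Rightarrow> (real \<Rightarrow> complex) \<Rightarrow> (real \<Rightarrow> complex) \<Rightarrow> bool" where
  "has_rn a b \<mu> f h \<longleftrightarrow> loc_int a b \<mu> h \<and>
     (\<forall>c\<in>Iab a b. \<forall>x\<in>Iab a b. f x = f c + sint \<mu> c x h)"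

definition AC_loc :: "ereal \<Rightarrow> ereal \<Rightarrow> rmeas \<Rightarrow> (real \<Rightarrow> complex) set" where
  "AC_loc a b \<mu> = {f. \<exists>h. has_rn a b \<mu> f h}"

definition dom_pair :: "ereal \<Rightarrow> ereal \<Rightarrow> real measure \<Rightarrow> rmeas \<Rightarrow> rmeas \<Rightarrow> real \<Rightarrow>
    (real \<Rightarrow> complex) \<Rightarrow> (real \<Rightarrow> complex) \<Rightarrow> bool" where
  "dom_pair a b \<rho> \<sigma> chi c f F \<longleftrightarrow> f \<in> AC_loc a b \<sigma> \<and> F \<in> AC_loc a b (pos_rm \<rho>) \<and>
     (\<exists>h. has_rn a b \<sigma> f h \<and>
        (AE x in fst \<sigma>. x \<in> Iab a b \<longrightarrow> F x = - h x + sint chi c x f) \<and>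
        (AE x in snd \<sigma>. x \<in> Iab a b \<longrightarrow> F x = - h x + sint chi c x f))"

definition Dtau :: "ereal \<Rightarrow> ereal \<Rightarrow> real measure \<Rightarrow> rmeas \<Rightarrow> rmeas \<Rightarrow> real \<Rightarrow> (real \<Rightarrow> complex) set" where
  "Dtau a b \<rho> \<sigma> chi c = {f. \<exists>F. dom_pair a b \<rho> \<sigma> chi c f F}"

definition qder :: "rmeas \<Rightarrow> real \<Rightarrow> (real \<Rightarrow> complex) \<Rightarrow> (real \<Rightarrow> complex) \<Rightarrow> real \<Rightarrow> complex" where
  "qder chi c f F x = sint chi c x f - F x"

definition Wr :: "rmeas \<Rightarrow> real \<Rightarrow> (real \<Rightarrow> complex) \<Rightarrow> (real \<Rightarrow> complex) \<Rightarrow>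
    (real \<Rightarrow> complex) \<Rightarrow> (real \<Rightarrow> complex) \<Rightarrow> real \<Rightarrow> complex" where
  "Wr chi c f F g G x = f x * qder chi c g G x - qder chi c f F x * g x"

definition left_end :: "ereal \<Rightarrow> real filter" where
  "left_end a = (if a = -\<infinity> then at_bot else at_right (real_of_ereal a))"

definition right_end :: "ereal \<Rightarrow> real filter" where
  "right_end b = (if b = \<infinity> then at_top else at_left (real_of_ereal b))"

text \<open>Elements of L^2 are represented by (measurable, square integrable) functions;
  linear relations are sets of pairs of such functions, saturated under rho-a.e. equality.\<close>
definition L2 :: "real measure \<Rightarrow> (real \<Rightarrow> complex) set" where
  "L2 \<rho> = {u. u \<in> borel_measurable \<rho> \<and> (\<integral>\<^sup>+ x. ennreal ((cmod (u x))\<^sup>2) \<partial>\<rho>) < \<infinity>}"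

definition inner2 :: "real measure \<Rightarrow> (real \<Rightarrow> complex) \<Rightarrow> (real \<Rightarrow> complex) \<Rightarrow> complex" where
  "inner2 \<rho> f g = (\<integral> x. f x * cnj (g x) \<partial>\<rho>)"

definition norm2 :: "real measure \<Rightarrow> (real \<Rightarrow> complex) \<Rightarrow> real" where
  "norm2 \<rho> f = sqrt (\<integral> x. (cmod (f x))\<^sup>2 \<partial>\<rho>)"

type_synonym lrel = "((real \<Rightarrow> complex) \<times> (real \<Rightarrow> complex)) set"

definition lin_rel :: "real measure \<Rightarrow> lrel \<Rightarrow> bool" where
  "lin_rel \<rho> S \<longleftrightarrow> S \<subseteq> L2 \<rho> \<times> L2 \<rho> \<and> ((\<lambda>x. 0), (\<lambda>x. 0)) \<in> S \<and>
     (\<forall>u w u' w'. (u, w) \<in> S \<longrightarrow> (u', w') \<in> S \<longrightarrow> ((\<lambda>x. u x + u' x), (\<lambda>x. w x + w' x)) \<in> S) \<and>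
     (\<forall>u w (k::complex). (u, w) \<in> S \<longrightarrow> ((\<lambda>x. k * u x), (\<lambda>x. k * w x)) \<in> S) \<and>
     (\<forall>u w u' w'. (u, w) \<in> S \<longrightarrow> u' \<in> L2 \<rho> \<longrightarrow> w' \<in> L2 \<rho> \<longrightarrow>
        (AE x in \<rho>. u' x = u x) \<longrightarrow> (AE x in \<rho>. w' x = w x) \<longrightarrow> (u', w') \<in> S)"

definition adj :: "real measure \<Rightarrow> lrel \<Rightarrow> lrel" where
  "adj \<rho> S = {(u, w). u \<in> L2 \<rho> \<and> w \<in> L2 \<rho> \<and>
      (\<forall>f g. (f, g) \<in> S \<longrightarrow> inner2 \<rho> g u = inner2 \<rho> f w)}"

text \<open>rep p f F: the L^2 pair p = (u,w) is represented by f in D_tau (with associated F),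
  i.e. u = f and w = tau f = dF/drho (rho-a.e.).\<close>
definition rep :: "ereal \<Rightarrow> ereal \<Rightarrow> real measure \<Rightarrow> rmeas \<Rightarrow> rmeas \<Rightarrow> real \<Rightarrow>
    ((real \<Rightarrow> complex) \<times> (real \<Rightarrow> complex)) \<Rightarrow> (real \<Rightarrow> complex) \<Rightarrow> (real \<Rightarrow> complex) \<Rightarrow> bool" where
  "rep a b \<rho> \<sigma> chi c p f F \<longleftrightarrow> dom_pair a b \<rho> \<sigma> chi c f F \<and>
      has_rn a b (pos_rm \<rho>) F (snd p) \<and> (AE x in \<rho>. fst p x = f x)"

definition Tmax :: "ereal \<Rightarrow> ereal \<Rightarrow> real measure \<Rightarrow> rmeas \<Rightarrow> rmeas \<Rightarrow> real \<Rightarrow> lrel" where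
  "Tmax a b \<rho> \<sigma> chi c = {(u, w). u \<in> L2 \<rho> \<and> w \<in> L2 \<rho> \<and>
      (\<exists>f F. rep a b \<rho> \<sigma> chi c (u, w) f F)}"

definition T0 :: "ereal \<Rightarrow> ereal \<Rightarrow> real measure \<Rightarrow> rmeas \<Rightarrow> rmeas \<Rightarrow> real \<Rightarrow> lrel" where
  "T0 a b \<rho> \<sigma> chi c = {p \<in> Tmax a b \<rho> \<sigma> chi c. \<exists>f F. rep a b \<rho> \<sigma> chi c p f F \<and>
      (\<exists>\<alpha>\<in>Iab a b. \<exists>\<beta>\<in>Iab a b. \<forall>x\<in>Iab a b. x \<notin> {\<alpha>..\<beta>} \<longrightarrow> f x = 0)}"

definition Tmin :: "ereal \<Rightarrow> ereal \<Rightarrow> real measure \<Rightarrow> rmeas \<Rightarrow> rmeas \<Rightarrow> real \<Rightarrow> lrel" where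
  "Tmin a b \<rho> \<sigma> chi c = {(u, w). u \<in> L2 \<rho> \<and> w \<in> L2 \<rho> \<and>
      (\<forall>e>0. \<exists>(f, g)\<in>T0 a b \<rho> \<sigma> chi c.
          norm2 \<rho> (\<lambda>x. u x - f x) + norm2 \<rho> (\<lambda>x. w x - g x) < e)}"

definition conjp :: "((real \<Rightarrow> complex) \<times> (real \<Rightarrow> complex)) \<Rightarrow> ((real \<Rightarrow> complex) \<times> (real \<Rightarrow> complex))" where
  "conjp p = ((\<lambda>x. cnj (fst p x)), (\<lambda>x. cnj (snd p x)))"

definition W_end_zero :: "ereal \<Rightarrow> ereal \<Rightarrow> real measure \<Rightarrow> rmeas \<Rightarrow> rmeas \<Rightarrow> real \<Rightarrow> real filter \<Rightarrow>
    ((real \<Rightarrow> complex) \<times> (real \<Rightarrow> complex)) \<Rightarrow> ((real \<Rightarrow> complex) \<times> (real \<Rightarrow> complex)) \<Rightarrow> bool" where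
  "W_end_zero a b \<rho> \<sigma> chi c L p q \<longleftrightarrow> (\<forall>f F g G. rep a b \<rho> \<sigma> chi c p f F \<longrightarrow> rep a b \<rho> \<sigma> chi c q g G \<longrightarrow>
      ((\<lambda>x. Wr chi c f F g G x) \<longlongrightarrow> 0) L)"

definition is_solution :: "ereal \<Rightarrow> ereal \<Rightarrow> real measure \<Rightarrow> rmeas \<Rightarrow> rmeas \<Rightarrow> real \<Rightarrow>
    complex \<Rightarrow> (real \<Rightarrow> complex) \<Rightarrow> bool" where
  "is_solution a b \<rho> \<sigma> chi c z u \<longleftrightarrow>
     (\<exists>F. dom_pair a b \<rho> \<sigma> chi c u F \<and> has_rn a b (pos_rm \<rho>) F (\<lambda>x. z * u x))"

definition lc_left :: "ereal \<Rightarrow> ereal \<Rightarrow> real measure \<Rightarrow> rmeas \<Rightarrow> rmeas \<Rightarrow> real \<Rightarrow> bool" where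
  "lc_left a b \<rho> \<sigma> chi c \<longleftrightarrow> (\<forall>z u. is_solution a b \<rho> \<sigma> chi c z u \<longrightarrow>
     (\<forall>d\<in>Iab a b. set_nn_integral \<rho> {x \<in> Iab a b. x < d} (\<lambda>x. ennreal ((cmod (u x))\<^sup>2)) < \<infinity>))"

definition lc_right :: "ereal \<Rightarrow> ereal \<Rightarrow> real measure \<Rightarrow> rmeas \<Rightarrow> rmeas \<Rightarrow> real \<Rightarrow> bool" where
  "lc_right a b \<rho> \<sigma> chi c \<longleftrightarrow> (\<forall>z u. is_solution a b \<rho> \<sigma> chi c z u \<longrightarrow>
     (\<forall>d\<in>Iab a b. set_nn_integral \<rho> {x \<in> Iab a b. d < x} (\<lambda>x. ennreal ((cmod (u x))\<^sup>2)) < \<infinity>))"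

definition supp_pos :: "ereal \<Rightarrow> ereal \<Rightarrow> real measure \<Rightarrow> real set" where
  "supp_pos a b M = {x \<in> Iab a b. \<forall>e>0. emeasure M {x - e<..<x + e} > 0}"

definition supp_real :: "ereal \<Rightarrow> ereal \<Rightarrow> rmeas \<Rightarrow> real set" where
  "supp_real a b \<mu> = {x \<in> Iab a b. \<forall>e>0.
      emeasure (fst \<mu>) {x - e<..<x + e} + emeasure (snd \<mu>) {x - e<..<x + e} > 0}"

end

theory Submission
  imports Defs
begin

text \<open>The equation \<open>\<tau> f = w\<close> is the system \<open>df = k d\<sigma>\<close>, \<open>dk = f d\<chi> - w d\<rho>\<close> for \<open>f\<close> and its
  quasi-derivative \<open>k\<close>. By (H4) integration by parts has no jump terms, which yields the Lagrange identity
  and hence, for \<open>f, g\<close> in \<open>T_max\<close>, limits \<open>W(f, g)(a)\<close> and \<open>W(f, g)(b)\<close> whose difference is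
  \<open>\<langle>\<tau> f, g*\<rangle> - \<langle>f, \<tau> g*\<rangle>\<close>. Variation of constants gives \<open>T_0* \<subseteq> T_max\<close>, so
  \<open>T_min\<close> is the set of \<open>f\<close> in \<open>T_max\<close> for which this difference vanishes for every \<open>g\<close>.

  Everything else rests on the Pluecker identity
  \<open>W(p, q) W(r, s) + W(p, r) W(s, q) + W(p, s) W(q, r) = 0\<close>. If \<open>W(f, g)(b) \<noteq> 0\<close> for some \<open>f, g\<close> in \<open>T_max\<close>, it
  bounds every solution of \<open>\<tau> u = z u\<close> near \<open>b\<close> by \<open>f\<close> and \<open>g\<close>, so \<open>\<tau>\<close> is in the limit circle case
  there; thus the boundary form vanishes at a limit point end. At a limit circle end it is non-zero, because two
  solutions can be switched off before the other end, and modulo its radical it is a symplectic form on a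
  two-dimensional space: an element \<open>v\<close> outside \<open>T_min\<close> with \<open>W(v, v*)(a) = 0\<close> spans a Lagrangian subspace,
  and every self-adjoint restriction arises from such a subspace.\<close>

section \<open>Locally finite measures on an interval\<close>

text \<open>All three measures may have atoms. Solutions are then only left-continuous, an atom of
  large mass rules out a contraction on a short interval, and running the system to the left is not
  the mirror image of running it to the right. This shapes the first half: a Gronwall bound that
  passes each atom at the cost of a finite factor, and backward uniqueness through Wronskians
  instead of iteration.

  An element of \<open>Tmax\<close> is a pair of L2 classes, so boundary values make sense only if
  the pair determines \<open>f\<close> and its quasi-derivative at every point. Here the hypotheses
  on supports enter: full support of \<sigma> lets \<open>f\<close> determine its quasi-derivative,
  and (H5) with (H6) forces a solution of \<tau> f = 0 that vanishes \<rho>-a.e. to vanish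
  identically.

  Relations need not be graphs of operators, so adjoints and closures are formed among pairs, and
  the projection argument is carried out in L2 x L2.\<close>

lemma Iab_convex: "x \<in> Iab a b \<Longrightarrow> y \<in> Iab a b \<Longrightarrow> x \<le> t \<Longrightarrow> t \<le> y \<Longrightarrow> t \<in> Iab a b"
  unfolding Iab_def by (auto intro: less_le_trans le_less_trans)
    (meson dual_order.strict_trans2 ereal_less_eq(3) le_less_trans less_le_trans)+

lemma open_Iab: "open (Iab a b)"
proof -
  have "Iab a b = ereal -` {a<..<b}" by (auto simp: Iab_def)
  then show ?thesis by (simp add: open_ereal_vimage)
qed

lemma Iab_nbhd:
  assumes "x \<in> Iab a b"
  obtains d where "d > 0" "\<And>t. \<bar>t - x\<bar> \<le> d \<Longrightarrow> t \<in> Iab a b"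
proof -
  obtain e where "e > 0" "cball x e \<subseteq> Iab a b"
    using open_Iab assms open_contains_cball by blast
  then show ?thesis using that[of e] by (auto simp: dist_real_def abs_minus_commute subset_iff)
qed

lemma Iab_lower: "x \<in> Iab a b \<Longrightarrow> \<exists>y\<in>Iab a b. y < x"
proof -
  assume "x \<in> Iab a b"
  then obtain d where d: "d > 0" "\<And>t. \<bar>t - x\<bar> \<le> d \<Longrightarrow> t \<in> Iab a b" using Iab_nbhd by metis
  then show ?thesis by (intro bexI[of _ "x - d"]) auto
qed

lemma Iab_upper: "x \<in> Iab a b \<Longrightarrow> \<exists>y\<in>Iab a b. x < y"
proof -
  assume "x \<in> Iab a b"
  then obtain d where d: "d > 0" "\<And>t. \<bar>t - x\<bar> \<le> d \<Longrightarrow> t \<in> Iab a b" using Iab_nbhd by metis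
  then show ?thesis by (intro bexI[of _ "x + d"]) auto
qed

text \<open>Local statements about \<open>Iab a b\<close> reduce to countably many compact pieces.
  Empty pieces with \<open>snd (K n) < fst (K n)\<close> keep the lemma true when
  \<open>Iab a b\<close> is empty; the pair \<open>(1,0)\<close> codes such a piece and makes the
  enumerated set \<open>Q\<close> non-empty.\<close>

lemma Iab_cover:
  "\<exists>K::nat \<Rightarrow> real \<times> real. (\<forall>n. fst (K n) \<in> Iab a b \<or> snd (K n) < fst (K n)) \<and> (\<forall>n. snd (K n) \<in> Iab a b \<or> snd (K n) < fst (K n))
     \<and> (\<Union>n. {fst (K n)..snd (K n)}) = Iab a b"
proof -
  define Q where "Q = insert (1,0) {p \<in> \<rat> \<times> \<rat>. fst p \<in> Iab a b \<and> snd p \<in> Iab a b}"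
  have "Q \<subseteq> insert (1,0) (\<rat> \<times> \<rat>)" unfolding Q_def by blast
  moreover have "countable (insert (1,0) (\<rat> \<times> \<rat>) :: (real \<times> real) set)"
    by (intro countable_insert countable_SIGMA countable_rat)
  ultimately have "countable Q" by (rule countable_subset)
  moreover have "Q \<noteq> {}" unfolding Q_def by blast
  moreover define K where "K = from_nat_into Q"
  ultimately have K: "range K = Q" using range_from_nat_into[of Q] by simp
  have 1: "(\<Union>n. {fst (K n)..snd (K n)}) = (\<Union>p\<in>Q. {fst p..snd p})" using K by auto
  have "x \<in> (\<Union>p\<in>Q. {fst p..snd p})" if x: "x \<in> Iab a b" for x
  proof -
    obtain d where d: "d > 0" "\<And>t. \<bar>t - x\<bar> \<le> d \<Longrightarrow> t \<in> Iab a b" using Iab_nbhd x by metis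
    obtain q where q: "q \<in> \<rat>" "x - d < q" "q < x" using Rats_dense_in_real[of "x-d" x] d(1) by auto
    obtain r where r: "r \<in> \<rat>" "x < r" "r < x + d" using Rats_dense_in_real[of x "x+d"] d(1) by auto
    have "q \<in> Iab a b" "r \<in> Iab a b" using q r by (auto intro!: d(2))
    then have "(q,r) \<in> Q" unfolding Q_def using q(1) r(1) by simp
    moreover have "x \<in> {fst (q,r)..snd (q,r)}" using q r by simp
    ultimately show ?thesis by (rule UN_I)
  qed
  moreover have "{fst p..snd p} \<subseteq> Iab a b" if "p \<in> Q" for p
  proof (cases "p = (1,0)")
    case False
    then have "fst p \<in> Iab a b" "snd p \<in> Iab a b" using that by (auto simp: Q_def)
    then show ?thesis using Iab_convex[of "fst p" a b "snd p"] by auto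
  qed simp
  ultimately have 2: "(\<Union>n. {fst (K n)..snd (K n)}) = Iab a b" using 1 by auto
  have "(fst (K n) \<in> Iab a b \<and> snd (K n) \<in> Iab a b) \<or> snd (K n) < fst (K n)" for n
  proof -
    have "K n \<in> Q" using K by auto
    then show ?thesis unfolding Q_def by (elim insertE) auto
  qed
  then show ?thesis using 2 by (intro exI[of _ K]) auto
qed

lemma locfin_sets: "locfin a b M \<Longrightarrow> sets M = sets borel" by (simp add: locfin_def)
lemma locfin_space: "locfin a b M \<Longrightarrow> space M = UNIV"
  by (metis locfin_def sets_eq_imp_space_eq space_borel)

lemma locfin_finite:
  assumes "locfin a b M" "x \<in> Iab a b" "y \<in> Iab a b" "A \<subseteq> {x..y}"
  shows "emeasure M A < \<infinity>"
proof -
  have "emeasure M A \<le> emeasure M {x..y}"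
    using assms by (intro emeasure_mono) (auto simp: locfin_sets)
  also have "\<dots> < \<infinity>" using assms by (auto simp: locfin_def)
  finally show ?thesis .
qed

lemma locfin_sigma_finite: assumes "locfin a b M" shows "sigma_finite_measure M"
proof
  obtain K where K: "\<And>n::nat. fst (K n) \<in> Iab a b \<or> snd (K n) < fst (K n)"
    "\<And>n. snd (K n) \<in> Iab a b \<or> snd (K n) < fst (K n)" "(\<Union>n. {fst (K n)..snd (K n)}) = Iab a b"
    using Iab_cover[of a b] by metis
  have "emeasure M {fst (K n)..snd (K n)} \<noteq> \<infinity>" for n
  proof (cases "snd (K n) < fst (K n)")
    case False
    then have "fst (K n) \<in> Iab a b" "snd (K n) \<in> Iab a b" using K(1)[of n] K(2)[of n] by auto
    then show ?thesis using locfin_finite[OF assms _ _ order_refl] by (simp add: less_top)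
  qed auto
  moreover have "emeasure M (- Iab a b) = 0" using assms by (simp add: locfin_def)
  moreover have "Iab a b \<in> sets borel" using open_Iab by auto
  moreover have "- Iab a b \<union> (\<Union>n. {fst (K n)..snd (K n)}) = UNIV" using K(3) by blast
  ultimately show "\<exists>A. countable A \<and> A \<subseteq> sets M \<and> \<Union> A = space M \<and> (\<forall>a\<in>A. emeasure M a \<noteq> \<infinity>)"
    unfolding locfin_sets[OF assms] locfin_space[OF assms]
    apply (intro exI[of _ "insert (- Iab a b) (range (\<lambda>n. {fst (K n)..snd (K n)}))"] conjI)
    subgoal by simp
    subgoal by (simp add: image_subset_iff)
    subgoal by simp
    subgoal by auto
    done
qed

text \<open>Continuity from above. Arbitrary subsets \<open>B\<close> are allowed:
  \<open>emeasure\<close> of a non-measurable set is 0, and \<open>emeasure_mono\<close> asks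
  measurability only of the larger set.\<close>

lemma locfin_decseq_small:
  assumes M: "locfin a b M" and xy: "x \<in> Iab a b" "y \<in> Iab a b" and e: "e > 0"
    and A: "decseq A" "(\<Inter>i. A i) = {}" "\<And>i::nat. A i \<subseteq> {x..y}" "\<And>i. A i \<in> sets borel"
  shows "\<exists>i. \<forall>B. B \<subseteq> A i \<longrightarrow> measure M B < e"
proof -
  have fin: "emeasure M (A i) \<noteq> \<infinity>" for i
    using less_imp_neq[OF locfin_finite[OF M xy A(3)]] .
  have "range A \<subseteq> sets M" using A(4) by (auto simp: locfin_sets[OF M])
  then have "(\<lambda>i. emeasure M (A i)) \<longlonglongrightarrow> 0"
    using Lim_emeasure_decseq[OF _ A(1) fin] A(2) by simp
  then have "\<forall>\<^sub>F i in sequentially. emeasure M (A i) < ennreal e"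
    using e by (intro order_tendstoD(2)) auto
  then obtain i where i: "emeasure M (A i) < ennreal e" by (auto simp: eventually_sequentially)
  have "measure M B < e" if "B \<subseteq> A i" for B
  proof -
    have "emeasure M B \<le> emeasure M (A i)"
      using that A(4) by (intro emeasure_mono) (auto simp: locfin_sets[OF M])
    then have l: "emeasure M B < ennreal e" using i by order
    show ?thesis
      using emeasure_eq_ennreal_measure[of M B, OF less_imp_neq[OF less_le_trans[OF l top_greatest]]] l by (simp add: ennreal_less_iff)
  qed
  then show ?thesis by blast
qed

lemma Inter_shrinking_empty:
  fixes d :: real
  assumes "d > 0"
  shows "(\<Inter>i::nat. {x - d / Suc i..<x}) = {}" "(\<Inter>i::nat. {x<..<x + d / Suc i}) = {}"
proof -
  have "\<exists>i::nat. d / Suc i < z" if "z > 0" for z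
  proof -
    obtain i :: nat where "d / z < Suc i" using reals_Archimedean2 less_Suc_eq
      by (metis of_nat_less_iff order_less_trans lessI)
    then show ?thesis using that assms by (intro exI[of _ i]) (simp add: field_simps)
  qed
  note z = this
  have "\<exists>i::nat. y \<notin> {x - d / Suc i..<x}" for y
  proof (cases "y < x")
    case True
    then obtain i :: nat where "d / Suc i < x - y" using z[of "x - y"] by auto
    then show ?thesis by (intro exI[of _ i]) auto
  qed auto
  then show "(\<Inter>i::nat. {x - d / Suc i..<x}) = {}" by blast
  have "\<exists>i::nat. y \<notin> {x<..<x + d / Suc i}" for y
  proof (cases "x < y")
    case True
    then obtain i :: nat where "d / Suc i < y - x" using z[of "y - x"] by auto
    then show ?thesis by (intro exI[of _ i]) auto
  qed auto
  then show "(\<Inter>i::nat. {x<..<x + d / Suc i}) = {}" by blast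
qed

text \<open>Both tails leave out the point x, so they shrink to the empty set and their mass tends
  to 0 however large the atom at x is. One-sided limits and the Gronwall bound rest on this.\<close>

lemma locfin_tail:
  assumes M: "locfin a b M" and x: "x \<in> Iab a b" and e: "e > 0"
  shows locfin_tail_left: "\<exists>d>0. \<forall>t. x - d \<le> t \<longrightarrow> t < x \<longrightarrow> t \<in> Iab a b \<and> measure M {t..<x} < e"
    and locfin_tail_right: "\<exists>d>0. \<forall>t. t \<le> x + d \<longrightarrow> x < t \<longrightarrow> t \<in> Iab a b \<and> measure M {x<..<t} < e"
proof -
  obtain d where d: "d > 0" "\<And>t. \<bar>t - x\<bar> \<le> d \<Longrightarrow> t \<in> Iab a b" using Iab_nbhd x by metis
  have dI: "x - d \<in> Iab a b" "x + d \<in> Iab a b" using d by auto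
  have le: "d / Suc n \<le> d / Suc m" if "m \<le> n" for m n :: nat using d that by (intro divide_left_mono) auto
  have le0: "d / Suc n \<le> d" for n :: nat using le[of 0 n] by simp
  obtain i where i: "\<And>B. B \<subseteq> {x - d / Suc i..<x} \<Longrightarrow> measure M B < e"
  proof -
    have "\<exists>n. \<forall>B. B \<subseteq> {x - d / Suc n..<x} \<longrightarrow> measure M B < e"
    proof (rule locfin_decseq_small[OF M dI(1) x e _ Inter_shrinking_empty(1)[OF d(1)]])
      show "decseq (\<lambda>n. {x - d / Suc n..<x})" unfolding decseq_def
      proof (intro allI impI)
        fix m n :: nat assume "m \<le> n"
        from le[OF this] show "{x - d / Suc n..<x} \<subseteq> {x - d / Suc m..<x}" by auto
      qed
      show "{x - d / Suc n..<x} \<subseteq> {x - d..x}" for n using le0[of n] by auto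
    qed simp
    then show ?thesis using that by blast
  qed
  obtain j where j: "\<And>B. B \<subseteq> {x<..<x + d / Suc j} \<Longrightarrow> measure M B < e"
  proof -
    have "\<exists>n. \<forall>B. B \<subseteq> {x<..<x + d / Suc n} \<longrightarrow> measure M B < e"
    proof (rule locfin_decseq_small[OF M x dI(2) e _ Inter_shrinking_empty(2)[OF d(1)]])
      show "decseq (\<lambda>n. {x<..<x + d / Suc n})" unfolding decseq_def
      proof (intro allI impI)
        fix m n :: nat assume "m \<le> n"
        from le[OF this] show "{x<..<x + d / Suc n} \<subseteq> {x<..<x + d / Suc m}" by auto
      qed
      show "{x<..<x + d / Suc n} \<subseteq> {x..x + d}" for n using le0[of n] by auto
    qed simp
    then show ?thesis using that by blast
  qed
  show "\<exists>d>0. \<forall>t. x - d \<le> t \<longrightarrow> t < x \<longrightarrow> t \<in> Iab a b \<and> measure M {t..<x} < e"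
  proof (intro exI[of _ "d / Suc i"] conjI allI impI)
    fix t assume t: "x - d / Suc i \<le> t" "t < x"
    then show "measure M {t..<x} < e" by (intro i) auto
    show "t \<in> Iab a b" using t le0[of i] by (intro d(2)) auto
  qed (use d in auto)
  show "\<exists>d>0. \<forall>t. t \<le> x + d \<longrightarrow> x < t \<longrightarrow> t \<in> Iab a b \<and> measure M {x<..<t} < e"
  proof (intro exI[of _ "d / Suc j"] conjI allI impI)
    fix t assume t: "t \<le> x + d / Suc j" "x < t"
    then show "measure M {x<..<t} < e" by (intro j) auto
    show "t \<in> Iab a b" using t le0[of j] by (intro d(2)) auto
  qed (use d in auto)
qed

text \<open>The class in which f and its quasi-derivative live on compact intervals: closed under
  products, and integrable for every locally finite measure at once because measurability is
  Borel.\<close>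

definition bm :: "real \<Rightarrow> real \<Rightarrow> (real \<Rightarrow> complex) \<Rightarrow> bool" where
  "bm x y f \<longleftrightarrow> set_borel_measurable borel {x..y} f \<and> (\<exists>B. \<forall>t\<in>{x..y}. cmod (f t) \<le> B)"

lemma bm_subset: "bm x y f \<Longrightarrow> x \<le> s \<Longrightarrow> t \<le> y \<Longrightarrow> bm s t f"
  unfolding bm_def by (auto intro: set_borel_measurable_subset)
    (meson atLeastAtMost_iff order_trans)

lemma bm_cong: "bm x y f \<Longrightarrow> (\<And>t. x \<le> t \<Longrightarrow> t \<le> y \<Longrightarrow> f t = g t) \<Longrightarrow> bm x y g"
proof -
  assume *: "bm x y f" "\<And>t. x \<le> t \<Longrightarrow> t \<le> y \<Longrightarrow> f t = g t"
  then have "(\<lambda>t. indicator {x..y} t *\<^sub>R f t) = (\<lambda>t. indicator {x..y} t *\<^sub>R g t)"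
    by (intro ext) (auto simp: indicator_def)
  then show ?thesis using * unfolding bm_def set_borel_measurable_def by auto
qed

lemma bm_const: "bm x y (\<lambda>_. z)"
  unfolding bm_def set_borel_measurable_def by auto

lemma bm_add: assumes "bm x y f" "bm x y g" shows "bm x y (\<lambda>t. f t + g t)"
proof -
  obtain A B where "\<forall>t\<in>{x..y}. cmod (f t) \<le> A" "\<forall>t\<in>{x..y}. cmod (g t) \<le> B" using assms by (auto simp: bm_def)
  then have "\<forall>t\<in>{x..y}. cmod (f t + g t) \<le> A + B" by (meson add_mono norm_triangle_ineq order_trans)
  then show ?thesis using assms unfolding bm_def set_borel_measurable_def
    by (auto simp: scaleR_add_right)
qed

lemma bm_mult: assumes "bm x y f" "bm x y g" shows "bm x y (\<lambda>t. f t * g t)"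
proof -
  obtain A B where "\<forall>t\<in>{x..y}. cmod (f t) \<le> A" "\<forall>t\<in>{x..y}. cmod (g t) \<le> B" using assms by (auto simp: bm_def)
  then have "\<forall>t\<in>{x..y}. cmod (f t * g t) \<le> A * B"
    by (auto simp: norm_mult) (meson atLeastAtMost_iff mult_mono norm_ge_zero order_trans)
  moreover have "(\<lambda>t. indicator {x..y} t *\<^sub>R (f t * g t)) = (\<lambda>t. (indicator {x..y} t *\<^sub>R f t) * (indicator {x..y} t *\<^sub>R g t))"
    by (auto simp: indicator_def)
  moreover have "(\<lambda>t. (indicator {x..y} t *\<^sub>R f t) * (indicator {x..y} t *\<^sub>R g t)) \<in> borel_measurable borel"
    using assms unfolding bm_def set_borel_measurable_def by (intro borel_measurable_times) auto
  ultimately show ?thesis unfolding bm_def set_borel_measurable_def by (metis (no_types, lifting))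
qed

lemma bm_cmult: "bm x y f \<Longrightarrow> bm x y (\<lambda>t. z * f t)"
  by (intro bm_mult bm_const)

lemma bm_diff: assumes "bm x y f" "bm x y g" shows "bm x y (\<lambda>t. f t - g t)"
  using bm_add[OF assms(1) bm_cmult[OF assms(2), of "-1"]] by simp

lemma bm_cnj: "bm x y f \<Longrightarrow> bm x y (\<lambda>t. cnj (f t))"
proof -
  assume *: "bm x y f"
  have "(\<lambda>t. indicator {x..y} t *\<^sub>R cnj (f t)) = (\<lambda>t. cnj (indicator {x..y} t *\<^sub>R f t))"
    by auto
  moreover have "(\<lambda>t. cnj (indicator {x..y} t *\<^sub>R f t)) \<in> borel_measurable borel"
    using * unfolding bm_def set_borel_measurable_def
    by (intro borel_measurable_continuous_on[where f=cnj]) (auto intro: continuous_intros)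
  ultimately show ?thesis using * unfolding bm_def set_borel_measurable_def by auto
qed

lemma set_integrable_bm_mult:
  assumes "sets M = sets borel" "bm x y f" "set_integrable M {x..y} p"
  shows "set_integrable M {x..y} (\<lambda>t. f t * p t)"
proof -
  obtain B where B: "\<forall>t\<in>{x..y}. cmod (f t) \<le> B" using assms by (auto simp: bm_def)
  have [measurable]: "(\<lambda>t. indicator {x..y} t *\<^sub>R p t) \<in> borel_measurable M"
    using assms by (auto simp: set_integrable_def)
  have [measurable]: "(\<lambda>t. indicator {x..y} t *\<^sub>R f t) \<in> borel_measurable M"
    using assms by (auto simp: bm_def set_borel_measurable_def cong: measurable_cong_sets)
  have *: "(\<lambda>t. indicator {x..y} t *\<^sub>R (f t * p t)) = (\<lambda>t. (indicator {x..y} t *\<^sub>R f t) * (indicator {x..y} t *\<^sub>R p t))"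
    by (auto simp: indicator_def)
  have "integrable M (\<lambda>t. of_real \<bar>B\<bar> * (indicator {x..y} t *\<^sub>R p t))"
    using assms(3) unfolding set_integrable_def by (intro integrable_mult_right) auto
  then have "integrable M (\<lambda>t. (indicator {x..y} t *\<^sub>R f t) * (indicator {x..y} t *\<^sub>R p t))"
  proof (rule Bochner_Integration.integrable_bound)
    show "AE t in M. norm (indicator {x..y} t *\<^sub>R f t * (indicator {x..y} t *\<^sub>R p t))
         \<le> norm (of_real \<bar>B\<bar> * (indicator {x..y} t *\<^sub>R p t))"
      using B by (intro AE_I2) (auto simp: indicator_def norm_mult intro!: mult_right_mono order_trans[OF _ abs_ge_self])
  qed measurable
  then show ?thesis unfolding set_integrable_def * .
qed

lemma set_integrable_bm:
  assumes "locfin a b M" "x \<in> Iab a b" "y \<in> Iab a b" "bm x y f"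
  shows "set_integrable M {x..y} f"
proof -
  have "set_integrable M {x..y} (\<lambda>t. 1::complex)"
    unfolding set_integrable_def using assms locfin_finite[OF assms(1-3)]
    by (intro integrable_scaleR_left) (auto simp: locfin_sets)
  from set_integrable_bm_mult[OF locfin_sets[OF assms(1)] assms(4) this] show ?thesis by simp
qed

text \<open>The primitive is a parameter integral of the jointly measurable integrand on x <= s < t,
  bounded by the integral of |p| over [x, y].\<close>

lemma bm_primitive:
  assumes M: "locfin a b M" and p: "set_integrable M {x..y} p"
  shows "bm x y (\<lambda>t. LINT s:{x..<t}|M. p s)"
proof -
  interpret sigma_finite_measure M using locfin_sigma_finite[OF M] .
  have sM: "sets M = sets borel" by (rule locfin_sets[OF M])
  note [measurable_cong] = sM
  define P where "P s = indicator {x..y} s *\<^sub>R p s" for s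
  have P[measurable]: "P \<in> borel_measurable M" "integrable M P" using p by (auto simp: set_integrable_def P_def[abs_def])
  have eq: "(LINT s:{x..<t}|M. p s) = (\<integral>s. (if x \<le> s \<and> s < t then P s else 0) \<partial>M)" if "t \<le> y" for t
    unfolding set_lebesgue_integral_def
    using that by (intro Bochner_Integration.integral_cong) (auto simp: P_def indicator_def)
  have [measurable]: "P \<in> borel_measurable borel" using P(1) by (simp cong: measurable_cong_sets add: sM)
  have "(\<lambda>t. \<integral>s. (if x \<le> s \<and> s < t then P s else 0) \<partial>M) \<in> borel_measurable borel"
    by (rule borel_measurable_lebesgue_integral) (simp add: split_beta', measurable)
  then have "(\<lambda>t. indicator {x..y} t *\<^sub>R (\<integral>s. (if x \<le> s \<and> s < t then P s else 0) \<partial>M)) \<in> borel_measurable borel"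
    by measurable
  also have "?this \<longleftrightarrow> (\<lambda>t. indicator {x..y} t *\<^sub>R (LINT s:{x..<t}|M. p s)) \<in> borel_measurable borel"
    by (intro measurable_cong) (auto simp: indicator_def eq)
  finally have 1: "set_borel_measurable borel {x..y} (\<lambda>t. LINT s:{x..<t}|M. p s)"
    by (simp add: set_borel_measurable_def)
  have "cmod (LINT s:{x..<t}|M. p s) \<le> (\<integral>s. norm (P s) \<partial>M)" if "t \<le> y" for t
    unfolding eq[OF that] using P(2)
    by (intro integral_norm_bound[THEN order_trans] integral_mono integrable_norm)
      (auto intro!: Bochner_Integration.integrable_bound[OF P(2)])
  then show ?thesis using 1 unfolding bm_def by (meson atLeastAtMost_iff)
qed

section \<open>Integration by parts for measures with atoms\<close>

lemma locfin_countable_atoms: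
  assumes M: "locfin a b M" and xy: "x \<in> Iab a b" "y \<in> Iab a b"
  shows "countable {s\<in>{x..y}. measure M {s} \<noteq> 0}"
proof -
  define N where "N = density M (indicator {x..y})"
  have N: "emeasure N B = emeasure M (B \<inter> {x..y})" if "B \<in> sets borel" for B
    using emeasure_restricted[of "{x..y}" M B] that locfin_sets[OF M] by (simp add: N_def Int_commute)
  have "finite_measure N"
    using N[of UNIV] locfin_finite[OF M xy order_refl] locfin_space[OF M]
    by (intro finite_measureI) (auto simp: N_def space_density less_top)
  then interpret finite_measure N .
  have "countable {s. measure N {s} \<noteq> 0}" by (rule countable_support)
  moreover have "measure N {s} = measure M {s}" if "s \<in> {x..y}" for s
    using N[of "{s}"] that by (auto simp: measure_def)
  ultimately show ?thesis by (elim countable_subset[rotated]) auto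
qed

lemma integral_if_mult:
  fixes z :: complex
  shows "(\<integral>t. (if R t then z * Q t else 0) \<partial>N) = z * (\<integral>t. (if R t then Q t else 0) \<partial>N)"
proof -
  have "(\<integral>t. (if R t then z * Q t else 0) \<partial>N) = (\<integral>t. z * (if R t then Q t else 0) \<partial>N)"
    by (intro Bochner_Integration.integral_cong) auto
  then show ?thesis by simp
qed

text \<open>Fubini on the square [x, y) x [x, y), split into t < s, s < t and the diagonal. Only
  common atoms of \<open>M\<close> and \<open>N\<close> charge the diagonal, and
  \<open>atoms\<close> excludes them, so both inner integrals can run over half-open
  intervals.\<close>

lemma set_integral_parts:
  fixes p q :: "real \<Rightarrow> complex"
  assumes M: "locfin a b M" and N: "locfin a b N" and xy: "x \<in> Iab a b" "y \<in> Iab a b"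
    and p: "set_integrable M {x..y} p" and q: "set_integrable N {x..y} q"
    and atoms: "\<And>s. s \<in> {x..y} \<Longrightarrow> measure M {s} = 0 \<or> measure N {s} = 0"
  shows "(LINT s:{x..<y}|M. p s) * (LINT t:{x..<y}|N. q t) =
    (LINT s:{x..<y}|M. p s * (LINT t:{x..<s}|N. q t)) + (LINT t:{x..<y}|N. q t * (LINT s:{x..<t}|M. p s))"
proof -
  interpret M: sigma_finite_measure M using locfin_sigma_finite[OF M] .
  interpret N: sigma_finite_measure N using locfin_sigma_finite[OF N] .
  interpret MN: pair_sigma_finite M N ..
  have [measurable_cong]: "sets M = sets borel" "sets N = sets borel"
    using M N by (simp_all add: locfin_sets)
  define P Q where "P s = indicator {x..<y} s *\<^sub>R p s" and "Q s = indicator {x..<y} s *\<^sub>R q s" for s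
  have "set_integrable M {x..<y} p" "set_integrable N {x..<y} q"
    using p q by (auto intro: set_integrable_subset)
  then have iP: "integrable M P" and iQ: "integrable N Q"
    by (auto simp: set_integrable_def P_def[abs_def] Q_def[abs_def])
  note [measurable] = borel_measurable_integrable[OF iP] borel_measurable_integrable[OF iQ]
  have iPQ: "integrable (M \<Otimes>\<^sub>M N) (\<lambda>z. P (fst z) * Q (snd z))"
  proof (rule MN.Fubini_integrable)
    show "integrable M (\<lambda>s. \<integral>t. norm (P (fst (s,t)) * Q (snd (s,t))) \<partial>N)"
      using iP iQ by (simp add: norm_mult)
    show "AE s in M. integrable N (\<lambda>t. P (fst (s,t)) * Q (snd (s,t)))" using iQ by simp
  qed measurable
  have i1: "integrable (M \<Otimes>\<^sub>M N) (\<lambda>(s,t). if s < t then P s * Q t else 0)"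
    by (rule Bochner_Integration.integrable_bound[OF iPQ]) (auto simp: split_beta')
  have iQ': "integrable N (\<lambda>t. if R t then Q t else 0)" if [measurable]: "Measurable.pred borel R" for R
    by (rule Bochner_Integration.integrable_bound[OF iQ]) auto
  \<comment> \<open>The inner integral is \<open>Q s\<close> times the mass of \<open>N\<close> at
    s. It is non-zero at most on the countable set of atoms of \<open>N\<close>, which
    \<open>M\<close> does not charge.\<close>
  have null: "AE s in M. P s * (\<integral>t. (if t = s then Q t else 0) \<partial>N) = 0"
  proof -
    let ?C = "{s\<in>{x..y}. measure N {s} \<noteq> 0}"
    have cou: "countable ?C" using locfin_countable_atoms[OF N xy] .
    have "AE s in M. s \<notin> ?C"
    proof (rule AE_I')
      have "{s} \<in> null_sets M" if "s \<in> ?C" for s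
      proof -
        have "emeasure M {s} \<noteq> \<infinity>" using locfin_finite[OF M xy, of "{s}"] that by auto
        moreover have "measure M {s} = 0" using that atoms[of s] by auto
        ultimately have "emeasure M {s} = 0"
          by (simp add: measure_def enn2real_eq_0_iff)
        then show ?thesis by auto
      qed
      then have "(\<Union>s\<in>?C. {s}) \<in> null_sets M" using cou by (intro null_sets_UN') auto
      then show "?C \<in> null_sets M" by simp
    qed auto
    then show ?thesis
    proof (rule AE_mp, intro AE_I2 impI)
      fix s assume s: "s \<notin> ?C"
      show "P s * (\<integral>t. (if t = s then Q t else 0) \<partial>N) = 0"
      proof (cases "s \<in> {x..y}")
        case True
        have "(\<integral>t. (if t = s then Q t else 0) \<partial>N) = (\<integral>t. indicator {s} t *\<^sub>R Q s \<partial>N)"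
          by (intro Bochner_Integration.integral_cong) (auto simp: indicator_def)
        also have "\<dots> = measure N {s} *\<^sub>R Q s"
          using locfin_finite[OF N xy, of "{s}"] True by (subst integral_scaleR_left) auto
        also have "\<dots> = 0" using s True by auto
        finally show ?thesis by simp
      qed (auto simp: P_def)
    qed
  qed
  have split: "P s * (\<integral>t. Q t \<partial>N) = P s * (\<integral>t. (if t < s then Q t else 0) \<partial>N)
     + P s * (\<integral>t. (if t = s then Q t else 0) \<partial>N) + P s * (\<integral>t. (if s < t then Q t else 0) \<partial>N)" for s
  proof -
    have "(\<integral>t. Q t \<partial>N) = (\<integral>t. (if t < s then Q t else 0) + (if t = s then Q t else 0) + (if s < t then Q t else 0) \<partial>N)"
      by (intro Bochner_Integration.integral_cong) auto
    also have "\<dots> = (\<integral>t. (if t < s then Q t else 0) \<partial>N) + (\<integral>t. (if t = s then Q t else 0) \<partial>N) + (\<integral>t. (if s < t then Q t else 0) \<partial>N)"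
    proof -
      have "integrable N (\<lambda>t. if t < s then Q t else 0)" "integrable N (\<lambda>t. if t = s then Q t else 0)"
        "integrable N (\<lambda>t. if s < t then Q t else 0)" by (rule iQ'; measurable)+
      then show ?thesis by (simp add: Bochner_Integration.integral_add Bochner_Integration.integrable_add)
    qed
    finally show ?thesis by (simp add: algebra_simps)
  qed
  have bd: "integrable M (\<lambda>s. P s * (\<integral>t. (if R s t then Q t else 0) \<partial>N))"
    if [measurable]: "Measurable.pred (borel \<Otimes>\<^sub>M borel) (\<lambda>z. R (fst z) (snd z))" for R
  proof -
    have "integrable (M \<Otimes>\<^sub>M N) (\<lambda>z. if R (fst z) (snd z) then P (fst z) * Q (snd z) else 0)"
      by (rule Bochner_Integration.integrable_bound[OF iPQ]) auto
    from MN.integrable_fst'[OF this]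
    have "integrable M (\<lambda>s. \<integral>t. (if R s t then P s * Q t else 0) \<partial>N)" by (simp cong: if_cong)
    then show ?thesis by (simp add: integral_if_mult)
  qed
  have "(\<integral>s. P s \<partial>M) * (\<integral>t. Q t \<partial>N) = (\<integral>s. P s * (\<integral>t. Q t \<partial>N) \<partial>M)" by simp
  also have "\<dots> = (\<integral>s. P s * (\<integral>t. (if t < s then Q t else 0) \<partial>N) + P s * (\<integral>t. (if s < t then Q t else 0) \<partial>N) \<partial>M)"
  proof (rule integral_cong_AE)
    show "AE s in M. P s * (\<integral>t. Q t \<partial>N) = P s * (\<integral>t. (if t < s then Q t else 0) \<partial>N) + P s * (\<integral>t. (if s < t then Q t else 0) \<partial>N)"
      using null by eventually_elim (subst split, simp)
    show "(\<lambda>s. P s * (\<integral>t. (if t < s then Q t else 0) \<partial>N) + P s * (\<integral>t. (if s < t then Q t else 0) \<partial>N)) \<in> borel_measurable M"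
      by (intro borel_measurable_integrable Bochner_Integration.integrable_add bd) measurable
  qed measurable
  also have "\<dots> = (\<integral>s. P s * (\<integral>t. (if t < s then Q t else 0) \<partial>N) \<partial>M) + (\<integral>s. P s * (\<integral>t. (if s < t then Q t else 0) \<partial>N) \<partial>M)"
    by (intro Bochner_Integration.integral_add bd) measurable
  also have "(\<integral>s. P s * (\<integral>t. (if s < t then Q t else 0) \<partial>N) \<partial>M) = (\<integral>s. (\<integral>t. (if s < t then P s * Q t else 0) \<partial>N) \<partial>M)"
    by (simp add: integral_if_mult)
  also have "\<dots> = (\<integral>t. (\<integral>s. (if s < t then P s * Q t else 0) \<partial>M) \<partial>N)"
    by (rule MN.Fubini_integral[OF i1, symmetric])
  also have "\<dots> = (\<integral>t. Q t * (\<integral>s. (if s < t then P s else 0) \<partial>M) \<partial>N)"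
    unfolding integral_if_mult[symmetric] mult.commute[of "Q _" "P _"] by (rule refl)
  finally have main: "(\<integral>s. P s \<partial>M) * (\<integral>t. Q t \<partial>N) = (\<integral>s. P s * (\<integral>t. (if t < s then Q t else 0) \<partial>N) \<partial>M)
    + (\<integral>t. Q t * (\<integral>s. (if s < t then P s else 0) \<partial>M) \<partial>N)" .
  have e1: "P s * (\<integral>t. (if t < s then Q t else 0) \<partial>N) = indicator {x..<y} s *\<^sub>R (p s * (LINT t:{x..<s}|N. q t))" for s
  proof (cases "s \<in> {x..<y}")
    case True
    have "(\<integral>t. (if t < s then Q t else 0) \<partial>N) = (LINT t:{x..<s}|N. q t)"
      unfolding set_lebesgue_integral_def Q_def using True
      by (intro Bochner_Integration.integral_cong) (auto simp: indicator_def)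
    then show ?thesis using True by (simp add: P_def)
  qed (simp add: P_def)
  have e2: "Q s * (\<integral>t. (if t < s then P t else 0) \<partial>M) = indicator {x..<y} s *\<^sub>R (q s * (LINT t:{x..<s}|M. p t))" for s
  proof (cases "s \<in> {x..<y}")
    case True
    have "(\<integral>t. (if t < s then P t else 0) \<partial>M) = (LINT t:{x..<s}|M. p t)"
      unfolding set_lebesgue_integral_def P_def using True
      by (intro Bochner_Integration.integral_cong) (auto simp: indicator_def)
    then show ?thesis using True by (simp add: Q_def)
  qed (simp add: Q_def)
  show ?thesis using main unfolding e1 e2 by (simp add: P_def Q_def set_lebesgue_integral_def)
qed

section \<open>Integrals with respect to a signed measure\<close>

definition rset_int :: "rmeas \<Rightarrow> real set \<Rightarrow> (real \<Rightarrow> complex) \<Rightarrow> bool" where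
  "rset_int \<mu> A h \<longleftrightarrow> set_integrable (fst \<mu>) A h \<and> set_integrable (snd \<mu>) A h"

definition rlocfin :: "ereal \<Rightarrow> ereal \<Rightarrow> rmeas \<Rightarrow> bool" where
  "rlocfin a b \<mu> \<longleftrightarrow> locfin a b (fst \<mu>) \<and> locfin a b (snd \<mu>)"

definition tv :: "rmeas \<Rightarrow> real set \<Rightarrow> real" where
  "tv \<mu> A = measure (fst \<mu>) A + measure (snd \<mu>) A"

lemma rlocfin_pos_rm: "locfin a b M \<Longrightarrow> rlocfin a b (pos_rm M)"
  by (auto simp: rlocfin_def pos_rm_def locfin_def emeasure_null_measure)

lemma real_meas_rlocfin: "real_meas a b \<mu> \<Longrightarrow> rlocfin a b \<mu>"
  by (auto simp: rlocfin_def real_meas_def)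

lemma loc_int_rset: "loc_int a b \<mu> h \<longleftrightarrow> (\<forall>x\<in>Iab a b. \<forall>y\<in>Iab a b. rset_int \<mu> {x..y} h)"
  by (auto simp: loc_int_def rset_int_def)

lemma rint_pos_rm: "rint (pos_rm M) A h = set_lebesgue_integral M A h"
  by (simp add: rint_def pos_rm_def set_lebesgue_integral_def integral_null_measure)

lemma rset_int_pos_rm: "rset_int (pos_rm M) A h \<longleftrightarrow> set_integrable M A h"
proof -
  have "set_integrable M A h \<Longrightarrow> set_integrable (null_measure M) A h"
    unfolding set_integrable_def integrable_iff_bounded
    by (auto simp: nn_integral_null_measure cong: measurable_cong_sets)
  then show ?thesis by (auto simp: rset_int_def pos_rm_def)
qed

lemma rset_int_subset:
  "rlocfin a b \<mu> \<Longrightarrow> rset_int \<mu> A h \<Longrightarrow> B \<subseteq> A \<Longrightarrow> B \<in> sets borel \<Longrightarrow> rset_int \<mu> B h"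
  unfolding rset_int_def by (auto intro: set_integrable_subset simp: rlocfin_def locfin_sets)

lemma rset_int_add: "rset_int \<mu> A f \<Longrightarrow> rset_int \<mu> A g \<Longrightarrow> rset_int \<mu> A (\<lambda>t. f t + g t)"
  by (auto simp: rset_int_def)

lemma rset_int_cmult: "rset_int \<mu> A f \<Longrightarrow> rset_int \<mu> A (\<lambda>t. z * f t)"
  by (auto simp: rset_int_def)

lemma rint_lin:
  "rset_int \<mu> A f \<Longrightarrow> rset_int \<mu> A g \<Longrightarrow>
   rint \<mu> A (\<lambda>t. z * f t + w * g t) = z * rint \<mu> A f + w * rint \<mu> A g"
  unfolding rset_int_def rint_def by (auto simp: algebra_simps)

lemma rint_add:
  "rset_int \<mu> A f \<Longrightarrow> rset_int \<mu> A g \<Longrightarrow> rint \<mu> A (\<lambda>t. f t + g t) = rint \<mu> A f + rint \<mu> A g"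
  using rint_lin[of \<mu> A f g 1 1] by simp

lemma rint_diff:
  "rset_int \<mu> A f \<Longrightarrow> rset_int \<mu> A g \<Longrightarrow> rint \<mu> A (\<lambda>t. f t - g t) = rint \<mu> A f - rint \<mu> A g"
  using rint_lin[of \<mu> A f g 1 "-1"] by simp

lemma rint_cnj: "rint \<mu> A (\<lambda>t. cnj (f t)) = cnj (rint \<mu> A f)"
proof -
  have "(LINT t:A|M. cnj (f t)) = cnj (LINT t:A|M. f t)" for M :: "real measure"
  proof -
    have "(\<lambda>t. indicator A t *\<^sub>R cnj (f t)) = (\<lambda>t. cnj (indicator A t *\<^sub>R f t))" by simp
    then show ?thesis unfolding set_lebesgue_integral_def by (simp only: Bochner_Integration.integral_cnj)
  qed
  then show ?thesis by (simp add: rint_def)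
qed

lemma rset_int_cnj: "rset_int \<mu> A f \<Longrightarrow> rset_int \<mu> A (\<lambda>t. cnj (f t))"
proof -
  have "set_integrable M A f \<Longrightarrow> set_integrable M A (\<lambda>t. cnj (f t))" for M :: "real measure"
    unfolding set_integrable_def complex_integrable_cnj[of _ "\<lambda>x. indicator A x *\<^sub>R f x", symmetric] by simp
  then show "rset_int \<mu> A f \<Longrightarrow> rset_int \<mu> A (\<lambda>t. cnj (f t))" by (auto simp: rset_int_def)
qed

lemma rint_cong: "(\<And>t. t \<in> A \<Longrightarrow> f t = g t) \<Longrightarrow> rint \<mu> A f = rint \<mu> A g"
proof -
  assume "\<And>t. t \<in> A \<Longrightarrow> f t = g t"
  then have "(\<lambda>t. indicator A t *\<^sub>R f t) = (\<lambda>t. indicator A t *\<^sub>R g t)"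
    by (intro ext) (auto simp: indicator_def)
  then show ?thesis by (simp add: rint_def set_lebesgue_integral_def)
qed

lemma rint_empty [simp]: "rint \<mu> {} f = 0"
  by (simp add: rint_def set_lebesgue_integral_def)

lemma rint_split:
  assumes "rlocfin a b \<mu>" "rset_int \<mu> {x..<z} h" "x \<le> y" "y \<le> z"
  shows "rint \<mu> {x..<z} h = rint \<mu> {x..<y} h + rint \<mu> {y..<z} h"
proof -
  have *: "{x..<z} = {x..<y} \<union> {y..<z}" using assms by auto
  have "rset_int \<mu> {x..<y} h" "rset_int \<mu> {y..<z} h"
    using assms by (auto intro: rset_int_subset)
  then show ?thesis unfolding rint_def * rset_int_def
    by (subst (1 2) set_integral_Un) auto
qed

lemma rint_split_left:
  assumes "rlocfin a b \<mu>" "rset_int \<mu> {x..<z} h" "x < z"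
  shows "rint \<mu> {x..<z} h = rint \<mu> {x} h + rint \<mu> {x<..<z} h"
proof -
  have *: "{x..<z} = {x} \<union> {x<..<z}" using assms by auto
  have "rset_int \<mu> {x} h" "rset_int \<mu> {x<..<z} h"
    using assms by (auto intro: rset_int_subset)
  then show ?thesis unfolding rint_def * rset_int_def
    by (subst (1 2) set_integral_Un) auto
qed

lemma rset_int_bm:
  "rlocfin a b \<mu> \<Longrightarrow> x \<in> Iab a b \<Longrightarrow> y \<in> Iab a b \<Longrightarrow> bm x y f \<Longrightarrow> rset_int \<mu> {x..y} f"
  by (auto simp: rset_int_def rlocfin_def intro: set_integrable_bm)

lemma rset_int_bm_mult:
  "rlocfin a b \<mu> \<Longrightarrow> bm x y f \<Longrightarrow> rset_int \<mu> {x..y} p \<Longrightarrow> rset_int \<mu> {x..y} (\<lambda>t. f t * p t)"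
  by (auto simp: rset_int_def rlocfin_def locfin_sets intro: set_integrable_bm_mult)

lemma rint_bound:
  assumes \<mu>: "rlocfin a b \<mu>" and xy: "x \<in> Iab a b" "y \<in> Iab a b" and A: "A \<subseteq> {x..y}" "A \<in> sets borel"
    and B: "\<And>t. t \<in> A \<Longrightarrow> cmod (h t) \<le> B"
  shows "cmod (rint \<mu> A h) \<le> B * tv \<mu> A"
proof -
  have 1: "cmod (LINT t:A|M. h t) \<le> B * measure M A" if M: "locfin a b M" for M
  proof (cases "A = {}")
    case False
    then have B0: "B \<ge> 0" using B norm_ge_zero order_trans by (metis ex_in_conv)
    have int: "integrable M (\<lambda>t. B * indicator A t)"
      using locfin_finite[OF M xy A(1)] A locfin_sets[OF M] by (intro integrable_mult_right integrable_real_indicator) auto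
    have "cmod (LINT t:A|M. h t) \<le> (\<integral>t. B * indicator A t \<partial>M)"
      unfolding set_lebesgue_integral_def
    proof (cases "integrable M (\<lambda>t. indicator A t *\<^sub>R h t)")
      case True
      then show "cmod (\<integral>t. indicator A t *\<^sub>R h t \<partial>M) \<le> (\<integral>t. B * indicator A t \<partial>M)"
        by (rule Bochner_Integration.integral_norm_bound_integral[OF _ int]) (use B B0 in \<open>auto simp: indicator_def\<close>)
    next
      \<comment> \<open>A non-integrable function has integral 0, so the bound holds for it as
        well.\<close>
      case False
      then show "cmod (\<integral>t. indicator A t *\<^sub>R h t \<partial>M) \<le> (\<integral>t. B * indicator A t \<partial>M)"
        using B0 by (simp add: not_integrable_integral_eq Bochner_Integration.integral_nonneg)
    qed
    also have "\<dots> = B * measure M A"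
      using locfin_sets[OF M] locfin_space[OF M] A by simp
    finally show ?thesis .
  qed (simp add: set_lebesgue_integral_def)
  have "cmod (rint \<mu> A h) \<le> cmod (LINT t:A|fst \<mu>. h t) + cmod (LINT t:A|snd \<mu>. h t)"
    unfolding rint_def by (rule norm_triangle_ineq4)
  also have "\<dots> \<le> B * tv \<mu> A"
    using 1[of "fst \<mu>"] 1[of "snd \<mu>"] \<mu> unfolding tv_def rlocfin_def by (simp add: distrib_left)
  finally show ?thesis .
qed

lemma bm_rint:
  assumes "rlocfin a b \<mu>" "rset_int \<mu> {x..y} p" shows "bm x y (\<lambda>t. rint \<mu> {x..<t} p)"
  unfolding rint_def using assms
  by (intro bm_diff bm_primitive) (auto simp: rlocfin_def rset_int_def)

lemma tv_tail_left:
  assumes "rlocfin a b \<mu>" "x \<in> Iab a b" "e > 0"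
  shows "\<exists>d>0. \<forall>t. x - d \<le> t \<longrightarrow> t < x \<longrightarrow> t \<in> Iab a b \<and> tv \<mu> {t..<x} < e"
proof -
  obtain d1 where d1: "d1 > 0" "\<forall>t. x - d1 \<le> t \<longrightarrow> t < x \<longrightarrow> t \<in> Iab a b \<and> measure (fst \<mu>) {t..<x} < e/2"
    using locfin_tail_left[of a b "fst \<mu>" x "e/2"] assms by (auto simp: rlocfin_def)
  obtain d2 where d2: "d2 > 0" "\<forall>t. x - d2 \<le> t \<longrightarrow> t < x \<longrightarrow> t \<in> Iab a b \<and> measure (snd \<mu>) {t..<x} < e/2"
    using locfin_tail_left[of a b "snd \<mu>" x "e/2"] assms by (auto simp: rlocfin_def)
  show ?thesis
  proof (intro exI[of _ "min d1 d2"] conjI allI impI)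
    fix t assume t: "x - min d1 d2 \<le> t" "t < x"
    then show "t \<in> Iab a b" using d1 by auto
    have "measure (fst \<mu>) {t..<x} < e/2" "measure (snd \<mu>) {t..<x} < e/2" using d1(2) d2(2) t by auto
    then show "tv \<mu> {t..<x} < e" unfolding tv_def by simp
  qed (use d1 d2 in auto)
qed

lemma tv_tail_right:
  assumes "rlocfin a b \<mu>" "x \<in> Iab a b" "e > 0"
  shows "\<exists>d>0. \<forall>t. t \<le> x + d \<longrightarrow> x < t \<longrightarrow> t \<in> Iab a b \<and> tv \<mu> {x<..<t} < e"
proof -
  obtain d1 where d1: "d1 > 0" "\<forall>t. t \<le> x + d1 \<longrightarrow> x < t \<longrightarrow> t \<in> Iab a b \<and> measure (fst \<mu>) {x<..<t} < e/2"
    using locfin_tail_right[of a b "fst \<mu>" x "e/2"] assms by (auto simp: rlocfin_def)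
  obtain d2 where d2: "d2 > 0" "\<forall>t. t \<le> x + d2 \<longrightarrow> x < t \<longrightarrow> t \<in> Iab a b \<and> measure (snd \<mu>) {x<..<t} < e/2"
    using locfin_tail_right[of a b "snd \<mu>" x "e/2"] assms by (auto simp: rlocfin_def)
  show ?thesis
  proof (intro exI[of _ "min d1 d2"] conjI allI impI)
    fix t assume t: "t \<le> x + min d1 d2" "x < t"
    then show "t \<in> Iab a b" using d1 by auto
    have "measure (fst \<mu>) {x<..<t} < e/2" "measure (snd \<mu>) {x<..<t} < e/2" using d1(2) d2(2) t by auto
    then show "tv \<mu> {x<..<t} < e" unfolding tv_def by simp
  qed (use d1 d2 in auto)
qed

text \<open>Expand into the four pairs of Jordan components. \<open>tv\<close> vanishes at a point
  only if both components do, so every pair inherits \<open>atoms\<close>.\<close>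

lemma rint_parts:
  assumes \<mu>: "rlocfin a b \<mu>" and \<nu>: "rlocfin a b \<nu>" and xy: "x \<in> Iab a b" "y \<in> Iab a b"
    and p: "rset_int \<mu> {x..y} p" and q: "rset_int \<nu> {x..y} q"
    and atoms: "\<And>s. s \<in> {x..y} \<Longrightarrow> tv \<mu> {s} = 0 \<or> tv \<nu> {s} = 0"
  shows "rint \<mu> {x..<y} p * rint \<nu> {x..<y} q =
    rint \<mu> {x..<y} (\<lambda>s. p s * rint \<nu> {x..<s} q) + rint \<nu> {x..<y} (\<lambda>t. q t * rint \<mu> {x..<t} p)"
proof -
  have atoms': "measure M {s} = 0 \<or> measure N {s} = 0"
    if "s \<in> {x..y}" "M \<in> {fst \<mu>, snd \<mu>}" "N \<in> {fst \<nu>, snd \<nu>}" for s M N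
  proof -
    have "(measure (fst \<mu>) {s} = 0 \<and> measure (snd \<mu>) {s} = 0) \<or> (measure (fst \<nu>) {s} = 0 \<and> measure (snd \<nu>) {s} = 0)"
      using atoms[OF that(1)] by (simp add: tv_def add_nonneg_eq_0_iff)
    then show ?thesis using that(2,3) by blast
  qed
  have lM: "locfin a b M" "set_integrable M {x..y} p" if "M \<in> {fst \<mu>, snd \<mu>}" for M
    using that \<mu> p by (auto simp: rlocfin_def rset_int_def)
  have lN: "locfin a b N" "set_integrable N {x..y} q" if "N \<in> {fst \<nu>, snd \<nu>}" for N
    using that \<nu> q by (auto simp: rlocfin_def rset_int_def)
  have parts: "(LINT s:{x..<y}|M. p s) * (LINT t:{x..<y}|N. q t) =
    (LINT s:{x..<y}|M. p s * (LINT t:{x..<s}|N. q t)) + (LINT t:{x..<y}|N. q t * (LINT s:{x..<t}|M. p s))"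
    if "M \<in> {fst \<mu>, snd \<mu>}" "N \<in> {fst \<nu>, snd \<nu>}" for M N
    using lM[OF that(1)] lN[OF that(2)] xy atoms'[OF _ that] by (intro set_integral_parts[of a b]) auto
  have i0: "set_integrable M {x..<y} (\<lambda>s. p s * (LINT t:{x..<s}|N. q t))"
    if M: "locfin a b M" and N: "locfin a b N" and p: "set_integrable M {x..y} p" and q: "set_integrable N {x..y} q" for M N and p q :: "real \<Rightarrow> complex"
  proof -
    have "set_integrable M {x..y} (\<lambda>s. (LINT t:{x..<s}|N. q t) * p s)"
      by (rule set_integrable_bm_mult[OF locfin_sets[OF M] bm_primitive[OF N q] p])
    then have "set_integrable M {x..<y} (\<lambda>s. (LINT t:{x..<s}|N. q t) * p s)"
      by (rule set_integrable_subset) (auto simp: locfin_sets[OF M])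
    then show ?thesis by (simp add: mult.commute)
  qed
  have i1: "set_integrable M {x..<y} (\<lambda>s. p s * (LINT t:{x..<s}|N. q t))"
    and i2: "set_integrable N {x..<y} (\<lambda>s. q s * (LINT t:{x..<s}|M. p t))"
    if "M \<in> {fst \<mu>, snd \<mu>}" "N \<in> {fst \<nu>, snd \<nu>}" for M N
    using i0 lM[OF that(1)] lN[OF that(2)] by blast+
  show ?thesis unfolding rint_def
    by (simp add: right_diff_distrib left_diff_distrib parts i1 i2 set_integral_diff)
qed

text \<open>Additivity of the oriented integral, whatever the position of c relative to x and
  y.\<close>

lemma sint_step:
  assumes \<mu>: "rlocfin a b \<mu>" and h: "loc_int a b \<mu> h" and xy: "x \<in> Iab a b" "y \<in> Iab a b" "c \<in> Iab a b" "x \<le> y"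
  shows "sint \<mu> c y h = sint \<mu> c x h + rint \<mu> {x..<y} h"
proof -
  have i: "rset_int \<mu> {s..<t} h" if "s \<in> Iab a b" "t \<in> Iab a b" for s t
    by (rule rset_int_subset[OF \<mu>, of "{s..t}"]) (use h that in \<open>auto simp: loc_int_rset\<close>)
  consider "c \<le> x" | "x < c" "c < y" | "x < c" "y \<le> c" by linarith
  then show ?thesis
  proof cases
    case 1
    then have "rint \<mu> {c..<y} h = rint \<mu> {c..<x} h + rint \<mu> {x..<y} h"
      using xy by (intro rint_split[OF \<mu>] i) auto
    then show ?thesis using 1 xy by (auto simp: sint_def)
  next
    case 2
    then have "rint \<mu> {x..<y} h = rint \<mu> {x..<c} h + rint \<mu> {c..<y} h"
      using xy by (intro rint_split[OF \<mu>] i) auto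
    then show ?thesis using 2 xy by (auto simp: sint_def)
  next
    case 3
    then have "rint \<mu> {x..<c} h = rint \<mu> {x..<y} h + rint \<mu> {y..<c} h"
      using xy by (intro rint_split[OF \<mu>] i) auto
    then show ?thesis using 3 xy by (auto simp: sint_def)
  qed
qed

text \<open>As \<open>has_rn\<close> quantifies over both points, the case x < c is the case c < x
  with the points exchanged, and the oriented integral can be traded for one over [x, y).\<close>

lemma has_rn_iff:
  assumes \<mu>: "rlocfin a b \<mu>"
  shows "has_rn a b \<mu> f h \<longleftrightarrow> loc_int a b \<mu> h \<and>
    (\<forall>x\<in>Iab a b. \<forall>y\<in>Iab a b. x \<le> y \<longrightarrow> f y = f x + rint \<mu> {x..<y} h)" (is "?L \<longleftrightarrow> ?R")
proof
  assume L: ?L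
  have "f y = f x + rint \<mu> {x..<y} h" if "x \<in> Iab a b" "y \<in> Iab a b" "x \<le> y" for x y
  proof -
    have *: "f y = f x + sint \<mu> x y h" using L that unfolding has_rn_def by blast
    show ?thesis
    proof (cases "x = y")
      case False
      then have "sint \<mu> x y h = rint \<mu> {x..<y} h" using that by (simp add: sint_def)
      then show ?thesis using * by simp
    qed simp
  qed
  moreover have "loc_int a b \<mu> h" using L unfolding has_rn_def by blast
  ultimately show ?R by blast
next
  assume R: ?R
  have "f x = f c + sint \<mu> c x h" if "c \<in> Iab a b" "x \<in> Iab a b" for x c
  proof (cases "c \<le> x")
    case True
    then have *: "f x = f c + rint \<mu> {c..<x} h" using R that by blast
    show ?thesis
    proof (cases "x = c")
      case False
      then have "sint \<mu> c x h = rint \<mu> {c..<x} h" using True by (simp add: sint_def)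
      then show ?thesis using * by simp
    qed (simp add: sint_def)
  next
    case False
    then have "x \<le> c" by simp
    then have "f c = f x + rint \<mu> {x..<c} h" using R that by blast
    moreover have "sint \<mu> c x h = - rint \<mu> {x..<c} h" using False by (simp add: sint_def)
    ultimately show ?thesis by simp
  qed
  then show ?L using R unfolding has_rn_def by blast
qed

lemma has_rn_bm:
  assumes \<mu>: "rlocfin a b \<mu>" and f: "has_rn a b \<mu> f h" and xy: "x \<in> Iab a b" "y \<in> Iab a b"
  shows "bm x y f"
proof -
  have "bm x y (\<lambda>t. f x + rint \<mu> {x..<t} h)"
    using f xy by (intro bm_add bm_const bm_rint[OF \<mu>]) (auto simp: has_rn_def loc_int_rset)
  then show ?thesis
  proof (rule bm_cong)
    fix t assume "x \<le> t" "t \<le> y"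
    then have "f t = f x + rint \<mu> {x..<t} h"
      using f Iab_convex[OF xy, of t] xy unfolding has_rn_iff[OF \<mu>] by blast
    then show "f x + rint \<mu> {x..<t} h = f t" by simp
  qed
qed

lemma sint_bm:
  assumes \<mu>: "rlocfin a b \<mu>" and h: "loc_int a b \<mu> h" and xy: "x \<in> Iab a b" "y \<in> Iab a b" "c \<in> Iab a b"
  shows "bm x y (\<lambda>t. sint \<mu> c t h)"
proof (rule has_rn_bm[OF \<mu> _ xy(1,2)])
  show "has_rn a b \<mu> (\<lambda>t. sint \<mu> c t h) h"
    unfolding has_rn_iff[OF \<mu>] using h sint_step[OF \<mu> h _ _ xy(3)] by blast
qed

section \<open>The first-order system\<close>

locale measure_sl =
  fixes a b :: ereal and \<rho> :: "real measure" and \<sigma> chi :: rmeas and c :: real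
  assumes c: "c \<in> Iab a b"
    and H1: "locfin a b \<rho>"
    and H2: "real_meas a b chi"
    and H3: "real_meas a b \<sigma>" "supp_real a b \<sigma> = Iab a b"
    and H4: "\<forall>x\<in>Iab a b. sval \<sigma> {x} * sval chi {x} = 0 \<and> sval \<sigma> {x} * measure \<rho> {x} = 0"
begin

abbreviation "I \<equiv> Iab a b"

lemma rlocfin_sigma: "rlocfin a b \<sigma>" and rlocfin_chi: "rlocfin a b chi" and rlocfin_rho: "rlocfin a b (pos_rm \<rho>)"
  using H1 H2 H3 by (auto intro: real_meas_rlocfin rlocfin_pos_rm)

text \<open>(H4) speaks of the signed mass of a point. Mutually singular components cannot both
  charge it, so no cancellation hides an atom.\<close>

lemma tv_atom:
  assumes "real_meas a b \<mu>" "sval \<mu> {x} = 0" shows "tv \<mu> {x} = 0"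
proof -
  from assms(1) obtain A where A: "A \<in> sets borel" "emeasure (fst \<mu>) A = 0" "emeasure (snd \<mu>) (- A) = 0"
    and s: "sets (fst \<mu>) = sets borel" "sets (snd \<mu>) = sets borel"
    unfolding real_meas_def locfin_def by auto
  have "measure (fst \<mu>) {x} = 0 \<or> measure (snd \<mu>) {x} = 0"
  proof (cases "x \<in> A")
    case True
    then have "emeasure (fst \<mu>) {x} \<le> emeasure (fst \<mu>) A" using A s by (intro emeasure_mono) auto
    then show ?thesis using A by (simp add: measure_def)
  next
    case False
    then have "emeasure (snd \<mu>) {x} \<le> emeasure (snd \<mu>) (-A)" using A s by (intro emeasure_mono) auto
    then show ?thesis using A by (simp add: measure_def)
  qed
  then show ?thesis using assms(2) by (auto simp: sval_def tv_def)
qed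

lemma atoms_chi: "x \<in> I \<Longrightarrow> tv \<sigma> {x} = 0 \<or> tv chi {x} = 0"
  using H4 tv_atom[OF H3(1), of x] tv_atom[OF H2, of x] by auto

lemma atoms_rho: "x \<in> I \<Longrightarrow> tv \<sigma> {x} = 0 \<or> tv (pos_rm \<rho>) {x} = 0"
  using H4 tv_atom[OF H3(1), of x] by (auto simp: tv_def pos_rm_def measure_def emeasure_null_measure)

text \<open>\<open>seg x y f k w\<close>: on \<open>[x, y]\<close> the function \<open>f\<close> has quasi-derivative \<open>k\<close>, that is \<open>f^[1]\<close> in the notation
  of the paper, and \<open>\<tau> f = w\<close>. All integrals are over half-open intervals, so \<open>f\<close> and \<open>k\<close> are left-continuous.\<close>

definition seg :: "real \<Rightarrow> real \<Rightarrow> (real \<Rightarrow> complex) \<Rightarrow> (real \<Rightarrow> complex) \<Rightarrow> (real \<Rightarrow> complex) \<Rightarrow> bool" where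
  "seg x y f k w \<longleftrightarrow> x \<in> I \<and> y \<in> I \<and> bm x y f \<and> bm x y k \<and> set_integrable \<rho> {x..y} w \<and>
     (\<forall>s t. x \<le> s \<longrightarrow> s \<le> t \<longrightarrow> t \<le> y \<longrightarrow> f t = f s + rint \<sigma> {s..<t} k \<and>
        k t = k s + rint chi {s..<t} f - (LINT r:{s..<t}|\<rho>. w r))"

definition sys :: "(real \<Rightarrow> complex) \<Rightarrow> (real \<Rightarrow> complex) \<Rightarrow> (real \<Rightarrow> complex) \<Rightarrow> bool" where
  "sys f k w \<longleftrightarrow> (\<forall>x\<in>I. \<forall>y\<in>I. x \<le> y \<longrightarrow> seg x y f k w)"

lemma sysD: "sys f k w \<Longrightarrow> x \<in> I \<Longrightarrow> y \<in> I \<Longrightarrow> x \<le> y \<Longrightarrow> seg x y f k w"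
  by (simp add: sys_def)

lemma seg_I: "seg x y f k w \<Longrightarrow> x \<le> t \<Longrightarrow> t \<le> y \<Longrightarrow> t \<in> I"
  unfolding seg_def using Iab_convex by blast

lemma seg_subset: assumes "seg x y f k w" "x \<le> s" "s \<le> t" "t \<le> y" shows "seg s t f k w"
proof -
  have "s \<in> I" "t \<in> I" using assms seg_I by auto
  moreover have "set_integrable \<rho> {s..t} w"
    by (rule set_integrable_subset[of _ "{x..y}"]) (use assms H1 in \<open>auto simp: seg_def locfin_sets\<close>)
  moreover have "bm s t f" "bm s t k" using assms by (auto simp: seg_def intro: bm_subset)
  moreover have "f t' = f s' + rint \<sigma> {s'..<t'} k \<and> k t' = k s' + rint chi {s'..<t'} f - (LINT r:{s'..<t'}|\<rho>. w r)"
    if "s \<le> s'" "s' \<le> t'" "t' \<le> t" for s' t'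
    using assms that unfolding seg_def by (meson order_trans)
  ultimately show ?thesis unfolding seg_def by blast
qed

lemma seg_int:
  assumes "seg x y f k w" "x \<le> s" "s \<le> t" "t \<le> y"
  shows "rset_int \<sigma> {s..<t} k" "rset_int chi {s..<t} f" "rset_int (pos_rm \<rho>) {s..<t} w"
    "rset_int \<sigma> {s..t} k" "rset_int chi {s..t} f" "rset_int (pos_rm \<rho>) {s..t} w"
proof -
  have s: "seg s t f k w" using seg_subset[OF assms] .
  then show "rset_int \<sigma> {s..t} k" "rset_int chi {s..t} f" "rset_int (pos_rm \<rho>) {s..t} w"
    using rlocfin_sigma rlocfin_chi by (auto simp: seg_def rset_int_pos_rm intro: rset_int_bm)
  then show "rset_int \<sigma> {s..<t} k" "rset_int chi {s..<t} f" "rset_int (pos_rm \<rho>) {s..<t} w"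
    using rlocfin_sigma rlocfin_chi rlocfin_rho by (auto intro: rset_int_subset[of a b _ "{s..t}"])
qed

text \<open>Equations based at the left end suffice, by additivity over [x, s) and [s, t).\<close>

lemma segI:
  assumes x: "x \<in> I" and y: "y \<in> I" and f: "bm x y f" and k: "bm x y k" and w: "set_integrable \<rho> {x..y} w"
    and e: "\<And>t. x \<le> t \<Longrightarrow> t \<le> y \<Longrightarrow> f t = f x + rint \<sigma> {x..<t} k"
      "\<And>t. x \<le> t \<Longrightarrow> t \<le> y \<Longrightarrow> k t = k x + rint chi {x..<t} f - (LINT r:{x..<t}|\<rho>. w r)"
  shows "seg x y f k w"
proof -
  have "f t = f s + rint \<sigma> {s..<t} k \<and> k t = k s + rint chi {s..<t} f - (LINT r:{s..<t}|\<rho>. w r)"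
    if st: "x \<le> s" "s \<le> t" "t \<le> y" for s t
  proof -
    have sb: "{x..<t} \<subseteq> {x..y}" using st by auto
    have "rset_int \<sigma> {x..<t} k" "rset_int chi {x..<t} f" "rset_int (pos_rm \<rho>) {x..<t} w"
      using rset_int_subset[OF rlocfin_sigma rset_int_bm[OF rlocfin_sigma x y k], of "{x..<t}"]
        rset_int_subset[OF rlocfin_chi rset_int_bm[OF rlocfin_chi x y f], of "{x..<t}"]
        rset_int_subset[OF rlocfin_rho, of "{x..y}" w "{x..<t}"] w sb by (simp_all add: rset_int_pos_rm)
    from rint_split[OF rlocfin_sigma this(1) st(1,2)] rint_split[OF rlocfin_chi this(2) st(1,2)] rint_split[OF rlocfin_rho this(3) st(1,2)]
    show ?thesis using e(1)[of s] e(1)[of t] e(2)[of s] e(2)[of t] st by (simp add: rint_pos_rm)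
  qed
  then show ?thesis using assms unfolding seg_def by blast
qed

lemma seg_lin:
  assumes f: "seg x y f k w" and g: "seg x y g l v" and xy: "x \<le> y"
  shows "seg x y (\<lambda>t. z * f t + z' * g t) (\<lambda>t. z * k t + z' * l t) (\<lambda>t. z * w t + z' * v t)"
proof (rule segI)
  show "x \<in> I" "y \<in> I" using f by (auto simp: seg_def)
  show "bm x y (\<lambda>t. z * f t + z' * g t)" "bm x y (\<lambda>t. z * k t + z' * l t)"
    using f g by (auto simp: seg_def intro!: bm_add bm_cmult)
  show "set_integrable \<rho> {x..y} (\<lambda>t. z * w t + z' * v t)" using f g by (auto simp: seg_def)
  fix t assume t: "x \<le> t" "t \<le> y"
  note i = seg_int[OF f order_refl t] seg_int[OF g order_refl t]
  have "f t = f x + rint \<sigma> {x..<t} k" "g t = g x + rint \<sigma> {x..<t} l"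
    using f g t unfolding seg_def by blast+
  then show "z * f t + z' * g t = z * f x + z' * g x + rint \<sigma> {x..<t} (\<lambda>t. z * k t + z' * l t)"
    using i by (simp add: rint_lin algebra_simps)
  have "k t = k x + rint chi {x..<t} f - rint (pos_rm \<rho>) {x..<t} w" "l t = l x + rint chi {x..<t} g - rint (pos_rm \<rho>) {x..<t} v"
    using f g t unfolding seg_def rint_pos_rm by blast+
  then show "z * k t + z' * l t = z * k x + z' * l x + rint chi {x..<t} (\<lambda>t. z * f t + z' * g t) - (LINT t:{x..<t}|\<rho>. z * w t + z' * v t)"
    unfolding rint_pos_rm[symmetric] rint_lin[OF i(2) i(8)] rint_lin[OF i(3) i(9)] by algebra
qed

lemma sys_lin:
  "sys f k w \<Longrightarrow> sys g l v \<Longrightarrow> sys (\<lambda>t. z * f t + z' * g t) (\<lambda>t. z * k t + z' * l t) (\<lambda>t. z * w t + z' * v t)"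
  unfolding sys_def by (auto intro: seg_lin)

lemma sys_diff:
  "sys f k w \<Longrightarrow> sys g l v \<Longrightarrow> sys (\<lambda>t. f t - g t) (\<lambda>t. k t - l t) (\<lambda>t. w t - v t)"
  using sys_lin[of f k w g l v 1 "-1"] by simp

lemma seg_cnj: assumes f: "seg x y f k w" shows "seg x y (\<lambda>t. cnj (f t)) (\<lambda>t. cnj (k t)) (\<lambda>t. cnj (w t))"
proof (rule segI)
  show "x \<in> I" "y \<in> I" using f by (auto simp: seg_def)
  show "bm x y (\<lambda>t. cnj (f t))" "bm x y (\<lambda>t. cnj (k t))"
    using f by (auto simp: seg_def intro!: bm_cnj)
  show "set_integrable \<rho> {x..y} (\<lambda>t. cnj (w t))"
    using rset_int_cnj[of "pos_rm \<rho>" "{x..y}" w] f by (simp add: rset_int_pos_rm seg_def)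
  fix t assume t: "x \<le> t" "t \<le> y"
  have "f t = f x + rint \<sigma> {x..<t} k" "k t = k x + rint chi {x..<t} f - rint (pos_rm \<rho>) {x..<t} w"
    using f t unfolding seg_def rint_pos_rm by blast+
  then show "cnj (f t) = cnj (f x) + rint \<sigma> {x..<t} (\<lambda>t. cnj (k t))"
    "cnj (k t) = cnj (k x) + rint chi {x..<t} (\<lambda>t. cnj (f t)) - (LINT t:{x..<t}|\<rho>. cnj (w t))"
    unfolding rint_pos_rm[symmetric] by (simp_all add: rint_cnj)
qed

lemma sys_cnj: "sys f k w \<Longrightarrow> sys (\<lambda>t. cnj (f t)) (\<lambda>t. cnj (k t)) (\<lambda>t. cnj (w t))"
  unfolding sys_def by (auto intro: seg_cnj)

text \<open>By (H4) the factors never jump simultaneously, so integration by parts has no jump terms.\<close>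

lemma seg_prod:
  assumes f: "seg x y f k w" and g: "seg x y g l v" and xy: "x \<le> y"
  shows "f y * l y = f x * l x + rint \<sigma> {x..<y} (\<lambda>t. k t * l t) + rint chi {x..<y} (\<lambda>t. f t * g t)
     - (LINT t:{x..<y}|\<rho>. f t * v t)"
proof -
  have xI: "x \<in> I" "y \<in> I" using f by (auto simp: seg_def)
  note i = seg_int[OF f order_refl xy order_refl] seg_int[OF g order_refl xy order_refl]
  define R1 R2 S where "R1 t = rint chi {x..<t} g" and "R2 t = rint (pos_rm \<rho>) {x..<t} v"
    and "S t = rint \<sigma> {x..<t} k" for t
  have bmR: "bm x y R1" "bm x y R2" "bm x y S" unfolding R1_def[abs_def] R2_def[abs_def] S_def[abs_def]
    using i rlocfin_sigma rlocfin_chi rlocfin_rho by (auto intro: bm_rint)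
  have at1: "\<And>s. s \<in> {x..y} \<Longrightarrow> tv \<sigma> {s} = 0 \<or> tv chi {s} = 0"
    and at2: "\<And>s. s \<in> {x..y} \<Longrightarrow> tv \<sigma> {s} = 0 \<or> tv (pos_rm \<rho>) {s} = 0"
    using atoms_chi atoms_rho seg_I[OF f] by auto
  have p1: "S y * R1 y = rint \<sigma> {x..<y} (\<lambda>s. k s * R1 s) + rint chi {x..<y} (\<lambda>t. g t * S t)"
    unfolding R1_def S_def using i by (intro rint_parts[OF rlocfin_sigma rlocfin_chi xI _ _ at1]) auto
  have p2: "S y * R2 y = rint \<sigma> {x..<y} (\<lambda>s. k s * R2 s) + rint (pos_rm \<rho>) {x..<y} (\<lambda>t. v t * S t)"
    unfolding R2_def S_def using i by (intro rint_parts[OF rlocfin_sigma rlocfin_rho xI _ _ at2]) auto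
  have sub: "rset_int \<mu> {x..<y} (\<lambda>t. h t * q t)" if "rlocfin a b \<mu>" "bm x y q" "rset_int \<mu> {x..y} h" for \<mu> q h
  proof -
    have "{x..<y} \<subseteq> {x..y}" by auto
    then show ?thesis using rset_int_subset[OF that(1) rset_int_bm_mult[OF that], of "{x..<y}"] by (simp add: mult.commute)
  qed
  have ft: "f t = f x + S t" if "x \<le> t" "t \<le> y" for t
    using f that unfolding seg_def S_def by (meson order_refl)
  have lt: "l t = l x + R1 t - R2 t" if "x \<le> t" "t \<le> y" for t
    using g that unfolding seg_def R1_def R2_def rint_pos_rm by (meson order_refl)
  have "rint \<sigma> {x..<y} (\<lambda>t. k t * l t) = rint \<sigma> {x..<y} (\<lambda>t. (l x * k t + 1 * (k t * R1 t)) - k t * R2 t)"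
  proof (rule rint_cong)
    fix t assume "t \<in> {x..<y}"
    then have "l t = l x + R1 t - R2 t" using lt[of t] by simp
    then show "k t * l t = (l x * k t + 1 * (k t * R1 t)) - k t * R2 t" by algebra
  qed
  also have "\<dots> = (l x * rint \<sigma> {x..<y} k + 1 * rint \<sigma> {x..<y} (\<lambda>t. k t * R1 t)) - rint \<sigma> {x..<y} (\<lambda>t. k t * R2 t)"
    using i bmR rlocfin_sigma by (subst rint_diff, intro rset_int_add rset_int_cmult sub, simp_all only: sub rint_lin)
  finally have e1: "rint \<sigma> {x..<y} (\<lambda>t. k t * l t) = l x * S y + rint \<sigma> {x..<y} (\<lambda>t. k t * R1 t) - rint \<sigma> {x..<y} (\<lambda>t. k t * R2 t)"
    by (simp add: S_def)
  have "rint chi {x..<y} (\<lambda>t. f t * g t) = rint chi {x..<y} (\<lambda>t. f x * g t + 1 * (g t * S t))"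
  proof (rule rint_cong)
    fix t assume "t \<in> {x..<y}"
    then have "f t = f x + S t" using ft[of t] by simp
    then show "f t * g t = f x * g t + 1 * (g t * S t)" by algebra
  qed
  also have "\<dots> = f x * rint chi {x..<y} g + 1 * rint chi {x..<y} (\<lambda>t. g t * S t)"
    using i bmR rlocfin_chi by (intro rint_lin sub)
  finally have e2: "rint chi {x..<y} (\<lambda>t. f t * g t) = f x * R1 y + rint chi {x..<y} (\<lambda>t. g t * S t)"
    by (simp add: R1_def)
  have "rint (pos_rm \<rho>) {x..<y} (\<lambda>t. f t * v t) = rint (pos_rm \<rho>) {x..<y} (\<lambda>t. f x * v t + 1 * (v t * S t))"
  proof (rule rint_cong)
    fix t assume "t \<in> {x..<y}"
    then have "f t = f x + S t" using ft[of t] by simp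
    then show "f t * v t = f x * v t + 1 * (v t * S t)" by algebra
  qed
  also have "\<dots> = f x * rint (pos_rm \<rho>) {x..<y} v + 1 * rint (pos_rm \<rho>) {x..<y} (\<lambda>t. v t * S t)"
    using i bmR rlocfin_rho by (intro rint_lin sub)
  finally have e3: "(LINT t:{x..<y}|\<rho>. f t * v t) = f x * R2 y + rint (pos_rm \<rho>) {x..<y} (\<lambda>t. v t * S t)"
    by (simp add: R2_def rint_pos_rm)
  have "f y * l y = (f x + S y) * (l x + R1 y - R2 y)" using ft[OF xy] lt[OF xy] by simp
  also have "\<dots> = f x * l x + f x * R1 y - f x * R2 y + l x * S y + S y * R1 y - S y * R2 y"
    by (simp add: algebra_simps)
  finally show ?thesis unfolding e1 e2 e3 p1 p2 by (simp add: algebra_simps)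
qed

text \<open>Subtract the product formula for g and k from that for f and l: the integrals against
  \<sigma> and \<open>chi\<close> are symmetric in the two solutions and cancel.\<close>

lemma Lagrange:
  assumes f: "seg x y f k w" and g: "seg x y g l v" and xy: "x \<le> y"
  shows "(f y * l y - k y * g y) - (f x * l x - k x * g x) = (LINT t:{x..<y}|\<rho>. w t * g t - f t * v t)"
proof -
  have i: "set_integrable \<rho> {x..<y} (\<lambda>t. g t * w t)" "set_integrable \<rho> {x..<y} (\<lambda>t. f t * v t)"
  proof -
    have "set_integrable \<rho> {x..y} (\<lambda>t. g t * w t)" "set_integrable \<rho> {x..y} (\<lambda>t. f t * v t)"
      using f g by (auto simp: seg_def intro!: set_integrable_bm_mult locfin_sets[OF H1])
    then show "set_integrable \<rho> {x..<y} (\<lambda>t. g t * w t)" "set_integrable \<rho> {x..<y} (\<lambda>t. f t * v t)"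
      by (auto elim!: set_integrable_subset simp: locfin_sets[OF H1])
  qed
  then have "(LINT t:{x..<y}|\<rho>. w t * g t - f t * v t) = (LINT t:{x..<y}|\<rho>. g t * w t) - (LINT t:{x..<y}|\<rho>. f t * v t)"
    by (subst set_integral_diff(2)[symmetric]) (auto simp: mult.commute)
  moreover have "rint \<sigma> {x..<y} (\<lambda>t. l t * k t) = rint \<sigma> {x..<y} (\<lambda>t. k t * l t)"
    "rint chi {x..<y} (\<lambda>t. g t * f t) = rint chi {x..<y} (\<lambda>t. f t * g t)"
    by (simp_all add: mult.commute)
  ultimately show ?thesis using seg_prod[OF f g xy] seg_prod[OF g f xy] by algebra
qed

text \<open>The equation for \<open>F\<close> holds only |\<sigma>|-a.e., but the density
  \<open>h\<close> matters only under \<sigma>-integrals, where it may be replaced by the everywhere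
  defined, locally bounded \<open>qder\<close>. With the quasi-derivative in place of
  \<open>F\<close>, the equations no longer mention the base point c.\<close>

lemma dom_pair_sys:
  assumes d: "dom_pair a b \<rho> \<sigma> chi c f F" and F: "has_rn a b (pos_rm \<rho>) F w"
  shows "sys f (qder chi c f F) w"
proof -
  from d obtain h where h: "has_rn a b \<sigma> f h"
    and ae: "AE x in fst \<sigma>. x \<in> I \<longrightarrow> F x = - h x + sint chi c x f"
      "AE x in snd \<sigma>. x \<in> I \<longrightarrow> F x = - h x + sint chi c x f"
    by (auto simp: dom_pair_def)
  let ?k = "qder chi c f F"
  have bf: "bm x y f" if "x \<in> I" "y \<in> I" for x y using has_rn_bm[OF rlocfin_sigma h that] .
  have lf: "loc_int a b chi f" unfolding loc_int_rset using rset_int_bm[OF rlocfin_chi _ _ bf] by blast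
  have bF: "bm x y F" if "x \<in> I" "y \<in> I" for x y using has_rn_bm[OF rlocfin_rho F that] .
  have bk: "bm x y ?k" if "x \<in> I" "y \<in> I" for x y
    unfolding qder_def[abs_def] by (intro bm_diff sint_bm[OF rlocfin_chi lf] bF that c)
  have hk: "rint \<sigma> {x..<y} h = rint \<sigma> {x..<y} ?k" if xy: "x \<in> I" "y \<in> I" for x y
  proof -
    have meas: "set_borel_measurable M {x..<y} q" if "locfin a b M" "set_integrable M {x..y} q" for M and q :: "real \<Rightarrow> complex"
    proof -
      have "set_integrable M {x..<y} q"
        by (rule set_integrable_subset[OF that(2)]) (auto simp: locfin_sets[OF that(1)])
      then show ?thesis unfolding set_integrable_def set_borel_measurable_def by (rule borel_measurable_integrable)
    qed
    have "(LINT t:{x..<y}|M. h t) = (LINT t:{x..<y}|M. ?k t)"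
      if M: "locfin a b M" "set_integrable M {x..y} h" "AE x in M. x \<in> I \<longrightarrow> F x = - h x + sint chi c x f" for M
      unfolding set_lebesgue_integral_def
    proof (rule integral_cong_AE; (fold set_borel_measurable_def)?)
      have "t \<in> I" if "t \<in> {x..<y}" for t using Iab_convex[OF xy, of t] that by auto
      then show "AE t in M. indicator {x..<y} t *\<^sub>R h t = indicator {x..<y} t *\<^sub>R ?k t"
        using M(3) by (auto simp: qder_def indicator_def elim!: eventually_mono)
      show "set_borel_measurable M {x..<y} h" using meas M by blast
      show "set_borel_measurable M {x..<y} ?k" using meas[OF M(1)] set_integrable_bm[OF M(1) xy bk[OF xy]] by blast
    qed
    then show ?thesis unfolding rint_def using ae rlocfin_sigma h xy by (auto simp: has_rn_def loc_int_def rlocfin_def)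
  qed
  have "seg x y f ?k w" if xy: "x \<in> I" "y \<in> I" "x \<le> y" for x y
  proof (rule segI[OF xy(1,2) bf[OF xy(1,2)] bk[OF xy(1,2)]])
    show "set_integrable \<rho> {x..y} w" using F xy by (auto simp: has_rn_def loc_int_def pos_rm_def)
    fix t assume t: "x \<le> t" "t \<le> y"
    then have tI: "t \<in> I" using Iab_convex xy by blast
    show "f t = f x + rint \<sigma> {x..<t} ?k"
      using h t xy tI hk[OF xy(1) tI] unfolding has_rn_iff[OF rlocfin_sigma] by metis
    have "F t = F x + rint (pos_rm \<rho>) {x..<t} w"
      using F t xy tI unfolding has_rn_iff[OF rlocfin_rho] by blast
    then show "?k t = ?k x + rint chi {x..<t} f - (LINT r:{x..<t}|\<rho>. w r)"
      using sint_step[OF rlocfin_chi lf xy(1) tI c t(1)] by (simp add: qder_def rint_pos_rm)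
  qed
  then show ?thesis by (simp add: sys_def)
qed

text \<open>Conversely \<open>F\<close> is the \<open>chi\<close>-primitive of f minus k; the a.e.
  equation then holds everywhere, with density k.\<close>

lemma sys_dom_pair:
  assumes s: "sys f k w"
  defines "F \<equiv> \<lambda>x. sint chi c x f - k x"
  shows "dom_pair a b \<rho> \<sigma> chi c f F" "has_rn a b (pos_rm \<rho>) F w" "qder chi c f F = k"
proof -
  have sg: "seg x y f k w" if "x \<in> I" "y \<in> I" "x \<le> y" for x y using s that by (simp add: sys_def)
  have bb: "bm x y f" "bm x y k" "set_integrable \<rho> {x..y} w" if xy: "x \<in> I" "y \<in> I" for x y
  proof -
    have "bm x y f \<and> bm x y k \<and> set_integrable \<rho> {x..y} w"
    proof (cases "x \<le> y")
      case True
      then show ?thesis using sg[OF xy] unfolding seg_def by blast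
    qed (simp add: bm_def set_borel_measurable_def)
    then show "bm x y f" "bm x y k" "set_integrable \<rho> {x..y} w" by auto
  qed
  have lf: "loc_int a b chi f" "loc_int a b \<sigma> k" 
    unfolding loc_int_rset using rset_int_bm[OF rlocfin_chi _ _ bb(1)] rset_int_bm[OF rlocfin_sigma _ _ bb(2)] by blast+
  have lw: "loc_int a b (pos_rm \<rho>) w" unfolding loc_int_rset using bb by (auto simp: rset_int_pos_rm)
  have e: "f y = f x + rint \<sigma> {x..<y} k" "k y = k x + rint chi {x..<y} f - (LINT r:{x..<y}|\<rho>. w r)" if "x \<in> I" "y \<in> I" "x \<le> y" for x y
    using sg[OF that] that(3) unfolding seg_def by (meson order_refl)+
  have hf: "has_rn a b \<sigma> f k" unfolding has_rn_iff[OF rlocfin_sigma] using lf e by blast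
  show hF: "has_rn a b (pos_rm \<rho>) F w" unfolding has_rn_iff[OF rlocfin_rho]
  proof (intro conjI ballI impI lw)
    fix x y assume xy: "x \<in> I" "y \<in> I" "x \<le> y"
    show "F y = F x + rint (pos_rm \<rho>) {x..<y} w"
      using e(2)[OF xy] sint_step[OF rlocfin_chi lf(1) xy(1,2) c xy(3)] by (simp add: F_def rint_pos_rm)
  qed
  show q: "qder chi c f F = k" by (auto simp: qder_def F_def)
  have "f \<in> AC_loc a b \<sigma>" "F \<in> AC_loc a b (pos_rm \<rho>)"
    unfolding AC_loc_def using hf hF by blast+
  moreover have "F x = - k x + sint chi c x f" for x by (simp add: F_def)
  ultimately show "dom_pair a b \<rho> \<sigma> chi c f F" unfolding dom_pair_def using hf by auto
qed

end

section \<open>A Gronwall estimate for measures with atoms\<close>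

text \<open>Integration against the total variation. With values in \<open>ennreal\<close>, iterated
  integrals exist without integrability conditions.\<close>

definition nr :: "rmeas \<Rightarrow> real set \<Rightarrow> (real \<Rightarrow> ennreal) \<Rightarrow> ennreal" where
  "nr \<mu> A g = set_nn_integral (fst \<mu>) A g + set_nn_integral (snd \<mu>) A g"

lemma rint_nn_bound:
  assumes "rset_int \<mu> A h" shows "ennreal (cmod (rint \<mu> A h)) \<le> nr \<mu> A (\<lambda>t. ennreal (cmod (h t)))"
proof -
  have 1: "ennreal (cmod (LINT t:A|M. h t)) \<le> set_nn_integral M A (\<lambda>t. ennreal (cmod (h t)))"
    if "set_integrable M A h" for M
  proof -
    have "ennreal (cmod (LINT t:A|M. h t)) \<le> (\<integral>\<^sup>+t. ennreal (norm (indicator A t *\<^sub>R h t)) \<partial>M)"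
      unfolding set_lebesgue_integral_def
      by (rule integral_norm_bound_ennreal) (use that in \<open>simp add: set_integrable_def\<close>)
    also have "\<dots> = set_nn_integral M A (\<lambda>t. ennreal (cmod (h t)))"
      by (intro nn_integral_cong) (auto simp: indicator_def)
    finally show ?thesis .
  qed
  have "cmod (rint \<mu> A h) \<le> cmod (LINT t:A|fst \<mu>. h t) + cmod (LINT t:A|snd \<mu>. h t)"
    unfolding rint_def by (rule norm_triangle_ineq4)
  then have "ennreal (cmod (rint \<mu> A h)) \<le> ennreal (cmod (LINT t:A|fst \<mu>. h t)) + ennreal (cmod (LINT t:A|snd \<mu>. h t))"
    by (simp add: ennreal_plus[symmetric] del: ennreal_plus)
  also have "\<dots> \<le> nr \<mu> A (\<lambda>t. ennreal (cmod (h t)))"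
    unfolding nr_def using assms by (intro add_mono 1) (auto simp: rset_int_def)
  finally show ?thesis .
qed

lemma nr_mono: "(\<And>t. t \<in> A \<Longrightarrow> f t \<le> g t) \<Longrightarrow> nr \<mu> A f \<le> nr \<mu> A g"
  unfolding nr_def by (intro add_mono nn_integral_mono) (auto simp: indicator_def)

lemma nr_cmult:
  assumes "rlocfin a b \<mu>" "g \<in> borel_measurable borel" "A \<in> sets borel"
  shows "nr \<mu> A (\<lambda>t. z * g t) = z * nr \<mu> A g"
proof -
  have 1: "set_nn_integral M A (\<lambda>t. z * g t) = z * set_nn_integral M A g" if "locfin a b M" for M
  proof -
    have [measurable_cong]: "sets M = sets borel" using that by (rule locfin_sets)
    note [measurable] = assms(2,3)
    show ?thesis by (subst nn_integral_cmult[symmetric]) (auto simp: mult.assoc)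
  qed
  show ?thesis unfolding nr_def using assms 1 by (simp add: rlocfin_def distrib_left)
qed

lemma nr_add:
  assumes "rlocfin a b \<mu>" "f \<in> borel_measurable borel" "g \<in> borel_measurable borel" "A \<in> sets borel"
  shows "nr \<mu> A (\<lambda>t. f t + g t) = nr \<mu> A f + nr \<mu> A g"
proof -
  have 1: "set_nn_integral M A (\<lambda>t. f t + g t) = set_nn_integral M A f + set_nn_integral M A g" if "locfin a b M" for M
  proof -
    have [measurable_cong]: "sets M = sets borel" using that by (rule locfin_sets)
    note [measurable] = assms(2,3,4)
    show ?thesis by (subst nn_integral_add[symmetric]) (auto simp: distrib_right)
  qed
  show ?thesis unfolding nr_def using assms 1 by (simp add: rlocfin_def ac_simps)
qed

lemma nr_Un:
  assumes "rlocfin a b \<mu>" "g \<in> borel_measurable borel" "A \<in> sets borel" "B \<in> sets borel" "A \<inter> B = {}"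
  shows "nr \<mu> (A \<union> B) g = nr \<mu> A g + nr \<mu> B g"
proof -
  have 1: "set_nn_integral M (A \<union> B) g = set_nn_integral M A g + set_nn_integral M B g" if "locfin a b M" for M
  proof -
    have [measurable_cong]: "sets M = sets borel" using that by (rule locfin_sets)
    note [measurable] = assms(2,3,4)
    show ?thesis using assms(5) by (intro nn_integral_disjoint_pair) auto
  qed
  show ?thesis unfolding nr_def using assms 1 by (simp add: rlocfin_def ac_simps)
qed

lemma nr_bound:
  assumes \<mu>: "rlocfin a b \<mu>" and xy: "x \<in> Iab a b" "y \<in> Iab a b" and A: "A \<subseteq> {x..y}" "A \<in> sets borel"
    and g: "\<And>t. t \<in> A \<Longrightarrow> g t \<le> B"
  shows "nr \<mu> A g \<le> ennreal (tv \<mu> A) * B"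
proof -
  have 1: "set_nn_integral M A (\<lambda>t. B) = ennreal (measure M A) * B" if M: "locfin a b M" for M
  proof -
    have "emeasure M A \<noteq> \<infinity>" using locfin_finite[OF M xy A(1)] by simp
    then have "emeasure M A = ennreal (measure M A)" by (rule emeasure_eq_ennreal_measure[unfolded infinity_ennreal_def[symmetric]])
    moreover have "A \<in> sets M" using A(2) locfin_sets[OF M] by simp
    ultimately show ?thesis by (subst nn_integral_cmult) (auto simp: mult.commute)
  qed
  have "nr \<mu> A g \<le> nr \<mu> A (\<lambda>_. B)" by (rule nr_mono[OF g])
  also have "\<dots> = ennreal (tv \<mu> A) * B"
    unfolding nr_def tv_def using \<mu> 1[of "fst \<mu>"] 1[of "snd \<mu>"]
    by (simp add: rlocfin_def distrib_right ennreal_plus)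
  finally show ?thesis .
qed

lemma nr_measurable:
  assumes \<mu>: "rlocfin a b \<mu>" and g: "g \<in> borel_measurable borel"
  shows "(\<lambda>x. nr \<mu> {x0..<x} g) \<in> borel_measurable borel"
proof -
  have 1: "(\<lambda>x. set_nn_integral M {x0..<x} g) \<in> borel_measurable borel" if M: "locfin a b M" for M
  proof -
    interpret sigma_finite_measure M using locfin_sigma_finite[OF M] .
    have [measurable_cong]: "sets M = sets borel" using M by (rule locfin_sets)
    note [measurable] = g
    have "(\<lambda>x. \<integral>\<^sup>+s. (if x0 \<le> s \<and> s < x then g s else 0) \<partial>M) \<in> borel_measurable borel"
      by (rule borel_measurable_nn_integral) (simp add: split_beta', measurable)
    moreover have "set_nn_integral M {x0..<x} g = (\<integral>\<^sup>+s. (if x0 \<le> s \<and> s < x then g s else 0) \<partial>M)" for x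
      by (intro nn_integral_cong) (auto simp: indicator_def)
    ultimately show ?thesis by simp
  qed
  show ?thesis unfolding nr_def using \<mu> 1 by (simp add: rlocfin_def borel_measurable_add)
qed

lemma ennreal_absorb_half:
  fixes X A :: ennreal
  assumes "X \<le> A + ennreal (1/2) * X" "X < \<infinity>" shows "X \<le> 2 * A"
proof (cases "A = \<infinity>")
  case False
  then obtain x' a' where e: "X = ennreal x'" "A = ennreal a'" "x' \<ge> 0" "a' \<ge> 0"
    using assms(2) by (cases X; cases A) auto
  have "ennreal (1/2) * ennreal x' = ennreal (1/2 * x')" using e by (intro ennreal_mult[symmetric]) auto
  then have "ennreal a' + ennreal (1/2) * ennreal x' = ennreal (a' + 1/2 * x')" using e by (simp only:) (subst ennreal_plus, auto)
  then have "ennreal x' \<le> ennreal (a' + 1/2 * x')" using assms(1) e by (simp only:)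
  then have "x' \<le> a' + 1/2 * x'" using e by (subst (asm) ennreal_le_iff) auto
  then have "x' \<le> 2 * a'" by simp
  moreover have "2 * A = ennreal (2 * a')" using e by (simp add: ennreal_mult)
  ultimately show ?thesis using e by (simp add: ennreal_leI)
qed (simp add: ennreal_mult_top)

section \<open>Iterated integrals of the total variation\<close>

context measure_sl
begin

definition tot :: "real set \<Rightarrow> (real \<Rightarrow> ennreal) \<Rightarrow> ennreal" where
  "tot A g = nr \<sigma> A g + nr chi A g"

text \<open>The n-fold integral of 1 over x0 <= t_n < ... < t_1 < x against |\<sigma>| +
  |\<open>chi\<close>|: the n-th term of the Peano-Baker series that majorises the Picard iteration.
  \<open>Pt\<close> collects its partial sums.\<close>

fun Jt :: "real \<Rightarrow> nat \<Rightarrow> real \<Rightarrow> ennreal" where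
  "Jt x0 0 x = 1"
| "Jt x0 (Suc n) x = tot {x0..<x} (Jt x0 n)"

definition Pt :: "real \<Rightarrow> nat \<Rightarrow> real \<Rightarrow> ennreal" where
  "Pt x0 N x = (\<Sum>n\<le>N. Jt x0 n x)"

lemma tot_mono: "(\<And>t. t \<in> A \<Longrightarrow> f t \<le> g t) \<Longrightarrow> tot A f \<le> tot A g"
  unfolding tot_def by (intro add_mono nr_mono) auto

lemma tot_add: "f \<in> borel_measurable borel \<Longrightarrow> g \<in> borel_measurable borel \<Longrightarrow> A \<in> sets borel \<Longrightarrow>
   tot A (\<lambda>t. f t + g t) = tot A f + tot A g"
  unfolding tot_def by (simp add: nr_add[OF rlocfin_sigma] nr_add[OF rlocfin_chi] ac_simps)

lemma tot_Un: "g \<in> borel_measurable borel \<Longrightarrow> A \<in> sets borel \<Longrightarrow> B \<in> sets borel \<Longrightarrow> A \<inter> B = {} \<Longrightarrow>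
   tot (A \<union> B) g = tot A g + tot B g"
  unfolding tot_def by (simp add: nr_Un[OF rlocfin_sigma] nr_Un[OF rlocfin_chi] ac_simps)

lemma tot_bound:
  assumes "x \<in> I" "y \<in> I" "A \<subseteq> {x..y}" "A \<in> sets borel" "\<And>t. t \<in> A \<Longrightarrow> g t \<le> B"
  shows "tot A g \<le> ennreal (tv \<sigma> A + tv chi A) * B"
proof -
  have "tot A g \<le> ennreal (tv \<sigma> A) * B + ennreal (tv chi A) * B"
    unfolding tot_def by (intro add_mono nr_bound[OF rlocfin_sigma assms] nr_bound[OF rlocfin_chi assms])
  also have "\<dots> = ennreal (tv \<sigma> A + tv chi A) * B"
    by (subst ennreal_plus) (auto simp: tv_def distrib_right)
  finally show ?thesis .
qed

lemma Jt_measurable: "Jt x0 n \<in> borel_measurable borel"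
proof (induction n)
  case (Suc n)
  have "Jt x0 (Suc n) = (\<lambda>x. nr \<sigma> {x0..<x} (Jt x0 n) + nr chi {x0..<x} (Jt x0 n))"
    by (auto simp: tot_def)
  then show ?case using nr_measurable[OF rlocfin_sigma Suc] nr_measurable[OF rlocfin_chi Suc] by (simp add: borel_measurable_add)
qed (simp add: fun_eq_iff[symmetric] cong: measurable_cong)

lemma Pt_measurable: "Pt x0 N \<in> borel_measurable borel"
  unfolding Pt_def[abs_def] using Jt_measurable by (intro borel_measurable_sum) auto

text \<open>The functions \<open>Pt\<close> are the Picard iterates of the scalar equation P(x) = 1
  + integral of P over [x0, x), whose solution plays the part of the exponential in Gronwall's
  bound.\<close>

lemma Pt_Suc: "Pt x0 (Suc N) x = 1 + tot {x0..<x} (Pt x0 N)"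
proof (induction N)
  case 0
  have "Pt x0 0 = Jt x0 0" "Jt x0 0 = (\<lambda>_. 1)" by (auto simp: Pt_def)
  then show ?case by (simp add: Pt_def)
next
  case (Suc N)
  have "Pt x0 (Suc (Suc N)) x = Pt x0 (Suc N) x + Jt x0 (Suc (Suc N)) x" by (simp add: Pt_def)
  also have "\<dots> = 1 + (tot {x0..<x} (Pt x0 N) + tot {x0..<x} (Jt x0 (Suc N)))"
    unfolding Suc by (simp add: ac_simps)
  also have "\<dots> = 1 + tot {x0..<x} (\<lambda>t. Pt x0 N t + Jt x0 (Suc N) t)"
    using Pt_measurable Jt_measurable by (subst tot_add) auto
  also have "(\<lambda>t. Pt x0 N t + Jt x0 (Suc N) t) = Pt x0 (Suc N)" by (auto simp: Pt_def)
  finally show ?case .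
qed

lemma tot_mono_set:
  assumes "g \<in> borel_measurable borel" "A \<subseteq> B" "A \<in> sets borel" "B \<in> sets borel"
  shows "tot A g \<le> tot B g"
proof -
  have "tot B g = tot A g + tot (B - A) g"
    using tot_Un[of g A "B - A"] assms by (simp add: Un_absorb1)
  then show ?thesis by simp
qed

lemma Jt_mono: "x \<le> y \<Longrightarrow> Jt x0 n x \<le> Jt x0 n y"
  by (cases n) (auto intro!: tot_mono_set Jt_measurable)

lemma Pt_mono: "x \<le> y \<Longrightarrow> Pt x0 N x \<le> Pt x0 N y"
  unfolding Pt_def by (intro sum_mono Jt_mono)

lemma Pt_le_Suc: "Pt x0 N x \<le> Pt x0 (Suc N) x"
  by (simp add: Pt_def)

text \<open>\<open>Pt_Suc\<close> lowers the index; monotonicity in \<open>N\<close> restores it.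
  With the same \<open>N\<close> on both sides a small integral can be absorbed, which gives bounds
  uniform in \<open>N\<close>.\<close>

lemma Pt_step:
  assumes "x0 \<le> x" "x \<le> y"
  shows "Pt x0 N y \<le> Pt x0 N x + tot {x..<y} (Pt x0 N)"
proof (cases N)
  case 0
  then show ?thesis by (simp add: Pt_def)
next
  case (Suc M)
  have "{x0..<y} = {x0..<x} \<union> {x..<y}" using assms by auto
  then have "tot {x0..<y} (Pt x0 M) = tot {x0..<x} (Pt x0 M) + tot {x..<y} (Pt x0 M)"
    using Pt_measurable by (simp add: tot_Un[symmetric] ivl_disj_int)
  moreover have "tot {x..<y} (Pt x0 M) \<le> tot {x..<y} (Pt x0 N)"
    unfolding Suc by (intro tot_mono Pt_le_Suc)
  ultimately show ?thesis unfolding Suc Pt_Suc by (simp add: add.assoc add_left_mono)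
qed

text \<open>This bound depends on \<open>N\<close>; it makes the subtraction in
  \<open>ennreal_absorb_half\<close> legitimate.\<close>

lemma Pt_finite:
  assumes "x0 \<in> I" "y \<in> I" "x0 \<le> y" shows "Pt x0 N y < \<infinity>"
proof (induction N)
  case (Suc N)
  have "tot {x0..<y} (Pt x0 N) \<le> ennreal (tv \<sigma> {x0..<y} + tv chi {x0..<y}) * Pt x0 N y"
    using assms by (intro tot_bound[of x0 y]) (auto intro: Pt_mono)
  also have "\<dots> < \<infinity>" using Suc by (simp add: ennreal_mult_less_top)
  finally show ?case unfolding Pt_Suc by simp
qed (simp add: Pt_def)

text \<open>A Gronwall-type bound. On each side of a point the total variation is eventually at most one half
  and is absorbed, the atom at the point contributes a finite factor, and compactness of the interval
  combines the local bounds.\<close>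

lemma Pt_bounded:
  assumes x0: "x0 \<in> I" and y0: "y \<in> I" and xy: "x0 \<le> y"
  shows "\<exists>K. \<forall>N. Pt x0 N y \<le> ennreal K"
proof -
  \<comment> \<open>\<open>R x y\<close>: from x to y the majorants grow at most by a factor
    independent of \<open>N\<close>. Such factors multiply, and they exist near every point;
    \<open>Bolzano\<close> turns this into one factor for the whole interval.\<close>
  define R where "R x y \<longleftrightarrow> (x0 \<le> x \<longrightarrow> y \<in> I \<longrightarrow> (\<exists>K. K \<ge> 0 \<and> (\<forall>N. Pt x0 N y \<le> ennreal K * Pt x0 N x)))" for x y
  have "R x0 y" using xy
  proof (induction rule: Bolzano)
    case (trans p q r)
    show ?case unfolding R_def
    proof (intro impI)
      assume p: "x0 \<le> p" "r \<in> I"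
      then have "q \<in> I" using Iab_convex[OF x0 p(2), of q] trans by auto
      then obtain K where K: "K \<ge> 0" "\<And>N. Pt x0 N q \<le> ennreal K * Pt x0 N p" using trans(1) p unfolding R_def by auto
      obtain L where L: "L \<ge> 0" "\<And>N. Pt x0 N r \<le> ennreal L * Pt x0 N q" using trans p unfolding R_def by auto
      have "Pt x0 N r \<le> ennreal (L * K) * Pt x0 N p" for N
      proof -
        have "Pt x0 N r \<le> ennreal L * (ennreal K * Pt x0 N p)" using L(2)[of N] K(2)[of N]
          by (meson mult_left_mono order_trans zero_le)
        then show ?thesis using L K by (simp add: ennreal_mult mult.assoc)
      qed
      then show "\<exists>K\<ge>0. \<forall>N. Pt x0 N r \<le> ennreal K * Pt x0 N p" using L K by (intro exI[of _ "L * K"]) auto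
    qed
  next
    case (local t)
    then have tI: "t \<in> I" using Iab_convex[OF x0 y0] by auto
    \<comment> \<open>One quarter for each of \<sigma> and \<open>chi\<close> makes their sum at
      most 1/2.\<close>
    obtain d1 where d1: "d1 > 0" "\<forall>s. t - d1 \<le> s \<longrightarrow> s < t \<longrightarrow> s \<in> I \<and> tv \<sigma> {s..<t} < 1/4"
      using tv_tail_left[OF rlocfin_sigma tI, of "1/4"] by auto
    obtain d2 where d2: "d2 > 0" "\<forall>s. t - d2 \<le> s \<longrightarrow> s < t \<longrightarrow> s \<in> I \<and> tv chi {s..<t} < 1/4"
      using tv_tail_left[OF rlocfin_chi tI, of "1/4"] by auto
    obtain d3 where d3: "d3 > 0" "\<forall>s. s \<le> t + d3 \<longrightarrow> t < s \<longrightarrow> s \<in> I \<and> tv \<sigma> {t<..<s} < 1/4"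
      using tv_tail_right[OF rlocfin_sigma tI, of "1/4"] by auto
    obtain d4 where d4: "d4 > 0" "\<forall>s. s \<le> t + d4 \<longrightarrow> t < s \<longrightarrow> s \<in> I \<and> tv chi {t<..<s} < 1/4"
      using tv_tail_right[OF rlocfin_chi tI, of "1/4"] by auto
    define m where "m = tv \<sigma> {t} + tv chi {t}"
    have m: "m \<ge> 0" by (simp add: m_def tv_def)
    \<comment> \<open>On [p, t) the majorant is at most its value at t, so the small integral is
      absorbed at the right end.\<close>
    have left: "Pt x0 N t \<le> 2 * Pt x0 N p" if p: "x0 \<le> p" "p \<le> t" "t - d1 \<le> p" "t - d2 \<le> p" for p N
    proof (cases "p = t")
      case False
      have "p \<in> I" using p Iab_convex[OF x0 tI] by auto
      have le: "tv \<sigma> {p..<t} + tv chi {p..<t} \<le> 1/2" 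
      proof -
        have "p < t" using p False by simp
        then have "tv \<sigma> {p..<t} < 1/4" "tv chi {p..<t} < 1/4" using d1(2) d2(2) p by blast+
        then show ?thesis by linarith
      qed
      have "Pt x0 N t \<le> Pt x0 N p + tot {p..<t} (Pt x0 N)" using Pt_step p by blast
      also have "tot {p..<t} (Pt x0 N) \<le> ennreal (tv \<sigma> {p..<t} + tv chi {p..<t}) * Pt x0 N t"
        using \<open>p \<in> I\<close> tI by (intro tot_bound[of p t]) (auto intro: Pt_mono)
      also have "\<dots> \<le> ennreal (1/2) * Pt x0 N t" using le by (intro mult_right_mono ennreal_leI) auto
      finally have "Pt x0 N t \<le> Pt x0 N p + ennreal (1/2) * Pt x0 N t" by (simp add: add_left_mono)
      then show ?thesis by (rule ennreal_absorb_half) (use Pt_finite[OF x0 tI] p in auto)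
    qed (metis mult.commute mult_2_right le_iff_add)
    \<comment> \<open>Splitting off {t} leaves a small open tail; the atom only multiplies the value
      at t, which is already controlled.\<close>
    have right: "Pt x0 N q \<le> ennreal (2 * (1 + m)) * Pt x0 N t" if q: "x0 \<le> t" "t \<le> q" "q \<le> t + d3" "q \<le> t + d4" "q \<in> I" for q N
    proof (cases "q = t")
      case True
      have "ennreal 1 \<le> ennreal (2 * (1 + m))" using m by (intro ennreal_leI) simp
      then have "1 * Pt x0 N t \<le> ennreal (2 * (1 + m)) * Pt x0 N t"
        unfolding ennreal_1 by (rule mult_right_mono) simp
      then show ?thesis using True by simp
    next
      case False
      have le: "tv \<sigma> {t<..<q} + tv chi {t<..<q} \<le> 1/2" 
      proof -
        have "t < q" using q False by simp
        then have "tv \<sigma> {t<..<q} < 1/4" "tv chi {t<..<q} < 1/4" using d3(2) d4(2) q by blast+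
        then show ?thesis by linarith
      qed
      have "{t..<q} = {t} \<union> {t<..<q}" using q False by auto
      then have "tot {t..<q} (Pt x0 N) = tot {t} (Pt x0 N) + tot {t<..<q} (Pt x0 N)"
        using Pt_measurable by (simp add: tot_Un[symmetric])
      also have "\<dots> \<le> ennreal m * Pt x0 N t + ennreal (tv \<sigma> {t<..<q} + tv chi {t<..<q}) * Pt x0 N q"
        unfolding m_def using q tI by (intro add_mono tot_bound[of t q]) (auto intro: Pt_mono)
      also have "\<dots> \<le> ennreal m * Pt x0 N t + ennreal (1/2) * Pt x0 N q"
        using le by (intro add_left_mono mult_right_mono ennreal_leI) auto
      finally have "Pt x0 N q \<le> Pt x0 N t + (ennreal m * Pt x0 N t + ennreal (1/2) * Pt x0 N q)"
        using Pt_step[OF q(1,2), of N] by (meson add_left_mono order_trans)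
      then have "Pt x0 N q \<le> (1 + ennreal m) * Pt x0 N t + ennreal (1/2) * Pt x0 N q"
        by (simp add: algebra_simps)
      then have "Pt x0 N q \<le> 2 * ((1 + ennreal m) * Pt x0 N t)"
        by (rule ennreal_absorb_half) (use Pt_finite[OF x0 q(5)] q in auto)
      also have "\<dots> = ennreal (2 * (1 + m)) * Pt x0 N t"
        using m by (simp add: ennreal_mult mult.assoc[symmetric] distrib_left)
      finally show ?thesis .
    qed
    show ?case
    proof (intro exI[of _ "min (min d1 d2) (min d3 d4)"] conjI allI impI)
      fix p q assume pq: "p \<le> t \<and> t \<le> q \<and> q - p < min (min d1 d2) (min d3 d4)"
      show "R p q" unfolding R_def
      proof (intro impI exI[of _ "2 * (1 + m) * 2"] conjI allI)
        fix N assume pI: "x0 \<le> p" "q \<in> I"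
        have "Pt x0 N q \<le> ennreal (2 * (1 + m)) * Pt x0 N t" using pq pI local by (intro right) auto
        also have "\<dots> \<le> ennreal (2 * (1 + m)) * (2 * Pt x0 N p)" using pq pI by (intro mult_left_mono left) auto
        also have "\<dots> = ennreal (2 * (1 + m) * 2) * Pt x0 N p"
        proof -
          have "ennreal (L * 2) = ennreal L * 2" if "L \<ge> 0" for L using that by (simp add: ennreal_mult)
          then have "ennreal (2 * (1 + m) * 2) = ennreal (2 * (1 + m)) * 2" using m by (metis add_nonneg_nonneg mult_nonneg_nonneg zero_le_numeral zero_le_one)
          then show ?thesis by (simp only: mult.assoc)
        qed
        finally show "Pt x0 N q \<le> ennreal (2 * (1 + m) * 2) * Pt x0 N p" .
      qed (use m in auto)
    qed (use d1 d2 d3 d4 in auto)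
  qed
  then obtain K where K: "\<And>N. Pt x0 N y \<le> ennreal K * Pt x0 N x0" unfolding R_def using y0 by auto
  have "tot {} g = 0" for g by (simp add: tot_def nr_def)
  then have "Pt x0 N x0 = 1" for N by (cases N) (auto simp: Pt_Suc, simp add: Pt_def)
  then show ?thesis using K by auto
qed

definition jr :: "real \<Rightarrow> nat \<Rightarrow> real \<Rightarrow> real" where
  "jr x0 n x = enn2real (Jt x0 n x)"

text \<open>Convergence of the majorant series serves twice: its terms tend to 0, which gives
  uniqueness, and it dominates the series of Picard terms, which gives existence.\<close>

lemma
  assumes x0: "x0 \<in> I" and y: "y \<in> I" and xy: "x0 \<le> y"
  shows summable_jr: "summable (\<lambda>n. jr x0 n y)" and Jt_jr: "Jt x0 n y = ennreal (jr x0 n y)"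
proof -
  have fin: "Jt x0 n y < \<infinity>" for n
  proof -
    have "Jt x0 n y \<le> Pt x0 n y" unfolding Pt_def by (rule member_le_sum) auto
    then show ?thesis using Pt_finite[OF assms, of n] by (rule le_less_trans)
  qed
  then show *: "Jt x0 n y = ennreal (jr x0 n y)" for n by (simp add: jr_def less_top)
  obtain K where K: "\<And>N. Pt x0 N y \<le> ennreal K" using Pt_bounded[OF assms] by auto
  have le: "(\<Sum>n\<le>N. jr x0 n y) \<le> max K 0" for N
  proof -
    have "ennreal (\<Sum>n\<le>N. jr x0 n y) \<le> ennreal K"
      using K[of N] unfolding Pt_def * by (subst sum_ennreal[symmetric]) (auto simp: jr_def)
    also have "\<dots> \<le> ennreal (max K 0)" by (intro ennreal_leI) simp
    finally show ?thesis by (subst (asm) ennreal_le_iff) auto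
  qed
  show "summable (\<lambda>n. jr x0 n y)"
  proof (rule summableI_nonneg_bounded[where x = "max K 0"])
    fix N show "0 \<le> jr x0 N y" by (simp add: jr_def)
    have "(\<Sum>n<N. jr x0 n y) \<le> (\<Sum>n\<le>N. jr x0 n y)" by (rule sum_mono2) (auto simp: jr_def)
    then show "(\<Sum>n<N. jr x0 n y) \<le> max K 0" using le[of N] by linarith
  qed
qed

lemma jr_mono:
  assumes x0: "x0 \<in> I" and y: "y \<in> I" and xy: "x0 \<le> x" "x \<le> y"
  shows "jr x0 n x \<le> jr x0 n y"
proof -
  have "x \<in> I" using Iab_convex[OF x0 y] xy by auto
  then have "ennreal (jr x0 n x) \<le> ennreal (jr x0 n y)"
    using Jt_mono[OF xy(2), of x0 n] Jt_jr[OF x0 _ xy(1)] Jt_jr[OF x0 y order_trans[OF xy]] by simp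
  then show ?thesis by (subst (asm) ennreal_le_iff) (auto simp: jr_def)
qed

end

section \<open>Existence and uniqueness\<close>

lemma rint_sum:
  assumes "finite N" "\<And>n. n \<in> N \<Longrightarrow> rset_int \<mu> A (h n)"
  shows "rset_int \<mu> A (\<lambda>t. \<Sum>n\<in>N. h n t) \<and> rint \<mu> A (\<lambda>t. \<Sum>n\<in>N. h n t) = (\<Sum>n\<in>N. rint \<mu> A (h n))"
  using assms
proof (induction rule: finite_induct)
  case empty
  show ?case by (simp add: rset_int_def set_integrable_def rint_def)
next
  case (insert x F)
  then show ?case by (auto simp: rint_add intro: rset_int_add)
qed

lemma bm_suminf:
  assumes h: "\<And>n. bm x y (h n)" and le: "\<And>n t. x \<le> t \<Longrightarrow> t \<le> y \<Longrightarrow> cmod (h n t) \<le> B n" and B: "summable B"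
  shows "bm x y (\<lambda>t. \<Sum>n. h n t)"
proof -
  have "(\<lambda>t. \<Sum>n. indicator {x..y} t *\<^sub>R h n t) \<in> borel_measurable borel"
    using h unfolding bm_def set_borel_measurable_def by (intro borel_measurable_suminf) auto
  also have "(\<lambda>t. \<Sum>n. indicator {x..y} t *\<^sub>R h n t) = (\<lambda>t. indicator {x..y} t *\<^sub>R (\<Sum>n. h n t))"
    by (intro ext) (auto simp: indicator_def)
  finally have "set_borel_measurable borel {x..y} (\<lambda>t. \<Sum>n. h n t)" by (simp add: set_borel_measurable_def)
  moreover have "cmod (\<Sum>n. h n t) \<le> suminf B" if "t \<in> {x..y}" for t
    using that le by (intro norm_suminf_le B) auto
  ultimately show ?thesis unfolding bm_def by blast
qed

text \<open>The Weierstrass test: the tails are uniformly small on [x, y), which has finite total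
  variation.\<close>

lemma rint_suminf:
  assumes \<mu>: "rlocfin a b \<mu>" and xy: "x \<in> Iab a b" "y \<in> Iab a b"
    and h: "\<And>n. bm x y (h n)" and le: "\<And>n t. x \<le> t \<Longrightarrow> t \<le> y \<Longrightarrow> cmod (h n t) \<le> B n" and B: "summable B"
  shows "(\<lambda>n. rint \<mu> {x..<y} (h n)) sums rint \<mu> {x..<y} (\<lambda>t. \<Sum>n. h n t)"
proof -
  have i: "rset_int \<mu> {x..<y} q" if "bm x y q" for q
    by (rule rset_int_subset[OF \<mu> rset_int_bm[OF \<mu> xy that]]) auto
  let ?S = "\<lambda>t. \<Sum>n. h n t"
  have bS: "bm x y ?S" by (rule bm_suminf[OF h le B])
  have est: "cmod (rint \<mu> {x..<y} ?S - (\<Sum>n<N. rint \<mu> {x..<y} (h n))) \<le> (\<Sum>n. B (n + N)) * tv \<mu> {x..<y}" for N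
  proof -
    have s: "rset_int \<mu> {x..<y} (\<lambda>t. \<Sum>n<N. h n t)" "rint \<mu> {x..<y} (\<lambda>t. \<Sum>n<N. h n t) = (\<Sum>n<N. rint \<mu> {x..<y} (h n))"
      using rint_sum[of "{..<N}" \<mu> "{x..<y}" h] i[OF h] by auto
    have "rint \<mu> {x..<y} ?S - (\<Sum>n<N. rint \<mu> {x..<y} (h n)) = rint \<mu> {x..<y} (\<lambda>t. ?S t - (\<Sum>n<N. h n t))"
      using rint_diff[OF i[OF bS] s(1)] s(2) by simp
    also have "cmod \<dots> \<le> (\<Sum>n. B (n + N)) * tv \<mu> {x..<y}"
    proof (rule rint_bound[OF \<mu> xy])
      fix t assume t: "t \<in> {x..<y}"
      have sm: "summable (\<lambda>n. h n t)" using t le by (intro summable_comparison_test'[OF B, of 0]) auto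
      have "?S t - (\<Sum>n<N. h n t) = (\<Sum>n. h (n + N) t)"
        using suminf_minus_initial_segment[OF sm, of N] by simp
      moreover have "cmod (\<Sum>n. h (n + N) t) \<le> (\<Sum>n. B (n + N))"
        using t le B by (intro norm_suminf_le) (auto simp: summable_iff_shift)
      ultimately show "cmod (?S t - (\<Sum>n<N. h n t)) \<le> (\<Sum>n. B (n + N))" by simp
    qed auto
    finally show ?thesis .
  qed
  have "(\<lambda>N. (\<Sum>n. B (n + N)) * tv \<mu> {x..<y}) \<longlonglongrightarrow> 0 * tv \<mu> {x..<y}"
    by (rule tendsto_mult[OF suminf_exist_split2[OF B] tendsto_const])
  then have "(\<lambda>N. (\<Sum>n. B (n + N)) * tv \<mu> {x..<y}) \<longlonglongrightarrow> 0" by simp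
  then have "(\<lambda>N. rint \<mu> {x..<y} ?S - (\<Sum>n<N. rint \<mu> {x..<y} (h n))) \<longlonglongrightarrow> 0"
    by (rule Lim_null_comparison[OF always_eventually[OF allI[OF est]]])
  then have "(\<lambda>N. rint \<mu> {x..<y} ?S - (rint \<mu> {x..<y} ?S - (\<Sum>n<N. rint \<mu> {x..<y} (h n)))) \<longlonglongrightarrow> rint \<mu> {x..<y} ?S - 0"
    by (intro tendsto_diff tendsto_const)
  then show ?thesis by (simp add: sums_def)
qed

context measure_sl
begin

text \<open>Inserting the homogeneous equations into themselves n times bounds f and k by
  \<open>C * Jt x n\<close>, the general term of a convergent series.\<close>

lemma seg_zero_forward:
  assumes f: "seg x y f k (\<lambda>_. 0)" and xy: "x \<le> y" and z: "f x = 0" "k x = 0"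
  shows "f y = 0 \<and> k y = 0"
proof -
  have xI: "x \<in> I" "y \<in> I" using f by (auto simp: seg_def)
  obtain C1 C2 where "\<forall>t\<in>{x..y}. cmod (f t) \<le> C1" "\<forall>t\<in>{x..y}. cmod (k t) \<le> C2"
    using f by (auto simp: seg_def bm_def)
  then obtain C where C: "\<forall>t\<in>{x..y}. cmod (f t) \<le> C" "\<forall>t\<in>{x..y}. cmod (k t) \<le> C" "C \<ge> 0"
    by (intro that[of "max (max C1 C2) 0"]) (auto simp: le_max_iff_disj)
  have est: "ennreal (cmod (f t)) \<le> ennreal C * Jt x n t \<and> ennreal (cmod (k t)) \<le> ennreal C * Jt x n t"
    if "x \<le> t" "t \<le> y" for n t
    using that
  proof (induction n arbitrary: t)
    case 0
    then show ?case using C by (auto intro!: ennreal_leI)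
  next
    case (Suc n)
    have ft: "f t = rint \<sigma> {x..<t} k" "k t = rint chi {x..<t} f"
    proof -
      have "f t = f x + rint \<sigma> {x..<t} k \<and> k t = k x + rint chi {x..<t} f - (LINT r:{x..<t}|\<rho>. 0)"
        using f Suc.prems unfolding seg_def by (meson order_refl)
      then show "f t = rint \<sigma> {x..<t} k" "k t = rint chi {x..<t} f" using z by simp_all
    qed
    note i = seg_int[OF f order_refl Suc.prems]
    have "ennreal (cmod (f t)) \<le> nr \<sigma> {x..<t} (\<lambda>s. ennreal (cmod (k s)))"
      unfolding ft(1) by (rule rint_nn_bound[OF i(1)])
    also have "\<dots> \<le> nr \<sigma> {x..<t} (\<lambda>s. ennreal C * Jt x n s)"
      using Suc by (intro nr_mono) auto
    also have "\<dots> \<le> ennreal C * Jt x (Suc n) t"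
      using nr_cmult[OF rlocfin_sigma Jt_measurable] by (simp add: tot_def distrib_left)
    finally have 1: "ennreal (cmod (f t)) \<le> ennreal C * Jt x (Suc n) t" .
    have "ennreal (cmod (k t)) \<le> nr chi {x..<t} (\<lambda>s. ennreal (cmod (f s)))"
      unfolding ft(2) by (rule rint_nn_bound[OF i(2)])
    also have "\<dots> \<le> nr chi {x..<t} (\<lambda>s. ennreal C * Jt x n s)"
      using Suc by (intro nr_mono) auto
    also have "\<dots> \<le> ennreal C * Jt x (Suc n) t"
      using nr_cmult[OF rlocfin_chi Jt_measurable] by (simp add: tot_def distrib_left)
    finally show ?case using 1 by simp
  qed
  have le: "cmod (f y) \<le> C * jr x n y" "cmod (k y) \<le> C * jr x n y" for n
  proof -
    have j: "jr x n y \<ge> 0" by (simp add: jr_def)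
    have "ennreal C * Jt x n y = ennreal (C * jr x n y)"
      using Jt_jr[OF xI xy] C(3) j by (simp add: ennreal_mult)
    then show "cmod (f y) \<le> C * jr x n y" "cmod (k y) \<le> C * jr x n y"
      using est[OF xy order_refl, of n] C(3) j by (auto simp: ennreal_le_iff)
  qed
  have "(\<lambda>n. C * jr x n y) \<longlonglongrightarrow> C * 0"
    by (intro tendsto_mult tendsto_const summable_LIMSEQ_zero summable_jr[OF xI xy])
  then have "(\<lambda>n. C * jr x n y) \<longlonglongrightarrow> 0" by simp
  then have "cmod (f y) \<le> 0" "cmod (k y) \<le> 0"
    using le by (auto intro: LIMSEQ_le_const simp del: norm_le_zero_iff)
  then show ?thesis by simp
qed

text \<open>The iterates are the terms of the series for the solution, not its partial sums.\<close>

fun picard :: "real \<Rightarrow> (real \<Rightarrow> complex) \<times> (real \<Rightarrow> complex) \<Rightarrow> nat \<Rightarrow> (real \<Rightarrow> complex) \<times> (real \<Rightarrow> complex)" where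
  "picard x p 0 = p"
| "picard x p (Suc n) = (\<lambda>t. rint \<sigma> {x..<t} (snd (picard x p n)), \<lambda>t. rint chi {x..<t} (fst (picard x p n)))"

lemma forward_exists:
  assumes x: "x \<in> I" and w: "\<And>y. y \<in> I \<Longrightarrow> x \<le> y \<Longrightarrow> set_integrable \<rho> {x..y} w"
  shows "\<exists>f k. f x = f0 \<and> k x = k0 \<and> (\<forall>y\<in>I. x \<le> y \<longrightarrow> seg x y f k w)"
proof -
  \<comment> \<open>Initial values and source together form the zeroth term; every further term is
    the homogeneous integral operator applied to the one before.\<close>
  define p where "p = ((\<lambda>t. f0) :: real \<Rightarrow> complex, \<lambda>t. k0 - (LINT s:{x..<t}|\<rho>. w s))"
  define F K where "F n = fst (picard x p n)" and "K n = snd (picard x p n)" for n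
  have F0: "F 0 = (\<lambda>t. f0)" "K 0 = (\<lambda>t. k0 - (LINT s:{x..<t}|\<rho>. w s))"
    and FS: "F (Suc n) = (\<lambda>t. rint \<sigma> {x..<t} (K n))" "K (Suc n) = (\<lambda>t. rint chi {x..<t} (F n))" for n
    by (simp_all add: F_def K_def p_def)
  define f k where "f t = (\<Sum>n. F n t)" and "k t = (\<Sum>n. K n t)" for t
  have bmFK: "bm x y (F n) \<and> bm x y (K n)" if y: "y \<in> I" "x \<le> y" for y n
  proof (induction n)
    case 0
    show ?case unfolding F0 by (intro conjI bm_const bm_diff bm_primitive[OF H1 w[OF y]])
  next
    case (Suc n)
    then show ?case unfolding FS by (intro conjI bm_rint[OF rlocfin_sigma] bm_rint[OF rlocfin_chi] rset_int_bm[OF rlocfin_sigma x y(1)] rset_int_bm[OF rlocfin_chi x y(1)]) auto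
  qed
  have bound: "\<exists>B. summable B \<and> (\<forall>n t. x \<le> t \<longrightarrow> t \<le> y \<longrightarrow> cmod (F n t) \<le> B n \<and> cmod (K n t) \<le> B n)"
    if y: "y \<in> I" "x \<le> y" for y
  proof -
    obtain C where C: "\<forall>t\<in>{x..y}. cmod (K 0 t) \<le> C" using bmFK[OF y, of 0] by (auto simp: bm_def)
    define D where "D = max (max C (cmod f0)) 0"
    have D: "D \<ge> 0" "\<And>t. x \<le> t \<Longrightarrow> t \<le> y \<Longrightarrow> cmod (K 0 t) \<le> D" "cmod f0 \<le> D"
      using C by (auto simp: D_def le_max_iff_disj)
    have est: "ennreal (cmod (F n t)) \<le> ennreal D * Jt x n t \<and> ennreal (cmod (K n t)) \<le> ennreal D * Jt x n t"
      if "x \<le> t" "t \<le> y" for n t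
      using that
    proof (induction n arbitrary: t)
      case 0
      then show ?case using D by (auto intro!: ennreal_leI simp: F0(1))
    next
      case (Suc n)
      have tI: "t \<in> I" using Iab_convex[OF x y(1)] Suc.prems by auto
      have i: "rset_int \<sigma> {x..<t} (K n)" "rset_int chi {x..<t} (F n)"
        using rset_int_subset[OF rlocfin_sigma rset_int_bm[OF rlocfin_sigma x tI], of "K n" "{x..<t}"]
          rset_int_subset[OF rlocfin_chi rset_int_bm[OF rlocfin_chi x tI], of "F n" "{x..<t}"]
          bmFK[OF tI Suc.prems(1), of n] atLeastLessThan_subseteq_atLeastAtMost_iff[of x t x t] by auto
      have "ennreal (cmod (F (Suc n) t)) \<le> nr \<sigma> {x..<t} (\<lambda>s. ennreal (cmod (K n s)))"
        unfolding FS by (rule rint_nn_bound[OF i(1)])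
      also have "\<dots> \<le> nr \<sigma> {x..<t} (\<lambda>s. ennreal D * Jt x n s)"
        using Suc by (intro nr_mono) auto
      also have "\<dots> \<le> ennreal D * Jt x (Suc n) t"
        using nr_cmult[OF rlocfin_sigma Jt_measurable] by (simp add: tot_def distrib_left)
      finally have 1: "ennreal (cmod (F (Suc n) t)) \<le> ennreal D * Jt x (Suc n) t" .
      have "ennreal (cmod (K (Suc n) t)) \<le> nr chi {x..<t} (\<lambda>s. ennreal (cmod (F n s)))"
        unfolding FS by (rule rint_nn_bound[OF i(2)])
      also have "\<dots> \<le> nr chi {x..<t} (\<lambda>s. ennreal D * Jt x n s)"
        using Suc by (intro nr_mono) auto
      also have "\<dots> \<le> ennreal D * Jt x (Suc n) t"
        using nr_cmult[OF rlocfin_chi Jt_measurable] by (simp add: tot_def distrib_left)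
      finally show ?case using 1 by simp
    qed
    have "cmod (F n t) \<le> D * jr x n y \<and> cmod (K n t) \<le> D * jr x n y" if t: "x \<le> t" "t \<le> y" for n t
    proof -
      have tI: "t \<in> I" using Iab_convex[OF x y(1)] t by auto
      have j: "jr x n t \<ge> 0" by (simp add: jr_def)
      have "ennreal D * Jt x n t = ennreal (D * jr x n t)"
        using Jt_jr[OF x tI t(1)] D(1) j by (simp add: ennreal_mult)
      then have "cmod (F n t) \<le> D * jr x n t" "cmod (K n t) \<le> D * jr x n t"
        using est[OF t, of n] D(1) j by (auto simp: ennreal_le_iff)
      moreover have "D * jr x n t \<le> D * jr x n y" using jr_mono[OF x y(1) t] D(1) by (intro mult_left_mono) auto
      ultimately show ?thesis by simp
    qed
    moreover have "summable (\<lambda>n. D * jr x n y)" by (intro summable_mult summable_jr[OF x y])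
    ultimately show ?thesis by blast
  qed
  have eq: "f y = f0 + rint \<sigma> {x..<y} k" "k y = k0 - (LINT s:{x..<y}|\<rho>. w s) + rint chi {x..<y} f"
    if y: "y \<in> I" "x \<le> y" for y
  proof -
    obtain B where B: "summable B" "\<And>n t. x \<le> t \<Longrightarrow> t \<le> y \<Longrightarrow> cmod (F n t) \<le> B n" "\<And>n t. x \<le> t \<Longrightarrow> t \<le> y \<Longrightarrow> cmod (K n t) \<le> B n"
      using bound[OF y] by blast
    have "(\<lambda>n. F (Suc n) y) sums rint \<sigma> {x..<y} k"
      unfolding FS k_def[abs_def] by (rule rint_suminf[OF rlocfin_sigma x y(1) _ B(3,1)]) (use bmFK[OF y] in auto)
    then have "(\<lambda>n. F n y) sums (rint \<sigma> {x..<y} k + F 0 y)" by (rule sums_Suc)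
    then show "f y = f0 + rint \<sigma> {x..<y} k" unfolding f_def by (simp add: sums_iff F0)
    have "(\<lambda>n. K (Suc n) y) sums rint chi {x..<y} f"
      unfolding FS f_def[abs_def] by (rule rint_suminf[OF rlocfin_chi x y(1) _ B(2,1)]) (use bmFK[OF y] in auto)
    then have "(\<lambda>n. K n y) sums (rint chi {x..<y} f + K 0 y)" by (rule sums_Suc)
    then show "k y = k0 - (LINT s:{x..<y}|\<rho>. w s) + rint chi {x..<y} f" unfolding k_def by (simp add: sums_iff F0)
  qed
  have fx: "f x = f0" "k x = k0"
    using eq[OF x order_refl] by (simp_all add: set_lebesgue_integral_def)
  have "seg x y f k w" if y: "y \<in> I" "x \<le> y" for y
  proof (rule segI[OF x y(1) _ _ w[OF y]])
    obtain B where B: "summable B" "\<And>n t. x \<le> t \<Longrightarrow> t \<le> y \<Longrightarrow> cmod (F n t) \<le> B n" "\<And>n t. x \<le> t \<Longrightarrow> t \<le> y \<Longrightarrow> cmod (K n t) \<le> B n"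
      using bound[OF y] by blast
    show "bm x y f" unfolding f_def[abs_def] by (rule bm_suminf[OF _ B(2,1)]) (use bmFK[OF y] in auto)
    show "bm x y k" unfolding k_def[abs_def] by (rule bm_suminf[OF _ B(3,1)]) (use bmFK[OF y] in auto)
    fix t assume t: "x \<le> t" "t \<le> y"
    then have tI: "t \<in> I" using Iab_convex[OF x y(1)] by auto
    show "f t = f x + rint \<sigma> {x..<t} k" "k t = k x + rint chi {x..<t} f - (LINT r:{x..<t}|\<rho>. w r)"
      using eq[OF tI t(1)] fx by simp_all
  qed
  then show ?thesis using fx by blast
qed


lemma seg_cong:
  assumes f: "seg x y f k w" and e: "\<And>t. x \<le> t \<Longrightarrow> t \<le> y \<Longrightarrow> f t = g t \<and> k t = l t" and xy: "x \<le> y"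
  shows "seg x y g l w"
proof (rule segI)
  show "x \<in> I" "y \<in> I" "set_integrable \<rho> {x..y} w" using f by (auto simp: seg_def)
  have "bm x y f" "bm x y k" using f by (auto simp: seg_def)
  then show "bm x y g" "bm x y l" using e by (blast intro: bm_cong)+
  fix t assume t: "x \<le> t" "t \<le> y"
  have "f t = f x + rint \<sigma> {x..<t} k \<and> k t = k x + rint chi {x..<t} f - (LINT r:{x..<t}|\<rho>. w r)"
    using f t unfolding seg_def by (meson order_refl)
  moreover have "rint \<sigma> {x..<t} k = rint \<sigma> {x..<t} l" "rint chi {x..<t} f = rint chi {x..<t} g"
    using e t by (auto intro!: rint_cong)
  moreover have "f t = g t" "k t = l t" "f x = g x" "k x = l x" using e[OF t] e[OF order_refl xy] by auto
  ultimately show "g t = g x + rint \<sigma> {x..<t} l" "l t = l x + rint chi {x..<t} g - (LINT r:{x..<t}|\<rho>. w r)"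
    by simp_all
qed

lemma zero_integrable: "set_integrable \<rho> A (\<lambda>_. 0::complex)"
  by (simp add: set_integrable_def)

lemma forward_zero_exists:
  assumes "x \<in> I"
  obtains f k where "f x = f0" "k x = k0" "\<And>y. y \<in> I \<Longrightarrow> x \<le> y \<Longrightarrow> seg x y f k (\<lambda>_. 0)"
  using forward_exists[OF assms, of "\<lambda>_. 0" f0 k0] zero_integrable by blast

text \<open>The iteration does not run leftwards: integrals over [x, y) contain an atom at x, so the
  equations become implicit there. Instead, the Wronskians with the solutions of data (1, 0) and (0,
  1) at x vanish at y, hence at x, where they equal - k x and f x.\<close>

lemma seg_zero_backward:
  assumes f: "seg x y f k (\<lambda>_. 0)" and xy: "x \<le> y" and z: "f y = 0" "k y = 0"
  shows "f x = 0 \<and> k x = 0"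
proof -
  have xI: "x \<in> I" "y \<in> I" using f by (auto simp: seg_def)
  obtain g l where g: "g x = 1" "l x = 0" "seg x y g l (\<lambda>_. 0)" using forward_zero_exists[OF xI(1), of 1 0] xI xy by metis
  obtain g' l' where g': "g' x = 0" "l' x = 1" "seg x y g' l' (\<lambda>_. 0)" using forward_zero_exists[OF xI(1), of 0 1] xI xy by metis
  show ?thesis using Lagrange[OF f g(3) xy] Lagrange[OF f g'(3) xy] g g' z
    by (simp add: set_lebesgue_integral_def)
qed

lemma seg_zero:
  assumes f: "seg x y f k (\<lambda>_. 0)" and t: "x \<le> t" "t \<le> y" and z: "f t = 0" "k t = 0" and s: "x \<le> s" "s \<le> y"
  shows "f s = 0 \<and> k s = 0"
proof (cases "t \<le> s")
  case True
  then show ?thesis using seg_zero_forward[OF seg_subset[OF f t(1) True s(2)] True z] by simp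
next
  case False
  then have "s \<le> t" by simp
  then show ?thesis using seg_zero_backward[OF seg_subset[OF f s(1) _ t(2)] _ z] by simp
qed

lemma seg_unique:
  assumes f: "seg x y f k w" and g: "seg x y g l w" and t: "x \<le> t" "t \<le> y" and z: "f t = g t" "k t = l t"
    and s: "x \<le> s" "s \<le> y"
  shows "f s = g s \<and> k s = l s"
proof -
  have "seg x y (\<lambda>t. f t - g t) (\<lambda>t. k t - l t) (\<lambda>t. 0)"
    using seg_lin[OF f g, of 1 "-1"] t by simp
  from seg_zero[OF this t _ _ s] z show ?thesis by simp
qed

lemma sys_zero:
  assumes f: "sys f k (\<lambda>_. 0)" and t: "t \<in> I" "f t = 0" "k t = 0" and s: "s \<in> I"
  shows "f s = 0 \<and> k s = 0"
  using seg_zero[OF sysD[OF f], of "min s t" "max s t" t s] t s by (auto simp: min_def max_def)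

text \<open>To prescribe data at x0, to the right of the starting point, correct a particular
  solution by two homogeneous ones. Their Wronskian is 1 at x, hence at x0, so Cramer's rule gives
  \<open>c1\<close> and \<open>c2\<close> without division.\<close>

lemma seg_exists_at:
  assumes x: "x \<in> I" "x0 \<in> I" "x \<le> x0" and w: "\<And>y. y \<in> I \<Longrightarrow> x \<le> y \<Longrightarrow> set_integrable \<rho> {x..y} w"
  shows "\<exists>f k. f x0 = f0 \<and> k x0 = k0 \<and> (\<forall>y\<in>I. x \<le> y \<longrightarrow> seg x y f k w)"
proof -
  obtain u l where u: "u x = 1" "l x = 0" "\<And>y. y \<in> I \<Longrightarrow> x \<le> y \<Longrightarrow> seg x y u l (\<lambda>_. 0)" using forward_zero_exists[OF x(1), of 1 0] by metis
  obtain u' l' where u': "u' x = 0" "l' x = 1" "\<And>y. y \<in> I \<Longrightarrow> x \<le> y \<Longrightarrow> seg x y u' l' (\<lambda>_. 0)" using forward_zero_exists[OF x(1), of 0 1] by metis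
  obtain p q where p: "\<And>y. y \<in> I \<Longrightarrow> x \<le> y \<Longrightarrow> seg x y p q w"
    using forward_exists[OF x(1), of w 0 0] w by blast
  have W: "u x0 * l' x0 - l x0 * u' x0 = 1"
    using Lagrange[OF u(3) u'(3) x(3)] x u u' by (simp add: set_lebesgue_integral_def)
  define A B where "A = f0 - p x0" and "B = k0 - q x0"
  define c1 c2 where "c1 = A * l' x0 - B * u' x0" and "c2 = u x0 * B - l x0 * A"
  let ?f = "\<lambda>t. 1 * p t + 1 * (c1 * u t + c2 * u' t)" and ?k = "\<lambda>t. 1 * q t + 1 * (c1 * l t + c2 * l' t)"
  have "seg x y ?f ?k w" if "y \<in> I" "x \<le> y" for y
    using seg_lin[OF p[OF that] seg_lin[OF u(3)[OF that] u'(3)[OF that] that(2), of c1 c2] that(2), of 1 1] by simp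
  moreover have "?f x0 = p x0 + A * (u x0 * l' x0 - l x0 * u' x0)" "?k x0 = q x0 + B * (u x0 * l' x0 - l x0 * u' x0)"
    by (simp_all add: c1_def c2_def algebra_simps)
  ultimately show ?thesis unfolding W A_def B_def by (intro exI[of _ ?f] exI[of _ ?k]) simp
qed

text \<open>Solutions through the same data at x0 but with different starting points agree by
  uniqueness. The value at t is read off the one that starts at \<open>min t x0\<close>.\<close>

lemma sys_exists:
  assumes x0: "x0 \<in> I" and w: "\<And>x y. x \<in> I \<Longrightarrow> y \<in> I \<Longrightarrow> set_integrable \<rho> {x..y} w"
  obtains f k where "sys f k w" "f x0 = f0" "k x0 = k0"
proof -
  have "\<forall>x. \<exists>p. x \<in> I \<and> x \<le> x0 \<longrightarrow> fst p x0 = f0 \<and> snd p x0 = k0 \<and> (\<forall>y\<in>I. x \<le> y \<longrightarrow> seg x y (fst p) (snd p) w)"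
    using seg_exists_at[OF _ x0] w by (metis fst_conv snd_conv)
  then obtain p where p: "\<And>x. x \<in> I \<Longrightarrow> x \<le> x0 \<Longrightarrow> fst (p x) x0 = f0 \<and> snd (p x) x0 = k0"
    "\<And>x y. x \<in> I \<Longrightarrow> x \<le> x0 \<Longrightarrow> y \<in> I \<Longrightarrow> x \<le> y \<Longrightarrow> seg x y (fst (p x)) (snd (p x)) w"
    by metis
  define f k where "f t = fst (p (min t x0)) t" and "k t = snd (p (min t x0)) t" for t
  have eq: "fst (p x) t = f t \<and> snd (p x) t = k t" if t: "x \<in> I" "t \<in> I" "x \<le> x0" "x \<le> t" for x t
  proof -
    let ?m = "min t x0" and ?M = "max t x0"
    have m: "?m \<in> I" "?M \<in> I" "x \<le> ?m" "?m \<le> x0" "?m \<le> t" "t \<le> ?M" "x0 \<le> ?M" "?m \<le> ?M" "x \<le> ?M"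
      using t x0 by (auto simp: min_def max_def)
    have "seg ?m ?M (fst (p x)) (snd (p x)) w" using seg_subset[OF p(2)[OF t(1,3) m(2,9)] m(3,8) order_refl] .
    from seg_unique[OF this p(2)[OF m(1,4,2,8)] m(4,7) _ _ m(5,6)] p(1)[OF t(1,3)] p(1)[OF m(1,4)]
    show ?thesis by (simp add: f_def k_def)
  qed
  have "sys f k w" unfolding sys_def
  proof (intro ballI impI)
    fix x y assume xy: "x \<in> I" "y \<in> I" "x \<le> y"
    define m where "m = min x x0"
    have m: "m \<in> I" "m \<le> x0" "m \<le> x" "m \<le> y" using xy x0 by (auto simp: m_def min_def)
    have "seg m y f k w"
      by (rule seg_cong[OF p(2)[OF m(1,2) xy(2) m(4)] _ m(4)]) (use eq[OF m(1) _ m(2)] Iab_convex[OF m(1) xy(2)] in auto)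
    then show "seg x y f k w" by (rule seg_subset[OF _ m(3) xy(3) order_refl])
  qed
  moreover have "f x0 = f0" "k x0 = k0" using p(1)[OF x0 order_refl] by (simp_all add: f_def k_def)
  ultimately show ?thesis using that by blast
qed

section \<open>One-sided limits of solutions and densities with vanishing integrals\<close>

lemma seg_left_f:
  assumes f: "seg x y f k w" and t: "x < t" "t \<le> y" and e: "e > 0"
  shows "\<exists>d>0. \<forall>s. t - d \<le> s \<longrightarrow> s < t \<longrightarrow> x \<le> s \<and> cmod (f t - f s) < e"
proof -
  have xI: "x \<in> I" "t \<in> I" using f seg_I[OF f] t by (auto simp: seg_def)
  obtain B where B: "\<forall>s\<in>{x..y}. cmod (k s) \<le> B" using f by (auto simp: seg_def bm_def)
  then have B0: "B \<ge> 0" using t by (meson atLeastAtMost_iff less_imp_le norm_ge_zero order_trans)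
  obtain d where d: "d > 0" "\<forall>s. t - d \<le> s \<longrightarrow> s < t \<longrightarrow> s \<in> I \<and> tv \<sigma> {s..<t} < e / (B + 1)"
    using tv_tail_left[OF rlocfin_sigma xI(2), of "e / (B + 1)"] e B0 by auto
  show ?thesis
  proof (intro exI[of _ "min d (t - x)"] conjI allI impI)
    fix s assume s: "t - min d (t - x) \<le> s" "s < t"
    then show xs: "x \<le> s" by auto
    then have sI: "s \<in> I" using seg_I[OF f, of s] s t by auto
    have "f t - f s = rint \<sigma> {s..<t} k" using f xs s t unfolding seg_def by (smt (verit) add_diff_cancel_left')
    also have "cmod \<dots> \<le> B * tv \<sigma> {s..<t}" using B xs t by (intro rint_bound[OF rlocfin_sigma sI xI(2)]) auto
    also have "\<dots> \<le> B * (e / (B + 1))"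
    proof -
      have "s \<ge> t - d" using s by simp
      then have "tv \<sigma> {s..<t} < e / (B + 1)" using d(2) s(2) by blast
      then show ?thesis using B0 by (intro mult_left_mono) auto
    qed
    also have "\<dots> < e" using e B0 by (simp add: field_simps)
    finally show "cmod (f t - f s) < e" .
  qed (use d t in auto)
qed

text \<open>An atom of \<sigma> makes f jump on the right; \<open>f t + rint \<sigma> {t} k\<close>
  is the limit f(t+) that (H5) refers to.\<close>

lemma seg_right_f:
  assumes f: "seg x y f k w" and t: "x \<le> t" "t < y" and e: "e > 0"
  shows "\<exists>d>0. \<forall>s. s \<le> t + d \<longrightarrow> t < s \<longrightarrow> s \<le> y \<and> cmod (f s - (f t + rint \<sigma> {t} k)) < e"
proof -
  have xI: "x \<in> I" "t \<in> I" using f seg_I[OF f] t by (auto simp: seg_def)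
  obtain B where B: "\<forall>s\<in>{x..y}. cmod (k s) \<le> B" using f by (auto simp: seg_def bm_def)
  then have B0: "B \<ge> 0" using t by (meson atLeastAtMost_iff less_imp_le norm_ge_zero order_trans)
  obtain d where d: "d > 0" "\<forall>s. s \<le> t + d \<longrightarrow> t < s \<longrightarrow> s \<in> I \<and> tv \<sigma> {t<..<s} < e / (B + 1)"
    using tv_tail_right[OF rlocfin_sigma xI(2), of "e / (B + 1)"] e B0 by auto
  show ?thesis
  proof (intro exI[of _ "min d (y - t)"] conjI allI impI)
    fix s assume s: "s \<le> t + min d (y - t)" "t < s"
    then show xs: "s \<le> y" by auto
    then have sI: "s \<in> I" using seg_I[OF f, of s] s t by auto
    have "f s = f t + rint \<sigma> {t..<s} k" using f xs s t unfolding seg_def by (meson less_imp_le)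
    also have "rint \<sigma> {t..<s} k = rint \<sigma> {t} k + rint \<sigma> {t<..<s} k"
      using seg_int(1)[OF f t(1) _ xs] s by (intro rint_split_left[OF rlocfin_sigma]) auto
    finally have "f s - (f t + rint \<sigma> {t} k) = rint \<sigma> {t<..<s} k" by simp
    also have "cmod \<dots> \<le> B * tv \<sigma> {t<..<s}" using B xs t by (intro rint_bound[OF rlocfin_sigma xI(2) sI]) auto
    also have "\<dots> \<le> B * (e / (B + 1))"
    proof -
      have "s \<le> t + d" using s by simp
      then have "tv \<sigma> {t<..<s} < e / (B + 1)" using d(2) s(2) by blast
      then show ?thesis using B0 by (intro mult_left_mono) auto
    qed
    also have "\<dots> < e" using e B0 by (simp add: field_simps)
    finally show "cmod (f s - (f t + rint \<sigma> {t} k)) < e" .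
  qed (use d t in auto)
qed

lemma seg_left_k:
  assumes f: "seg x y f k w" and t: "x < t" "t \<le> y" and e: "e > 0"
  shows "\<exists>s. x \<le> s \<and> s < t \<and> (\<forall>r. s < r \<longrightarrow> r < t \<longrightarrow> cmod (k t - k r) < e)"
proof -
  have xI: "x \<in> I" "t \<in> I" using f seg_I[OF f] t by (auto simp: seg_def)
  obtain B where B: "\<forall>s\<in>{x..y}. cmod (f s) \<le> B" using f by (auto simp: seg_def bm_def)
  then have B0: "B \<ge> 0" using t by (meson atLeastAtMost_iff less_imp_le norm_ge_zero order_trans)
  obtain d where d: "d > 0" "\<forall>s. t - d \<le> s \<longrightarrow> s < t \<longrightarrow> s \<in> I \<and> tv chi {s..<t} < e / 2 / (B + 1)"
    using tv_tail_left[OF rlocfin_chi xI(2), of "e / 2 / (B + 1)"] e B0 by auto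
  have wi: "set_integrable \<rho> {x..y} w" using f by (simp add: seg_def)
  have ni: "set_integrable \<rho> A (\<lambda>r. cmod (w r))" if "A \<in> sets borel" "A \<subseteq> {x..y}" for A
  proof -
    have "set_integrable \<rho> A w" by (rule set_integrable_subset[OF wi]) (use that locfin_sets[OF H1] in auto)
    then have "integrable \<rho> (\<lambda>r. norm (indicator A r *\<^sub>R w r))" unfolding set_integrable_def by (rule integrable_norm)
    then show ?thesis by (simp add: set_integrable_def)
  qed
  \<comment> \<open>The source is merely integrable, so small \<rho>-mass gives no quantitative
    bound on its integral. Continuity of the integral of |w| in its end point is used
    instead.\<close>
  have "((\<lambda>r. LINT s:{x..r}|\<rho>. cmod (w s)) \<longlongrightarrow> (LINT s:{x..<t}|\<rho>. cmod (w s))) (at_left t)"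
  proof (rule tendsto_set_lebesgue_integral_at_left[OF t(1)])
    show "{x..b'} \<in> sets \<rho>" for b' using locfin_sets[OF H1] by simp
    show "set_integrable \<rho> {x..<t} (\<lambda>r. cmod (w r))" by (rule ni) (use t in auto)
  qed
  then have "\<forall>\<^sub>F r in at_left t. dist (LINT s:{x..r}|\<rho>. cmod (w s)) (LINT s:{x..<t}|\<rho>. cmod (w s)) < e/2"
    using e by (intro tendstoD) auto
  then obtain s0 where s0: "s0 < t" "\<And>r. s0 < r \<Longrightarrow> r < t \<Longrightarrow> dist (LINT s:{x..r}|\<rho>. cmod (w s)) (LINT s:{x..<t}|\<rho>. cmod (w s)) < e/2"
    unfolding eventually_at_left_field by auto
  define s where "s = (max (max s0 (t - d)) x + t) / 2"
  have s: "s0 < s" "t - d < s" "x < s" "s < t" using s0(1) d t unfolding s_def by (auto simp: max_def field_simps)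
  have tail: "(LINT r:{s<..<t}|\<rho>. cmod (w r)) < e/2"
  proof -
    have "{x..<t} = {x..s} \<union> {s<..<t}" using s by auto
    then have "(LINT r:{x..<t}|\<rho>. cmod (w r)) = (LINT r:{x..s}|\<rho>. cmod (w r)) + (LINT r:{s<..<t}|\<rho>. cmod (w r))"
      using s t by (simp only:) (intro set_integral_Un ni, auto)
    then show ?thesis using s0(2)[OF s(1,4)] by (auto simp: dist_real_def)
  qed
  show ?thesis
  proof (intro exI[of _ s] conjI allI impI)
    fix r assume r: "s < r" "r < t"
    then have rI: "r \<in> I" using seg_I[OF f, of r] s t by auto
    have "k t = k r + rint chi {r..<t} f - (LINT r:{r..<t}|\<rho>. w r)" using f r s t unfolding seg_def by (meson less_imp_le less_trans)
    then have "cmod (k t - k r) \<le> cmod (rint chi {r..<t} f) + cmod (LINT r:{r..<t}|\<rho>. w r)"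
      using norm_triangle_ineq4[of "rint chi {r..<t} f" "LINT r:{r..<t}|\<rho>. w r"] by simp
    also have "cmod (rint chi {r..<t} f) \<le> B * tv chi {r..<t}" using B r s t by (intro rint_bound[OF rlocfin_chi rI xI(2)]) auto
    also have "\<dots> \<le> B * (e / 2 / (B + 1))"
    proof -
      have "t - d \<le> r" using r s by simp
      then have "tv chi {r..<t} < e / 2 / (B + 1)" using d(2) r(2) by blast
      then show ?thesis using B0 by (intro mult_left_mono) auto
    qed
    also have "\<dots> \<le> e / 2" using e B0 by (simp add: field_simps)
    also have "cmod (LINT r:{r..<t}|\<rho>. w r) \<le> (LINT q:{r..<t}|\<rho>. cmod (w q))"
      unfolding set_lebesgue_integral_def by (rule integral_norm_bound[THEN order_trans]) simp
    also have "\<dots> \<le> (LINT q:{s<..<t}|\<rho>. cmod (w q))"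
      unfolding set_lebesgue_integral_def
      by (rule integral_mono; (fold set_integrable_def)?) (use r s t in \<open>auto intro!: ni simp: indicator_def\<close>)
    also note tail
    finally show "cmod (k t - k r) < e" by simp
  qed (use s in auto)
qed

end

text \<open>Half-lines generate the Borel sets and are closed under intersection, so the integral
  vanishes over every Borel subset of [x, y). On a set that carries one Jordan component and is null
  for the other no cancellation is left, so h vanishes there almost everywhere.\<close>

lemma rint_zero_AE:
  assumes \<mu>: "real_meas a b \<mu>" and xy: "x \<in> Iab a b" "y \<in> Iab a b" and h: "rset_int \<mu> {x..y} h"
    and z: "\<And>t. x \<le> t \<Longrightarrow> t \<le> y \<Longrightarrow> rint \<mu> {x..<t} h = 0"
  shows "(AE t in fst \<mu>. t \<in> {x..<y} \<longrightarrow> h t = 0) \<and> (AE t in snd \<mu>. t \<in> {x..<y} \<longrightarrow> h t = 0)"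
proof (cases "x \<le> y")
  case True
  have rl: "rlocfin a b \<mu>" using real_meas_rlocfin[OF \<mu>] .
  then have l: "locfin a b (fst \<mu>)" "locfin a b (snd \<mu>)" by (auto simp: rlocfin_def)
  note ss[simp] = locfin_sets[OF l(1)] locfin_sets[OF l(2)]
  obtain A where A: "A \<in> sets borel" "emeasure (fst \<mu>) A = 0" "emeasure (snd \<mu>) (- A) = 0"
    using \<mu> by (auto simp: real_meas_def)
  define J where "J = {x..<y}"
  have J: "J \<in> sets borel" "J \<subseteq> {x..y}" by (auto simp: J_def)
  have i: "rset_int \<mu> (B \<inter> J) h" if "B \<in> sets borel" for B
    using rset_int_subset[OF rl h, of "B \<inter> J"] J that by auto
  have si: "set_integrable M (B \<inter> J) h" if "M \<in> {fst \<mu>, snd \<mu>}" "B \<in> sets borel" for M B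
    using i[OF that(2)] that(1) by (auto simp: rset_int_def)
  have all: "rint \<mu> (B \<inter> J) h = 0" if "B \<in> sets borel" for B
  proof -
    have B: "B \<in> sigma_sets UNIV (range lessThan)" using that by (simp add: borel_Iio)
    have "Int_stable (range (lessThan :: real \<Rightarrow> _))"
    proof -
      have "{..<p} \<inter> {..<q} \<in> range lessThan" for p q :: real
        by (rule range_eqI[of _ _ "min p q"]) auto
      then show ?thesis by (auto simp: Int_stable_def)
    qed
    moreover have "range (lessThan :: real \<Rightarrow> _) \<subseteq> Pow UNIV" by simp
    ultimately show ?thesis using B
    proof (induction rule: sigma_sets_induct_disjoint)
      case (basic B)
      then obtain t where B: "B = {..<t}" by auto
      show ?case
      proof (cases "x \<le> min t y")
        case True
        have "B \<inter> J = {x..<min t y}" by (auto simp: B J_def)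
        then show ?thesis using z[OF True] by simp
      next
        case False
        then have "B \<inter> J = {}" using \<open>x \<le> y\<close> by (auto simp: B J_def)
        then show ?thesis by simp
      qed
    next
      case (compl B)
      then have B: "B \<in> sets borel" by (simp add: borel_Iio)
      have "rint \<mu> J h = 0" using z[OF True order_refl] by (simp add: J_def)
      moreover have "rint \<mu> J h = rint \<mu> (B \<inter> J) h + rint \<mu> ((UNIV - B) \<inter> J) h"
      proof -
        have u: "(B \<inter> J) \<union> ((UNIV - B) \<inter> J) = J" by auto
        have "(LINT t:J|M. h t) = (LINT t:B \<inter> J|M. h t) + (LINT t:(UNIV - B) \<inter> J|M. h t)"
          if M: "M \<in> {fst \<mu>, snd \<mu>}" for M
          using set_integral_Un[of "B \<inter> J" "(UNIV - B) \<inter> J" M h] si[OF M B] si[OF M, of "UNIV - B"] B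
          unfolding u by auto
        from this[of "fst \<mu>"] this[of "snd \<mu>"] show ?thesis by (simp add: rint_def)
      qed
      ultimately show ?case using compl by simp
    next
      case (union B)
      have B: "B i \<in> sets borel" for i using union by (auto simp: borel_Iio)
      have e: "(\<Union>i. B i) \<inter> J = (\<Union>i. B i \<inter> J)" by auto
      \<comment> \<open>\<open>rint\<close> is a difference of two series; each is shown to converge
        on its own, so that they may be subtracted termwise.\<close>
      have s: "(LINT t:(\<Union>i. B i \<inter> J)|M. h t) = (\<Sum>i. (LINT t:B i \<inter> J|M. h t)) \<and> summable (\<lambda>i. LINT t:B i \<inter> J|M. h t)"
        if M: "M \<in> {fst \<mu>, snd \<mu>}" for M
      proof -
        have sM: "sets M = sets borel" using M by auto
        have BJ: "B i \<inter> J \<in> sets M" for i using B[of i] J(1) sM by simp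
        have dj: "(B i \<inter> J) \<inter> (B j \<inter> J) = {}" if "i \<noteq> j" for i j
          using union(1) that unfolding disjoint_family_on_def by blast
        have "(\<Union>i. B i) \<in> sets borel" using B by (intro sets.countable_UN) auto
        from si[OF M this] have int: "set_integrable M (\<Union>i. B i \<inter> J) h" unfolding e .
        have "(LINT t:(\<Union>i. B i \<inter> J)|M. h t) = (\<Sum>i. (LINT t:B i \<inter> J|M. h t))"
          by (rule lebesgue_integral_countable_add[OF BJ dj int])
        moreover have "(\<lambda>n. LINT t:(\<Union>i<n. B i \<inter> J)|M. h t) \<longlonglongrightarrow> (LINT t:(\<Union>n. \<Union>i<n. B i \<inter> J)|M. h t)"
        proof (rule set_integral_cont_up)
          show "(\<Union>i<n. B i \<inter> J) \<in> sets M" for n using BJ by (intro sets.finite_UN) auto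
          show "incseq (\<lambda>n. \<Union>i<n. B i \<inter> J)" by (force simp: incseq_def)
          have "(\<Union>n. \<Union>i<n. B i \<inter> J) = (\<Union>i. B i \<inter> J)" by auto
          then show "set_integrable M (\<Union>n. \<Union>i<n. B i \<inter> J) h" using int by (simp only:)
        qed
        moreover have "(LINT t:(\<Union>i<n. B i \<inter> J)|M. h t) = (\<Sum>i<n. (LINT t:B i \<inter> J|M. h t))" for n
        proof (rule set_integral_finite_Union)
          show "disjoint_family_on (\<lambda>i. B i \<inter> J) {..<n}" using dj by (auto simp: disjoint_family_on_def)
          show "set_integrable M (B i \<inter> J) h" for i using si[OF M B] .
          show "B i \<inter> J \<in> sets M" for i using BJ .
        qed simp
        ultimately show ?thesis by (auto simp: summable_def sums_def)
      qed
      have s1: "fst \<mu> \<in> {fst \<mu>, snd \<mu>}" and s2: "snd \<mu> \<in> {fst \<mu>, snd \<mu>}" by auto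
      have "rint \<mu> (\<Union>i. B i \<inter> J) h = (\<Sum>i. rint \<mu> (B i \<inter> J) h)"
        unfolding rint_def s[OF s1, THEN conjunct1] s[OF s2, THEN conjunct1]
        by (rule suminf_diff[OF s[OF s1, THEN conjunct2] s[OF s2, THEN conjunct2]])
      then show ?case unfolding e using union(3) by (simp only: suminf_zero)
    qed auto
  qed
  have null: "(LINT t:N|M. h t) = 0" if "emeasure M N = 0" "N \<in> sets M" for M and N :: "real set"
  proof -
    have "AE t in M. t \<notin> N" using that by (intro AE_not_in) auto
    then have "AE t in M. indicator N t *\<^sub>R h t = 0" by eventually_elim simp
    then show ?thesis unfolding set_lebesgue_integral_def by (rule integral_eq_zero_AE)
  qed
  have fin: "AE t in M. t \<in> J \<longrightarrow> h t = 0"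
    if M: "M \<in> {fst \<mu>, snd \<mu>}" and C: "C \<in> sets borel" "emeasure M (- C) = 0" and zero: "\<And>B. B \<in> sets borel \<Longrightarrow> (LINT t:(B \<inter> C) \<inter> J|M. h t) = 0" for M C
  proof -
    have lM: "locfin a b M" using M l by auto
    note sM = locfin_sets[OF lM]
    interpret sigma_finite_measure M using locfin_sigma_finite[OF lM] .
    have "AE t in M. indicator (C \<inter> J) t *\<^sub>R h t = 0"
    proof (rule density_zero)
      show "integrable M (\<lambda>t. indicator (C \<inter> J) t *\<^sub>R h t)" using si[OF M C(1)] by (simp add: set_integrable_def)
      fix B assume "B \<in> sets M"
      have "(LINT t:B|M. indicator (C \<inter> J) t *\<^sub>R h t) = (LINT t:(B \<inter> C) \<inter> J|M. h t)"
        unfolding set_lebesgue_integral_def by (intro Bochner_Integration.integral_cong) (auto simp: indicator_def)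
      then show "(LINT t:B|M. indicator (C \<inter> J) t *\<^sub>R h t) = 0" using zero \<open>B \<in> sets M\<close> sM by simp
    qed
    moreover have "AE t in M. t \<notin> - C" using C sM by (intro AE_not_in) auto
    ultimately show ?thesis by eventually_elim (auto simp: indicator_def split: if_splits)
  qed
  have sub0: "emeasure M N = 0" if "emeasure M N' = 0" "N \<subseteq> N'" "N' \<in> sets M" for M and N N' :: "real set"
    using emeasure_mono[OF that(2,3)] that(1) by simp
  show ?thesis unfolding J_def[symmetric]
  proof
    show "AE t in fst \<mu>. t \<in> J \<longrightarrow> h t = 0"
    proof (rule fin[of _ "- A"])
      fix B :: "real set" assume B: "B \<in> sets borel"
      have "(LINT t:(B \<inter> - A) \<inter> J|snd \<mu>. h t) = 0"
        by (rule null[OF sub0[OF A(3)]]) (use A B J in auto)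
      then show "(LINT t:(B \<inter> - A) \<inter> J|fst \<mu>. h t) = 0"
        using all[of "B \<inter> - A"] A B unfolding rint_def by auto
    qed (use A in auto)
    show "AE t in snd \<mu>. t \<in> J \<longrightarrow> h t = 0"
    proof (rule fin[of _ A])
      fix B :: "real set" assume B: "B \<in> sets borel"
      have "(LINT t:(B \<inter> A) \<inter> J|fst \<mu>. h t) = 0"
        by (rule null[OF sub0[OF A(2)]]) (use A B J in auto)
      then show "(LINT t:(B \<inter> A) \<inter> J|snd \<mu>. h t) = 0"
        using all[of "B \<inter> A"] A B unfolding rint_def by auto
    qed (use A in auto)
  qed
qed (auto simp: not_le)

context measure_sl
begin

text \<open>The quasi-derivative is left-continuous, hence determined by the function because
  the support of the leading measure is the whole interval.\<close>

lemma seg_quasi_zero: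
  assumes f: "seg x y f k w" and z: "\<And>t. x \<le> t \<Longrightarrow> t \<le> y \<Longrightarrow> f t = 0" and t: "x < t" "t \<le> y"
  shows "k t = 0"
proof (rule ccontr)
  assume kt: "k t \<noteq> 0"
  have xI: "x \<in> I" "y \<in> I" using f by (auto simp: seg_def)
  have xy: "x \<le> y" using t by simp
  have "rint \<sigma> {x..<t} k = 0" if "x \<le> t" "t \<le> y" for t
  proof -
    have "f t = f x + rint \<sigma> {x..<t} k" using f that unfolding seg_def by (meson order_refl)
    then show ?thesis using z[OF that] z[OF order_refl xy] by simp
  qed
  from rint_zero_AE[OF H3(1) xI seg_int(4)[OF f order_refl xy order_refl] this]
  have ae: "AE t in fst \<sigma>. t \<in> {x..<y} \<longrightarrow> k t = 0" "AE t in snd \<sigma>. t \<in> {x..<y} \<longrightarrow> k t = 0" by auto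
  obtain s where s: "x \<le> s" "s < t" "\<And>r. s < r \<Longrightarrow> r < t \<Longrightarrow> cmod (k t - k r) < cmod (k t)"
    using seg_left_k[OF f t, of "cmod (k t)"] kt by auto
  have k0: "k r \<noteq> 0" if "s < r" "r < t" for r using s(3)[OF that] by auto
  \<comment> \<open>The interval (s, t) written as a symmetric neighbourhood of its midpoint, the
    form used by \<open>supp_real\<close>.\<close>
  define m e where "m = (s + t) / 2" and "e = (t - s) / 2"
  have m: "m - e = s" "m + e = t" "e > 0" using s by (auto simp: m_def e_def field_simps)
  have "m \<in> I" using seg_I[OF f, of m] m s t by auto
  then have pos: "emeasure (fst \<sigma>) {m - e<..<m + e} + emeasure (snd \<sigma>) {m - e<..<m + e} > 0"
    using H3(2) m(3) unfolding supp_real_def by blast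
  have "emeasure M {s<..<t} = 0" if "AE t in M. t \<in> {x..<y} \<longrightarrow> k t = 0" "sets M = sets borel" for M
  proof -
    have "AE r in M. r \<notin> {s<..<t}" using that(1) k0 s t by (auto elim!: eventually_mono)
    then show ?thesis using AE_iff_null_sets[of "{s<..<t}" M] that(2) by (simp add: null_sets_def)
  qed
  moreover have "sets (fst \<sigma>) = sets borel" "sets (snd \<sigma>) = sets borel"
    using rlocfin_sigma locfin_sets unfolding rlocfin_def by blast+
  ultimately show False using pos ae m by simp
qed

end

section \<open>Solutions vanishing on the support of the weight\<close>

text \<open>Off the support every point has a null neighbourhood; Lindelof reduces their union to a
  countable one.\<close>

lemma null_off_supp:
  assumes M: "locfin a b M" and U: "open U" "U \<subseteq> Iab a b" "U \<inter> supp_pos a b M = {}"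
  shows "emeasure M U = 0"
proof -
  define F where "F = {{x - e<..<x + e} |x e. emeasure M {x - e<..<x + e} = 0}"
  have "open S" if "S \<in> F" for S using that by (auto simp: F_def)
  then obtain F' where F': "F' \<subseteq> F" "countable F'" "\<Union>F' = \<Union>F" using Lindelof by metis
  have "U \<subseteq> \<Union>F"
  proof
    fix x assume x: "x \<in> U"
    then have "x \<in> Iab a b" "x \<notin> supp_pos a b M" using U by auto
    then obtain e where "e > 0" "emeasure M {x - e<..<x + e} = 0"
      unfolding supp_pos_def by (auto simp: not_less)
    then have "{x - e<..<x + e} \<in> F" "x \<in> {x - e<..<x + e}" by (auto simp: F_def)
    then show "x \<in> \<Union>F" by blast
  qed
  moreover have "S \<in> null_sets M" if S: "S \<in> F'" for S
  proof -
    obtain x e where "S = {x - e<..<x + e}" "emeasure M {x - e<..<x + e} = 0"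
      using F'(1) S unfolding F_def by blast
    then show ?thesis by (intro null_setsI) (auto simp: locfin_sets[OF M])
  qed
  then have "\<Union>F' \<in> null_sets M" using null_sets_UN'[OF F'(2), of "\<lambda>S. S"] by simp
  moreover have "U \<in> sets M" using U(1) locfin_sets[OF M] by simp
  ultimately show ?thesis using emeasure_mono[of U "\<Union>F'" M] F'(3) by (simp add: null_sets_def)
qed

text \<open>Makes the end points of a gap support points, as (H5) requires.\<close>

lemma supp_pos_closed:
  assumes M: "locfin a b M" and p: "p \<in> Iab a b" and s: "\<And>e. e > 0 \<Longrightarrow> \<exists>s\<in>supp_pos a b M. \<bar>s - p\<bar> < e"
  shows "p \<in> supp_pos a b M"
  unfolding supp_pos_def
proof (intro CollectI conjI allI impI p)
  fix e :: real assume e: "e > 0"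
  obtain s where s: "s \<in> supp_pos a b M" "\<bar>s - p\<bar> < e / 2" using s[of "e/2"] e by auto
  then have "emeasure M {s - e/2<..<s + e/2} > 0" using e unfolding supp_pos_def by (auto dest!: spec[of _ "e/2"])
  also have "emeasure M {s - e/2<..<s + e/2} \<le> emeasure M {p - e<..<p + e}"
  proof (intro emeasure_mono)
    have "s - p < e / 2" "p - s < e / 2" using s(2) abs_ge_self[of "s - p"] abs_ge_minus_self[of "s - p"] by linarith+
    then show "{s - e/2<..<s + e/2} \<subseteq> {p - e<..<p + e}" by auto
  qed (simp add: locfin_sets[OF M])
  finally show "emeasure M {p - e<..<p + e} > 0" .
qed

locale measure_sl_gap = measure_sl +
  assumes H5: "\<forall>\<alpha> \<beta>. \<alpha> \<in> supp_pos a b \<rho> \<and> \<beta> \<in> supp_pos a b \<rho> \<and> \<alpha> < \<beta> \<and>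
               {\<alpha><..<\<beta>} \<inter> supp_pos a b \<rho> = {} \<longrightarrow>
               (\<forall>f\<in>Dtau a b \<rho> \<sigma> chi c. (f \<longlongrightarrow> 0) (at_left \<alpha>) \<and> (f \<longlongrightarrow> 0) (at_right \<beta>) \<longrightarrow>
                  (\<forall>x\<in>{\<alpha><..<\<beta>}. f x = 0))"
    and H6: "\<exists>x\<in>supp_pos a b \<rho>. \<exists>y\<in>supp_pos a b \<rho>. x \<noteq> y"
begin

abbreviation "supp \<equiv> supp_pos a b \<rho>"

lemma sets_rho [simp]: "sets \<rho> = sets borel" using locfin_sets[OF H1] .

text \<open>In the gaps between x1 and x2, f vanishes by (H5), whose boundary values are read off at
  atoms and accumulation points of \<rho>; at support points it vanishes by left-continuity. Hence f
  = 0 on (x1, x2), its quasi-derivative vanishes at an inner point too, and uniqueness carries the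
  zero data to the whole interval.\<close>

lemma sys_ae_zero:
  assumes f: "sys f k (\<lambda>_. 0)" and x: "x1 \<in> supp" "x2 \<in> supp" "\<alpha> < x1" "x1 < x2" "x2 < \<beta>" and ab: "\<alpha> \<in> I" "\<beta> \<in> I"
    and ae: "AE t in \<rho>. t \<in> {\<alpha>..<\<beta>} \<longrightarrow> f t = 0" and s: "s \<in> I"
  shows "f s = 0 \<and> k s = 0"
proof -
  have sg: "seg \<alpha> \<beta> f k (\<lambda>_. 0)" using sysD[OF f ab] x by simp
  have mI: "t \<in> I" if "\<alpha> < t" "t < \<beta>" for t using Iab_convex[OF ab] that by auto
  have pos: "\<exists>t\<in>A. f t = 0" if "emeasure \<rho> A > 0" "A \<subseteq> {\<alpha>..<\<beta>}" "A \<in> sets borel" for A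
  proof (rule ccontr)
    assume "\<not> ?thesis"
    then have "AE t in \<rho>. t \<notin> A" using ae that(2) by (auto elim!: eventually_mono)
    then show False using AE_iff_null_sets[of A \<rho>] that by (auto simp: null_sets_def)
  qed
  \<comment> \<open>At an atom of \<rho>, (H4) excludes an atom of \<sigma>; so f is continuous
    there and its right limit is 0 as well.\<close>
  have atom: "f t = 0 \<and> rint \<sigma> {t} k = 0" if t: "\<alpha> < t" "t < \<beta>" "emeasure \<rho> {t} > 0" for t
  proof -
    have "f t = 0" using pos[of "{t}"] t by auto
    have "emeasure \<rho> {t} < \<infinity>" using locfin_finite[OF H1 ab, of "{t}"] t by auto
    then have "measure \<rho> {t} \<noteq> 0" using t(3) by (auto simp: measure_def enn2real_eq_0_iff)
    then have "tv (pos_rm \<rho>) {t} \<noteq> 0" by (simp add: tv_def pos_rm_def measure_def)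
    then have "tv \<sigma> {t} = 0" using atoms_rho[OF mI[OF t(1,2)]] by auto
    moreover have "cmod (rint \<sigma> {t} k) \<le> cmod (k t) * tv \<sigma> {t}"
      using t by (intro rint_bound[OF rlocfin_sigma ab]) auto
    ultimately show ?thesis using \<open>f t = 0\<close> by simp
  qed
  \<comment> \<open>Mass in every left neighbourhood of t yields zeros of f that approach t from the
    left.\<close>
  have L: "f t = 0" if t: "\<alpha> < t" "t < \<beta>" and acc: "\<And>e. e > 0 \<Longrightarrow> emeasure \<rho> {t - e<..<t} > 0" for t
  proof (rule ccontr)
    assume "f t \<noteq> 0"
    then obtain d where d: "d > 0" "\<forall>s. t - d \<le> s \<longrightarrow> s < t \<longrightarrow> \<alpha> \<le> s \<and> cmod (f t - f s) < cmod (f t)"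
      using seg_left_f[OF sg t(1) less_imp_le[OF t(2)], of "cmod (f t)"] by auto
    have "{t - d<..<t} \<subseteq> {\<alpha>..<\<beta>}" using d t by auto
    then obtain s where "s \<in> {t - d<..<t}" "f s = 0" using pos[OF acc[OF d(1)]] by auto
    then show False using d(2)[rule_format, of s] by simp
  qed
  have R: "f t + rint \<sigma> {t} k = 0" if t: "\<alpha> < t" "t < \<beta>" and acc: "\<And>e. e > 0 \<Longrightarrow> emeasure \<rho> {t<..<t + e} > 0" for t
  proof (rule ccontr)
    let ?c = "f t + rint \<sigma> {t} k"
    assume "?c \<noteq> 0"
    then obtain d where d: "d > 0" "\<forall>s. s \<le> t + d \<longrightarrow> t < s \<longrightarrow> s \<le> \<beta> \<and> cmod (f s - ?c) < cmod ?c"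
      using seg_right_f[OF sg less_imp_le[OF t(1)] t(2), of "cmod ?c"] by auto
    have "{t<..<t + min d (\<beta> - t)} \<subseteq> {\<alpha>..<\<beta>}" using t by auto
    then obtain s where s: "s \<in> {t<..<t + min d (\<beta> - t)}" "f s = 0" using pos[OF acc] d t by (metis borel_open diff_gt_0_iff_gt min_less_iff_conj open_greaterThanLessThan)
    have "s \<le> t + d" "t < s" using s(1) by auto
    then have "cmod (f s - ?c) < cmod ?c" using d(2) by blast
    then show False using s(2) by (metis diff_0 norm_minus_cancel order_less_irrefl)
  qed
  \<comment> \<open>The support points p and q nearest to y on either side bound the gap containing
    y; (H5) then asks for f(p-) = 0 and f(q+) = 0.\<close>
  have off: "f y = 0" if y: "x1 < y" "y < x2" "y \<notin> supp" for y
  proof -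
    define A B where "A = {s\<in>supp. s \<le> y}" and "B = {s\<in>supp. y \<le> s}"
    have A: "x1 \<in> A" "bdd_above A" and B: "x2 \<in> B" "bdd_below B"
      using x y by (auto simp: A_def B_def intro: bdd_aboveI[of _ y] bdd_belowI[of _ y])
    define p q where "p = Sup A" and "q = Inf B"
    have p: "x1 \<le> p" "p \<le> y" and q: "y \<le> q" "q \<le> x2"
      unfolding p_def q_def using A B by (auto intro!: cSup_upper cSup_least cInf_lower cInf_greatest simp: A_def B_def)
    have pI: "p \<in> I" "q \<in> I" using p q x y by (auto intro!: mI)
    have ps: "p \<in> supp"
    proof (rule supp_pos_closed[OF H1 pI(1)])
      fix e :: real assume "e > 0"
      then have "p - e < Sup A" by (simp add: p_def)
      then obtain s where "s \<in> A" "p - e < s" using less_cSup_iff[of A "p - e"] A by blast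
      moreover have "s \<le> p" using \<open>s \<in> A\<close> A by (auto simp: p_def intro: cSup_upper)
      ultimately show "\<exists>s\<in>supp. \<bar>s - p\<bar> < e" by (intro bexI[of _ s]) (auto simp: A_def)
    qed
    have qs: "q \<in> supp"
    proof (rule supp_pos_closed[OF H1 pI(2)])
      fix e :: real assume "e > 0"
      then have "Inf B < q + e" by (simp add: q_def)
      then obtain s where "s \<in> B" "s < q + e" using cInf_less_iff[of B "q + e"] B by blast
      moreover have "q \<le> s" using \<open>s \<in> B\<close> B by (auto simp: q_def intro: cInf_lower)
      ultimately show "\<exists>s\<in>supp. \<bar>s - q\<bar> < e" by (intro bexI[of _ s]) (auto simp: B_def)
    qed
    have py: "p < y" "y < q" using p q ps qs y(3) by (metis less_eq_real_def)+
    have gap: "{p<..<q} \<inter> supp = {}"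
    proof -
      have False if "s \<in> supp" "p < s" "s < q" for s
      proof (cases "s \<le> y")
        case True
        then have "s \<le> p" unfolding p_def using that A by (intro cSup_upper) (auto simp: A_def)
        then show False using that by simp
      next
        case False
        then have "q \<le> s" unfolding q_def using that B by (intro cInf_lower) (auto simp: B_def)
        then show False using that by simp
      qed
      then show ?thesis by auto
    qed
    have null: "emeasure \<rho> {p<..<q} = 0"
      using gap Iab_convex[OF pI] by (intro null_off_supp[OF H1]) auto
    have al: "\<alpha> < p" "p < \<beta>" "\<alpha> < q" "q < \<beta>" using p q x py by auto
    have fp: "f p = 0"
    proof (cases "emeasure \<rho> {p} > 0")
      case True then show ?thesis using atom al by blast
    next
      case False
      show ?thesis
      proof (rule L[OF al(1,2)])
        fix e :: real assume e: "e > 0"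
        \<comment> \<open>\<rho> charges neither {p} nor the gap to the right of p, so the mass near
          the support point p lies to its left. The cut by q - p keeps the right half of the
          neighbourhood within the gap.\<close>
        define e' where "e' = min e (q - p)"
        have "emeasure \<rho> {p - e'<..<p + e'} > 0" using ps e py unfolding supp_pos_def by (auto simp: e'_def)
        also have "{p - e'<..<p + e'} = {p - e'<..<p} \<union> ({p} \<union> {p<..<p + e'})" using e py by (auto simp: e'_def)
        also have "emeasure \<rho> \<dots> \<le> emeasure \<rho> {p - e'<..<p} + emeasure \<rho> ({p} \<union> {p<..<p + e'})"
          by (rule emeasure_subadditive) auto
        also have "emeasure \<rho> ({p} \<union> {p<..<p + e'}) \<le> emeasure \<rho> {p} + emeasure \<rho> {p<..<p + e'}"
          by (rule emeasure_subadditive) auto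
        also have "emeasure \<rho> {p<..<p + e'} \<le> emeasure \<rho> {p<..<q}" by (intro emeasure_mono) (auto simp: e'_def)
        also note null
        also have "emeasure \<rho> {p - e'<..<p} \<le> emeasure \<rho> {p - e<..<p}" by (intro emeasure_mono) (auto simp: e'_def)
        finally show "emeasure \<rho> {p - e<..<p} > 0" using False by (simp add: add_right_mono add_left_mono)
      qed
    qed
    have fq: "f q + rint \<sigma> {q} k = 0"
    proof (cases "emeasure \<rho> {q} > 0")
      case True then show ?thesis using atom al by fastforce
    next
      case False
      show ?thesis
      proof (rule R[OF al(3,4)])
        fix e :: real assume e: "e > 0"
        define e' where "e' = min e (q - p)"
        have "emeasure \<rho> {q - e'<..<q + e'} > 0" using qs e py unfolding supp_pos_def by (auto simp: e'_def)
        also have "{q - e'<..<q + e'} = {q<..<q + e'} \<union> ({q} \<union> {q - e'<..<q})" using e py by (auto simp: e'_def)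
        also have "emeasure \<rho> \<dots> \<le> emeasure \<rho> {q<..<q + e'} + emeasure \<rho> ({q} \<union> {q - e'<..<q})"
          by (rule emeasure_subadditive) auto
        also have "emeasure \<rho> ({q} \<union> {q - e'<..<q}) \<le> emeasure \<rho> {q} + emeasure \<rho> {q - e'<..<q}"
          by (rule emeasure_subadditive) auto
        also have "emeasure \<rho> {q - e'<..<q} \<le> emeasure \<rho> {p<..<q}" by (intro emeasure_mono) (auto simp: e'_def)
        also note null
        also have "emeasure \<rho> {q<..<q + e'} \<le> emeasure \<rho> {q<..<q + e}" by (intro emeasure_mono) (auto simp: e'_def)
        finally show "emeasure \<rho> {q<..<q + e} > 0" using False by (simp add: add_right_mono add_left_mono)
      qed
    qed
    have "(f \<longlongrightarrow> 0) (at_left p)"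
    proof (rule tendstoI)
      fix e :: real assume "e > 0"
      then obtain d where "d > 0" "\<forall>s. p - d \<le> s \<longrightarrow> s < p \<longrightarrow> \<alpha> \<le> s \<and> cmod (f p - f s) < e"
        using seg_left_f[OF sg al(1) less_imp_le[OF al(2)]] by blast
      then show "\<forall>\<^sub>F s in at_left p. dist (f s) 0 < e"
        using fp unfolding eventually_at_left_field by (intro exI[of _ "p - d"]) auto
    qed
    moreover have "(f \<longlongrightarrow> 0) (at_right q)"
    proof (rule tendstoI)
      fix e :: real assume "e > 0"
      then obtain d where "d > 0" "\<forall>s. s \<le> q + d \<longrightarrow> q < s \<longrightarrow> s \<le> \<beta> \<and> cmod (f s - (f q + rint \<sigma> {q} k)) < e"
        using seg_right_f[OF sg less_imp_le[OF al(3)] al(4)] by blast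
      then show "\<forall>\<^sub>F s in at_right q. dist (f s) 0 < e"
        unfolding fq eventually_at_right_field by (intro exI[of _ "q + d"]) auto
    qed
    moreover have "f \<in> Dtau a b \<rho> \<sigma> chi c" unfolding Dtau_def using sys_dom_pair(1)[OF f] by blast
    ultimately show "f y = 0" using H5[rule_format, of p q f y] ps qs gap py by auto
  qed
  have mid: "f y = 0" if y: "x1 < y" "y < x2" for y
  proof (cases "y \<in> supp")
    case True
    have al: "\<alpha> < y" "y < \<beta>" using y x by auto
    show ?thesis
    proof (cases "\<forall>e>0. emeasure \<rho> {y - e<..<y} > 0")
      case True
      then show ?thesis using L[OF al] by blast
    next
      \<comment> \<open>A left neighbourhood of y without mass contains no support points, so f
        vanishes there by \<open>off\<close>, and left-continuity gives f y = 0.\<close>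
      case False
      then obtain e where e: "e > 0" "emeasure \<rho> {y - e<..<y} = 0" by (auto simp: not_less)
      define e' where "e' = min e (y - x1)"
      have e': "e' > 0" "e' \<le> e" "e' \<le> y - x1" using e y by (auto simp: e'_def)
      have z: "f s = 0" if s: "y - e' < s" "s < y" for s
      proof (rule off)
        show "s \<notin> supp"
        proof
          assume "s \<in> supp"
          define r where "r = min (s - (y - e')) (y - s)"
          have "r > 0" using s by (simp add: r_def)
          then have "emeasure \<rho> {s - r<..<s + r} > 0" using \<open>s \<in> supp\<close> by (auto simp: supp_pos_def)
          moreover have "emeasure \<rho> {s - r<..<s + r} \<le> emeasure \<rho> {y - e<..<y}"
            using e' by (intro emeasure_mono) (auto simp: r_def)
          ultimately show False using e by simp
        qed
      qed (use s e' y in auto)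
      show ?thesis
      proof (rule ccontr)
        assume "f y \<noteq> 0"
        then obtain d where d: "d > 0" "\<forall>s. y - d \<le> s \<longrightarrow> s < y \<longrightarrow> \<alpha> \<le> s \<and> cmod (f y - f s) < cmod (f y)"
          using seg_left_f[OF sg al(1) less_imp_le[OF al(2)], of "cmod (f y)"] by auto
        define s where "s = y - min d e' / 2"
        have "f s = 0" using e' d by (intro z) (auto simp: s_def)
        moreover have "y - d \<le> s" "s < y" using e' d by (auto simp: s_def)
        ultimately show False using d(2) by auto
      qed
    qed
  qed (use off y in blast)
  \<comment> \<open>Any l < r inside (x1, x2) serve: f = 0 on [l, r] makes the quasi-derivative
    vanish at r.\<close>
  define l r where "l = x1 + (x2 - x1) / 3" and "r = x1 + (x2 - x1) / 2"
  have lr: "x1 < l" "l < r" "r < x2" using x by (auto simp: l_def r_def field_simps)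
  have rI: "l \<in> I" "r \<in> I" using lr x by (auto intro!: mI)
  have "k r = 0"
    by (rule seg_quasi_zero[OF sysD[OF f rI less_imp_le[OF lr(2)]] _ lr(2) order_refl]) (use lr in \<open>auto intro!: mid\<close>)
  moreover have "f r = 0" using lr by (intro mid) auto
  ultimately show ?thesis using sys_zero[OF f rI(2) _ _ s] by blast
qed

section \<open>A fundamental system with prescribed moments\<close>

lemma sys_wronskian_const:
  assumes f: "sys f k (\<lambda>_. 0)" and g: "sys g l (\<lambda>_. 0)" and x: "x \<in> I" "y \<in> I"
  shows "f y * l y - k y * g y = f x * l x - k x * g x"
proof -
  have "f t * l t - k t * g t = f s * l s - k s * g s" if st: "s \<in> I" "t \<in> I" "s \<le> t" for s t
    using Lagrange[OF sysD[OF f st] sysD[OF g st] st(3)] by (simp add: set_lebesgue_integral_def)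
  then show ?thesis using x by (metis linear)
qed

lemma bm_sys: "sys f k w \<Longrightarrow> x \<in> I \<Longrightarrow> y \<in> I \<Longrightarrow> bm x y f \<and> bm x y k \<and> set_integrable \<rho> {x..y} w"
proof (cases "x \<le> y")
  case True
  then show "sys f k w \<Longrightarrow> x \<in> I \<Longrightarrow> y \<in> I \<Longrightarrow> ?thesis" using sysD[of f k w x y] by (simp add: seg_def)
qed (simp add: bm_def set_borel_measurable_def)

lemma bm_integrable: "bm x y f \<Longrightarrow> x \<in> I \<Longrightarrow> y \<in> I \<Longrightarrow> set_integrable \<rho> {x..<y} f"
  by (rule set_integrable_subset[OF set_integrable_bm[OF H1]]) auto

text \<open>A fundamental system of \<open>\<tau> u = 0\<close> with Wronskian 1 that stays linearly independent in \<open>L2\<close> of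
  \<open>[\<alpha>, \<beta>)\<close>, so that its two moments against functions on this interval can be prescribed.\<close>

definition basis :: "real \<Rightarrow> real \<Rightarrow> (real \<Rightarrow> complex) \<Rightarrow> (real \<Rightarrow> complex) \<Rightarrow> (real \<Rightarrow> complex) \<Rightarrow> (real \<Rightarrow> complex) \<Rightarrow> bool" where
  "basis \<alpha> \<beta> u k v l \<longleftrightarrow> \<alpha> \<in> I \<and> \<beta> \<in> I \<and> \<alpha> < \<beta> \<and> sys u k (\<lambda>_. 0) \<and> sys v l (\<lambda>_. 0) \<and>
    (\<forall>x\<in>I. u x * l x - k x * v x = 1) \<and>
    (\<forall>r s. \<exists>h. bm \<alpha> \<beta> h \<and> (LINT t:{\<alpha>..<\<beta>}|\<rho>. h t * u t) = r \<and> (LINT t:{\<alpha>..<\<beta>}|\<rho>. h t * v t) = s) \<and>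
    (\<forall>f g. sys f g (\<lambda>_. 0) \<longrightarrow> (AE t in \<rho>. t \<in> {\<alpha>..<\<beta>} \<longrightarrow> f t = 0) \<longrightarrow> (\<forall>t\<in>I. f t = 0 \<and> g t = 0))"

text \<open>\<alpha> and \<beta> enclose two support points, so a solution of \<tau> f = 0 that
  vanishes \<rho>-a.e. on [\<alpha>, \<beta>) is zero. Hence the Gram matrix of u and v is
  invertible, and test functions in the span of the conjugates of u and v reach all moments.\<close>

lemma basis_exists: obtains \<alpha> \<beta> u k v l where "basis \<alpha> \<beta> u k v l"
proof -
  obtain x1 x2 where x: "x1 \<in> supp" "x2 \<in> supp" "x1 < x2" using H6 by (metis linorder_neqE_linordered_idom)
  then have xI: "x1 \<in> I" "x2 \<in> I" by (auto simp: supp_pos_def)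
  obtain \<alpha> where al: "\<alpha> \<in> I" "\<alpha> < x1" using Iab_lower[OF xI(1)] by auto
  obtain \<beta> where be: "\<beta> \<in> I" "x2 < \<beta>" using Iab_upper[OF xI(2)] by auto
  obtain u k where u: "sys u k (\<lambda>_. 0)" "u \<alpha> = 1" "k \<alpha> = 0" using sys_exists[OF al(1) zero_integrable, of 1 0] by blast
  obtain v l where v: "sys v l (\<lambda>_. 0)" "v \<alpha> = 0" "l \<alpha> = 1" using sys_exists[OF al(1) zero_integrable, of 0 1] by blast
  have W: "u x * l x - k x * v x = 1" if "x \<in> I" for x
    using sys_wronskian_const[OF u(1) v(1) al(1) that] u v by simp
  have bu: "bm \<alpha> \<beta> u" "bm \<alpha> \<beta> v" using bm_sys[OF u(1) al(1) be(1)] bm_sys[OF v(1) al(1) be(1)] by auto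
  note bi = bm_integrable[OF _ al(1) be(1)]
  define ip where "ip f g = (LINT t:{\<alpha>..<\<beta>}|\<rho>. f t * cnj (g t))" for f g :: "real \<Rightarrow> complex"
  have ipl: "ip (\<lambda>t. x * f t + y * g t) h = x * ip f h + y * ip g h" if "bm \<alpha> \<beta> f" "bm \<alpha> \<beta> g" "bm \<alpha> \<beta> h" for x y f g h
  proof -
    have "ip (\<lambda>t. x * f t + y * g t) h = (LINT t:{\<alpha>..<\<beta>}|\<rho>. x * (f t * cnj (h t)) + y * (g t * cnj (h t)))"
      unfolding ip_def by (simp add: algebra_simps)
    also have "\<dots> = x * ip f h + y * ip g h"
      unfolding ip_def rint_pos_rm[symmetric]
      using that by (intro rint_lin) (auto simp: rset_int_pos_rm intro!: bi bm_mult bm_cnj)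
    finally show ?thesis .
  qed
  have zero: "\<forall>t\<in>I. f t = 0 \<and> g t = 0" if "sys f g (\<lambda>_. 0)" "AE t in \<rho>. t \<in> {\<alpha>..<\<beta>} \<longrightarrow> f t = 0" for f g
    using sys_ae_zero[OF that(1) x(1,2) al(2) x(3) be(2) al(1) be(1) that(2)] by blast
  \<comment> \<open>The combination f with these coefficients is orthogonal to u and v, hence to
    itself, so it vanishes a.e. on [\<alpha>, \<beta>) and then identically.\<close>
  have indep: "x = 0 \<and> y = 0" if z: "x * ip u u + y * ip v u = 0" "x * ip u v + y * ip v v = 0" for x y
  proof -
    define f where "f t = x * u t + y * v t" for t
    have f: "sys f (\<lambda>t. x * k t + y * l t) (\<lambda>_. 0)" unfolding f_def[abs_def] using sys_lin[OF u(1) v(1), of x y] by simp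
    have bf: "bm \<alpha> \<beta> f" unfolding f_def[abs_def] using bu by (intro bm_add bm_cmult)
    have "ip f u = 0" "ip f v = 0" using z ipl[OF bu bu(1), of x y] ipl[OF bu bu(2), of x y] by (simp_all add: f_def[abs_def])
    moreover have "ip f f = cnj x * ip f u + cnj y * ip f v"
    proof -
      have "ip f f = (LINT t:{\<alpha>..<\<beta>}|\<rho>. cnj x * (f t * cnj (u t)) + cnj y * (f t * cnj (v t)))"
        unfolding ip_def by (intro set_lebesgue_integral_cong) (auto simp: f_def algebra_simps)
      also have "\<dots> = cnj x * ip f u + cnj y * ip f v"
        unfolding ip_def rint_pos_rm[symmetric]
        using bu bf by (intro rint_lin) (auto simp: rset_int_pos_rm intro!: bi bm_mult bm_cnj)
      finally show ?thesis .
    qed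
    ultimately have "ip f f = 0" by simp
    moreover have "ip f f = of_real (LINT t:{\<alpha>..<\<beta>}|\<rho>. (cmod (f t))\<^sup>2)"
      unfolding ip_def complex_norm_square[symmetric] set_integral_complex_of_real by (rule refl)
    ultimately have z2: "(LINT t:{\<alpha>..<\<beta>}|\<rho>. (cmod (f t))\<^sup>2) = 0" by simp
    have "set_integrable \<rho> {\<alpha>..<\<beta>} (\<lambda>t. f t * cnj (f t))" using bf by (intro bi bm_mult bm_cnj)
    then have "integrable \<rho> (\<lambda>t. Re (indicator {\<alpha>..<\<beta>} t *\<^sub>R (f t * cnj (f t))))" unfolding set_integrable_def by (rule integrable_Re)
    then have i2: "integrable \<rho> (\<lambda>t. indicator {\<alpha>..<\<beta>} t *\<^sub>R (cmod (f t))\<^sup>2)"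
      by (simp add: complex_norm_square[symmetric] flip: of_real_power)
    have "AE t in \<rho>. indicator {\<alpha>..<\<beta>} t *\<^sub>R (cmod (f t))\<^sup>2 = 0"
      using z2 integral_nonneg_eq_0_iff_AE[OF i2] unfolding set_lebesgue_integral_def by auto
    then have "AE t in \<rho>. t \<in> {\<alpha>..<\<beta>} \<longrightarrow> f t = 0" by eventually_elim auto
    from zero[OF f this] have "f \<alpha> = 0" "x * k \<alpha> + y * l \<alpha> = 0" using al(1) by auto
    then show ?thesis using u v by (simp add: f_def)
  qed
  define D where "D = ip u u * ip v v - ip u v * ip v u"
  have D: "D \<noteq> 0"
  proof
    assume D0: "D = 0"
    \<comment> \<open>If the determinant is 0, the cofactors solve the homogeneous system. By
      \<open>indep\<close> all four entries then vanish, so (1, 0) would solve it too.\<close>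
    have "ip v v = 0 \<and> - ip u v = 0" by (rule indep) (use D0 in \<open>simp_all add: D_def algebra_simps\<close>)
    moreover have "ip v u = 0 \<and> - ip u u = 0" by (rule indep) (use D0 in \<open>simp_all add: D_def algebra_simps\<close>)
    ultimately show False using indep[of 1 0] by simp
  qed
  have surj: "\<exists>h. bm \<alpha> \<beta> h \<and> (LINT t:{\<alpha>..<\<beta>}|\<rho>. h t * u t) = r \<and> (LINT t:{\<alpha>..<\<beta>}|\<rho>. h t * v t) = s" for r s
  proof -
    \<comment> \<open>Cramer's rule for the Gram matrix.\<close>
    define c d where "c = (r * ip v v - s * ip u v) / D" and "d = (ip u u * s - ip v u * r) / D"
    define h where "h t = c * cnj (u t) + d * cnj (v t)" for t
    have bh: "bm \<alpha> \<beta> h" unfolding h_def[abs_def] using bu by (intro bm_add bm_cmult bm_cnj)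
    have hh: "(LINT t:{\<alpha>..<\<beta>}|\<rho>. h t * z t) = c * ip z u + d * ip z v" if "bm \<alpha> \<beta> z" for z
    proof -
      have "(LINT t:{\<alpha>..<\<beta>}|\<rho>. h t * z t) = (LINT t:{\<alpha>..<\<beta>}|\<rho>. c * (z t * cnj (u t)) + d * (z t * cnj (v t)))"
        by (intro set_lebesgue_integral_cong) (auto simp: h_def algebra_simps)
      also have "\<dots> = c * ip z u + d * ip z v"
        unfolding ip_def rint_pos_rm[symmetric]
        using bu that by (intro rint_lin) (auto simp: rset_int_pos_rm intro!: bi bm_mult bm_cnj)
      finally show ?thesis .
    qed
    have "c * ip u u + d * ip u v = r * (D / D)" "c * ip v u + d * ip v v = s * (D / D)"
      unfolding c_def d_def by (simp_all only: times_divide_eq_right times_divide_eq_left add_divide_distrib[symmetric])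
        (simp_all add: D_def algebra_simps)
    then show ?thesis using bh hh[OF bu(1)] hh[OF bu(2)] D by (intro exI[of _ h]) simp
  qed
  have "\<alpha> < \<beta>" using al be x by simp
  then have "basis \<alpha> \<beta> u k v l" unfolding basis_def
    by (intro conjI al be u v) (use W surj zero in blast)+
  then show ?thesis using that by blast
qed

text \<open>All integrals run over half-open intervals inside [x, y), so the source may be changed
  at y even if \<rho> has an atom there.\<close>

lemma seg_source_cong:
  assumes f: "seg x y f k w" and e: "\<And>t. x \<le> t \<Longrightarrow> t < y \<Longrightarrow> w t = v t" and v: "set_integrable \<rho> {x..y} v"
  shows "seg x y f k v"
proof -
  have "(LINT r:{s..<t}|\<rho>. w r) = (LINT r:{s..<t}|\<rho>. v r)" if "x \<le> s" "t \<le> y" for s t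
    using that e by (intro set_lebesgue_integral_cong) auto
  then show ?thesis using f v unfolding seg_def by (metis order_trans)
qed

text \<open>The common data may sit at either end, so the same step continues to the left and to the
  right.\<close>

lemma sys_extend:
  assumes f: "sys f k w" and g: "sys g l v" and xy: "x \<in> I" "y \<in> I" "x \<le> y" and z: "x0 \<in> {x, y}" "f x0 = g x0" "k x0 = l x0"
    and e: "\<And>t. x \<le> t \<Longrightarrow> t < y \<Longrightarrow> w t = v t"
  shows "f x = g x \<and> k x = l x \<and> f y = g y \<and> k y = l y"
proof -
  have sf: "seg x y f k v"
    by (rule seg_source_cong[OF sysD[OF f xy] e]) (use bm_sys[OF g xy(1,2)] in auto)
  from seg_unique[OF sf sysD[OF g xy], of x0] z xy show ?thesis by auto
qed

text \<open>By the Lagrange identity the two moment conditions say that the Wronskians of f with u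
  and with v vanish at y. As u and v are independent, the data of f at y are 0, and there is no
  source beyond y.\<close>

lemma glue:
  assumes B: "basis \<alpha> \<beta> u k v l" and f: "sys f g w" and xy: "x \<in> I" "y \<in> I" "x \<le> y"
    and w: "\<And>t. t \<in> I \<Longrightarrow> t < x \<Longrightarrow> w t = w0 t" "\<And>t. t \<in> I \<Longrightarrow> y \<le> t \<Longrightarrow> w t = 0"
    and f0: "sys f0 g0 w0" "f x = f0 x" "g x = g0 x"
    and i: "(LINT t:{x..<y}|\<rho>. w t * u t) = - (f0 x * k x - g0 x * u x)" "(LINT t:{x..<y}|\<rho>. w t * v t) = - (f0 x * l x - g0 x * v x)"
  shows "\<forall>t\<in>I. (t \<le> x \<longrightarrow> f t = f0 t \<and> g t = g0 t) \<and> (y \<le> t \<longrightarrow> f t = 0 \<and> g t = 0)"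
proof -
  have s: "sys u k (\<lambda>_. 0)" "sys v l (\<lambda>_. 0)" and W: "u y * l y - k y * v y = 1" using B xy by (auto simp: basis_def)
  have "f y * k y - g y * u y = 0" "f y * l y - g y * v y = 0"
    using Lagrange[OF sysD[OF f xy] sysD[OF s(1) xy] xy(3)] Lagrange[OF sysD[OF f xy] sysD[OF s(2) xy] xy(3)] i f0 by simp_all
  then have "f y * (u y * l y - k y * v y) = 0" "g y * (u y * l y - k y * v y) = 0" by algebra+
  then have fy: "f y = 0" "g y = 0" using W by simp_all
  have z: "sys (\<lambda>_. 0) (\<lambda>_. 0) (\<lambda>_. 0)" using sys_lin[OF s(1) s(1), of 0 0] by simp
  show ?thesis
  proof (intro ballI conjI impI)
    fix t assume t: "t \<in> I"
    show "f t = f0 t" "g t = g0 t" if "t \<le> x"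
      using sys_extend[OF f f0(1) t xy(1) that, of x] f0 w(1) Iab_convex[OF t xy(1)] by auto
    show "f t = 0" "g t = 0" if "y \<le> t"
      using sys_extend[OF f z xy(2) t that, of y] fy w(2) Iab_convex[OF xy(2) t] by auto
  qed
qed

end

section \<open>Orthogonality and approximation in L2\<close>

definition sqn :: "real measure \<Rightarrow> (real \<Rightarrow> complex) \<Rightarrow> real" where
  "sqn M u = (\<integral>x. (cmod (u x))\<^sup>2 \<partial>M)"

lemma L2_measurable: "u \<in> L2 M \<Longrightarrow> u \<in> borel_measurable M" by (simp add: L2_def)

lemma L2_sq_integrable: "u \<in> L2 M \<Longrightarrow> integrable M (\<lambda>x. (cmod (u x))\<^sup>2)"
  unfolding L2_def integrable_iff_bounded by auto

lemma L2I: "u \<in> borel_measurable M \<Longrightarrow> integrable M (\<lambda>x. (cmod (u x))\<^sup>2) \<Longrightarrow> u \<in> L2 M"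
  unfolding L2_def integrable_iff_bounded by auto

lemma L2_nn: "u \<in> L2 M \<Longrightarrow> (\<integral>\<^sup>+ x. ennreal ((cmod (u x))\<^sup>2) \<partial>M) = ennreal (sqn M u)"
  unfolding sqn_def by (intro nn_integral_eq_integral L2_sq_integrable) auto

lemma L2_bound:
  assumes "u \<in> borel_measurable M" "integrable M g" "AE x in M. (cmod (u x))\<^sup>2 \<le> g x" shows "u \<in> L2 M"
proof (rule L2I[OF assms(1)])
  note [measurable] = assms(1)
  show "integrable M (\<lambda>x. (cmod (u x))\<^sup>2)"
    by (rule Bochner_Integration.integrable_bound[OF assms(2)]) (use assms(3) in auto)
qed

lemma cmod_add_sq: "(cmod (x + y))\<^sup>2 \<le> 2 * (cmod x)\<^sup>2 + 2 * (cmod y)\<^sup>2"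
proof -
  have "(cmod (x + y))\<^sup>2 \<le> (cmod x + cmod y)\<^sup>2" by (intro power_mono norm_triangle_ineq) auto
  also have "\<dots> \<le> 2 * (cmod x)\<^sup>2 + 2 * (cmod y)\<^sup>2"
    using sum_squares_bound[of "cmod x" "cmod y"] by (simp add: power2_sum)
  finally show ?thesis .
qed

lemma L2_cmult: "u \<in> L2 M \<Longrightarrow> (\<lambda>x. z * u x) \<in> L2 M"
  by (rule L2I) (auto simp: norm_mult power_mult_distrib dest: L2_measurable intro: L2_sq_integrable)

lemma L2_add: assumes "u \<in> L2 M" "v \<in> L2 M" shows "(\<lambda>x. u x + v x) \<in> L2 M"
proof (rule L2_bound)
  show "(\<lambda>x. u x + v x) \<in> borel_measurable M" using assms by (intro borel_measurable_add L2_measurable)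
  show "integrable M (\<lambda>x. 2 * (cmod (u x))\<^sup>2 + 2 * (cmod (v x))\<^sup>2)"
    using assms by (intro Bochner_Integration.integrable_add integrable_mult_right L2_sq_integrable)
qed (simp add: cmod_add_sq)

lemma L2_diff: assumes "u \<in> L2 M" "v \<in> L2 M" shows "(\<lambda>x. u x - v x) \<in> L2 M"
  using L2_add[OF assms(1) L2_cmult[OF assms(2), of "-1"]] by simp

lemma L2_zero: "(\<lambda>x. 0) \<in> L2 M"
  by (rule L2I) auto

lemma L2_cnj: assumes "u \<in> L2 M" shows "(\<lambda>x. cnj (u x)) \<in> L2 M"
proof (rule L2I)
  show "(\<lambda>x. cnj (u x)) \<in> borel_measurable M"
    by (rule borel_measurable_continuous_on[where f=cnj]) (auto intro: continuous_intros L2_measurable assms)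
qed (use L2_sq_integrable[OF assms] in simp)

lemma L2_mult_integrable: assumes "u \<in> L2 M" "v \<in> L2 M" shows "integrable M (\<lambda>x. u x * v x)"
proof (rule Bochner_Integration.integrable_bound)
  show "integrable M (\<lambda>x. (cmod (u x))\<^sup>2 + (cmod (v x))\<^sup>2)"
    using assms by (intro Bochner_Integration.integrable_add L2_sq_integrable)
  show "(\<lambda>x. u x * v x) \<in> borel_measurable M" using assms by (intro borel_measurable_times L2_measurable)
  have "norm (x * y) \<le> norm ((cmod x)\<^sup>2 + (cmod y)\<^sup>2)" for x y :: complex
  proof -
    have "0 \<le> cmod x * cmod y" by simp
    then have "cmod x * cmod y \<le> (cmod x)\<^sup>2 + (cmod y)\<^sup>2" using sum_squares_bound[of "cmod x" "cmod y"] unfolding mult.assoc by linarith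
    then show ?thesis by (simp add: norm_mult)
  qed
  then show "AE x in M. norm (u x * v x) \<le> norm ((cmod (u x))\<^sup>2 + (cmod (v x))\<^sup>2)" by auto
qed

lemma inner2_integrable: "u \<in> L2 M \<Longrightarrow> v \<in> L2 M \<Longrightarrow> integrable M (\<lambda>x. u x * cnj (v x))"
  by (intro L2_mult_integrable L2_cnj)

lemma inner2_lin:
  "u \<in> L2 M \<Longrightarrow> v \<in> L2 M \<Longrightarrow> w \<in> L2 M \<Longrightarrow> inner2 M (\<lambda>x. s * u x + t * v x) w = s * inner2 M u w + t * inner2 M v w"
proof -
  assume *: "u \<in> L2 M" "v \<in> L2 M" "w \<in> L2 M"
  have "inner2 M (\<lambda>x. s * u x + t * v x) w = (\<integral>x. s * (u x * cnj (w x)) + t * (v x * cnj (w x)) \<partial>M)"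
    unfolding inner2_def by (simp add: algebra_simps)
  also have "\<dots> = s * inner2 M u w + t * inner2 M v w"
    unfolding inner2_def using inner2_integrable[OF *(1,3)] inner2_integrable[OF *(2,3)] by simp
  finally show ?thesis .
qed

lemma inner2_diff: "u \<in> L2 M \<Longrightarrow> v \<in> L2 M \<Longrightarrow> w \<in> L2 M \<Longrightarrow> inner2 M (\<lambda>x. u x - v x) w = inner2 M u w - inner2 M v w"
  using inner2_lin[of u M v w 1 "-1"] by simp

lemma inner2_cnj: "inner2 M u v = cnj (inner2 M v u)"
proof -
  have "cnj (inner2 M v u) = (\<integral>x. cnj (v x * cnj (u x)) \<partial>M)"
    unfolding inner2_def by (rule Bochner_Integration.integral_cnj[symmetric])
  then show ?thesis by (simp add: inner2_def mult.commute)
qed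

lemma inner2_self: "inner2 M u u = of_real (sqn M u)"
  unfolding inner2_def sqn_def complex_norm_square[symmetric] by (rule integral_complex_of_real)

lemma sqn_nonneg: "sqn M u \<ge> 0" by (simp add: sqn_def)

lemma norm2_sqn: "norm2 M u = sqrt (sqn M u)" by (simp add: norm2_def sqn_def)

section \<open>Orthogonality in the space of pairs\<close>

type_synonym cpair = "(real \<Rightarrow> complex) \<times> (real \<Rightarrow> complex)"

text \<open>Relations are subspaces of L2 x L2, and with this inner product the adjoint becomes, up
  to a swap of components and a sign, the orthogonal complement.\<close>

definition ip2 :: "real measure \<Rightarrow> cpair \<Rightarrow> cpair \<Rightarrow> complex" where
  "ip2 M p q = inner2 M (fst p) (fst q) + inner2 M (snd p) (snd q)"

definition sq2 :: "real measure \<Rightarrow> cpair \<Rightarrow> real" where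
  "sq2 M p = sqn M (fst p) + sqn M (snd p)"

definition plin :: "complex \<Rightarrow> cpair \<Rightarrow> complex \<Rightarrow> cpair \<Rightarrow> cpair" where
  "plin s p t q = ((\<lambda>x. s * fst p x + t * fst q x), (\<lambda>x. s * snd p x + t * snd q x))"

abbreviation LL :: "real measure \<Rightarrow> cpair set" where "LL M \<equiv> L2 M \<times> L2 M"

lemma plin_LL: "p \<in> LL M \<Longrightarrow> q \<in> LL M \<Longrightarrow> plin s p t q \<in> LL M"
  by (auto simp: plin_def intro!: L2_add L2_cmult)

lemma ip2_lin: "p \<in> LL M \<Longrightarrow> q \<in> LL M \<Longrightarrow> r \<in> LL M \<Longrightarrow> ip2 M (plin s p t q) r = s * ip2 M p r + t * ip2 M q r"
  by (auto simp: ip2_def plin_def inner2_lin algebra_simps)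

lemma ip2_cnj: "ip2 M p q = cnj (ip2 M q p)"
  unfolding ip2_def by (simp add: inner2_cnj[of M "fst p"] inner2_cnj[of M "snd p"])

lemma ip2_lin_right: "p \<in> LL M \<Longrightarrow> q \<in> LL M \<Longrightarrow> r \<in> LL M \<Longrightarrow> ip2 M r (plin s p t q) = cnj s * ip2 M r p + cnj t * ip2 M r q"
  using ip2_lin[of p M q r s t] ip2_cnj[of M r] by (metis (no_types, lifting) complex_cnj_add complex_cnj_mult complex_cnj_cnj)

lemma ip2_self: "ip2 M p p = of_real (sq2 M p)"
  by (simp add: ip2_def sq2_def inner2_self)

lemma sq2_nonneg: "sq2 M p \<ge> 0" by (simp add: sq2_def sqn_nonneg)

lemma sq2_plin:
  assumes "p \<in> LL M" "q \<in> LL M"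
  shows "sq2 M (plin s p t q) = (cmod s)\<^sup>2 * sq2 M p + (cmod t)\<^sup>2 * sq2 M q + 2 * Re (s * cnj t * ip2 M p q)"
proof -
  have "of_real (sq2 M (plin s p t q)) = s * (cnj s * ip2 M p p + cnj t * ip2 M p q) + t * (cnj s * ip2 M q p + cnj t * ip2 M q q)"
    unfolding ip2_self[symmetric] using assms plin_LL[OF assms] by (simp add: ip2_lin ip2_lin_right algebra_simps)
  also have "\<dots> = of_real ((cmod s)\<^sup>2 * sq2 M p + (cmod t)\<^sup>2 * sq2 M q) + (s * cnj t * ip2 M p q + cnj (s * cnj t * ip2 M p q))"
    unfolding ip2_self ip2_cnj[of M q p] of_real_add of_real_mult complex_norm_square complex_cnj_mult complex_cnj_cnj
    by (simp add: algebra_simps)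
  also have "\<dots> = of_real ((cmod s)\<^sup>2 * sq2 M p + (cmod t)\<^sup>2 * sq2 M q + 2 * Re (s * cnj t * ip2 M p q))"
    by (simp only: complex_add_cnj of_real_add)
  finally show ?thesis by (simp only: of_real_eq_iff)
qed

text \<open>Minimising \<open>sq2 M (p - t q)\<close> over \<open>t\<close>.\<close>

lemma ip2_le_of_min:
  assumes p: "p \<in> LL M" "q \<in> LL M" and m: "\<And>t. sq2 M (plin 1 p t q) \<ge> d"
  shows "(cmod (ip2 M p q))\<^sup>2 \<le> (sq2 M p - d) * sq2 M q"
proof -
  define z where "z = ip2 M p q"
  define Q where "Q = sq2 M q"
  have Q: "Q \<ge> 0" by (simp add: Q_def sq2_nonneg)
  \<comment> \<open>The choice t = - r z makes the cross term real; what remains is a quadratic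
    polynomial in the real number r, minimal at r = 1/Q.\<close>
  have *: "d \<le> sq2 M p + r\<^sup>2 * (cmod z)\<^sup>2 * Q - 2 * r * (cmod z)\<^sup>2" for r :: real
  proof -
    have "cnj (- of_real r * z) * z = of_real (- r * (cmod z)\<^sup>2)"
      using complex_norm_square[of z] by (simp add: mult.commute mult.left_commute)
    then have "Re (1 * cnj (- of_real r * z) * z) = - r * (cmod z)\<^sup>2" by (simp only: mult_1 Re_complex_of_real)
    then show ?thesis using m[of "- of_real r * z"] unfolding sq2_plin[OF p] z_def[symmetric] Q_def[symmetric]
      by (simp add: norm_mult power_mult_distrib)
  qed
  show ?thesis
  proof (cases "Q = 0")
    case True
    have "(cmod z)\<^sup>2 = 0"
    proof (rule ccontr)
      assume "(cmod z)\<^sup>2 \<noteq> 0"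
      \<comment> \<open>For Q = 0 the polynomial is linear; this r makes it equal to d - 1, below
        its lower bound d.\<close>
      then have "2 * ((sq2 M p - d + 1) / (2 * (cmod z)\<^sup>2)) * (cmod z)\<^sup>2 = sq2 M p - d + 1" by simp
      then show False using *[of "(sq2 M p - d + 1) / (2 * (cmod z)\<^sup>2)"] unfolding True by linarith
    qed
    then show ?thesis using True by (simp add: z_def[symmetric] Q_def[symmetric])
  next
    case False
    then have "d \<le> sq2 M p - (cmod z)\<^sup>2 / Q" using *[of "1/Q"] by (simp add: power2_eq_square)
    then show ?thesis using False Q by (simp add: z_def[symmetric] Q_def[symmetric] field_simps)
  qed
qed

lemma ip2_Cauchy_Schwarz:
  assumes "p \<in> LL M" "q \<in> LL M" shows "(cmod (ip2 M p q))\<^sup>2 \<le> sq2 M p * sq2 M q"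
  using ip2_le_of_min[OF assms, of 0] sq2_nonneg by simp

text \<open>Riesz-Fischer for a fast Cauchy sequence. The rate 1/4 leaves room for the weight 2^n:
  the weighted sum of squared increments has finite integral, so almost everywhere the increments
  decay geometrically. Fatou carries the rate over to the pointwise limit.\<close>

lemma L2_complete:
  assumes f: "\<And>n. f n \<in> L2 M" and C: "C \<ge> 0" and e: "\<And>n m. n \<le> m \<Longrightarrow> sqn M (\<lambda>x. f n x - f m x) \<le> C * (1/4)^n"
  shows "\<exists>g\<in>L2 M. \<forall>n. sqn M (\<lambda>x. f n x - g x) \<le> C * (1/4)^n"
proof -
  note [measurable] = L2_measurable[OF f]
  define D where "D n x = ennreal (2^n * (cmod (f n x - f (Suc n) x))\<^sup>2)" for n x
  have [measurable]: "D n \<in> borel_measurable M" for n unfolding D_def[abs_def] by measurable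
  have Dn: "(\<integral>\<^sup>+x. D n x \<partial>M) \<le> ennreal (C * (1/2)^n)" for n
  proof -
    have "(\<integral>\<^sup>+x. D n x \<partial>M) = (\<integral>\<^sup>+x. ennreal (2^n) * ennreal ((cmod (f n x - f (Suc n) x))\<^sup>2) \<partial>M)"
      unfolding D_def by (intro nn_integral_cong) (auto simp: ennreal_mult)
    also have "\<dots> = ennreal (2^n) * ennreal (sqn M (\<lambda>x. f n x - f (Suc n) x))"
      by (subst nn_integral_cmult) (auto simp: L2_nn[OF L2_diff[OF f f]])
    also have "\<dots> = ennreal (2^n * sqn M (\<lambda>x. f n x - f (Suc n) x))" by (simp add: ennreal_mult sqn_nonneg)
    also have "\<dots> \<le> ennreal (2^n * (C * (1/4)^n))"
      using e[of n "Suc n"] by (intro ennreal_leI mult_left_mono) auto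
    also have "2^n * (C * (1/4)^n) = C * (1/2::real)^n" by (simp add: power_mult_distrib[symmetric] mult.left_commute)
    finally show ?thesis .
  qed
  have "(\<integral>\<^sup>+x. (\<Sum>n. D n x) \<partial>M) = (\<Sum>n. \<integral>\<^sup>+x. D n x \<partial>M)" by (rule nn_integral_suminf) simp
  also have "\<dots> \<le> (\<Sum>n. ennreal (C * (1/2)^n))" by (intro suminf_le Dn summableI)
  also have "\<dots> = ennreal (\<Sum>n. C * (1/2)^n)" using C by (intro suminf_ennreal2) (auto intro: summable_mult summable_geometric)
  also have "\<dots> < \<infinity>" by simp
  finally have "AE x in M. (\<Sum>n. D n x) \<noteq> \<infinity>" by (intro nn_integral_noteq_infinite) auto
  then have conv: "AE x in M. convergent (\<lambda>n. f n x)"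
  proof eventually_elim
    fix x assume "(\<Sum>n. D n x) \<noteq> \<infinity>"
    then obtain K where K: "(\<Sum>n. D n x) = ennreal K" "K \<ge> 0" by (cases "(\<Sum>n. D n x)") auto
    have le: "cmod (f n x - f (Suc n) x) \<le> sqrt K * (sqrt (1/2))^n" for n
    proof -
      have "D n x \<le> (\<Sum>n. D n x)" using sum_le_suminf[of "\<lambda>n. D n x" "{n}"] summableI by simp
      then have "2^n * (cmod (f n x - f (Suc n) x))\<^sup>2 \<le> K" using K by (simp add: D_def ennreal_le_iff)
      then have "(cmod (f n x - f (Suc n) x))\<^sup>2 \<le> K * (1/2)^n" by (simp add: field_simps power_divide)
      then have "sqrt ((cmod (f n x - f (Suc n) x))\<^sup>2) \<le> sqrt (K * (1/2)^n)" by (rule real_sqrt_le_mono)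
      then show ?thesis by (simp add: real_sqrt_mult real_sqrt_power)
    qed
    have "summable (\<lambda>n. sqrt K * (sqrt (1/2))^n)" by (intro summable_mult summable_geometric) (simp add: real_sqrt_divide)
    then have "summable (\<lambda>n. f (Suc n) x - f n x)"
      by (rule summable_comparison_test'[of _ 0]) (use le in \<open>simp add: norm_minus_commute\<close>)
    then have "convergent (\<lambda>n. - f 0 x + f n x)"
      unfolding summable_iff_convergent sum_lessThan_telescope[of "\<lambda>n. f n x"] by simp
    then show "convergent (\<lambda>n. f n x)" unfolding convergent_add_const_iff .
  qed
  define g where "g x = lim (\<lambda>n. f n x)" for x
  have gm[measurable]: "g \<in> borel_measurable M" unfolding g_def[abs_def] by measurable
  have gconv: "AE x in M. (\<lambda>n. f n x) \<longlonglongrightarrow> g x"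
    using conv by eventually_elim (auto simp: g_def convergent_LIMSEQ_iff)
  have bound: "(\<integral>\<^sup>+x. ennreal ((cmod (f n x - g x))\<^sup>2) \<partial>M) \<le> ennreal (C * (1/4)^n)" for n
  proof -
    have "(\<integral>\<^sup>+x. ennreal ((cmod (f n x - g x))\<^sup>2) \<partial>M) = (\<integral>\<^sup>+x. liminf (\<lambda>m. ennreal ((cmod (f n x - f m x))\<^sup>2)) \<partial>M)"
    proof (rule nn_integral_cong_AE)
      show "AE x in M. ennreal ((cmod (f n x - g x))\<^sup>2) = liminf (\<lambda>m. ennreal ((cmod (f n x - f m x))\<^sup>2))"
        using gconv
      proof eventually_elim
        fix x assume "(\<lambda>n. f n x) \<longlonglongrightarrow> g x"
        then have "(\<lambda>m. ennreal ((cmod (f n x - f m x))\<^sup>2)) \<longlonglongrightarrow> ennreal ((cmod (f n x - g x))\<^sup>2)"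
          by (intro tendsto_ennrealI tendsto_intros)
        then show "ennreal ((cmod (f n x - g x))\<^sup>2) = liminf (\<lambda>m. ennreal ((cmod (f n x - f m x))\<^sup>2))"
          by (intro lim_imp_Liminf[symmetric]) auto
      qed
    qed
    also have "\<dots> \<le> liminf (\<lambda>m. \<integral>\<^sup>+x. ennreal ((cmod (f n x - f m x))\<^sup>2) \<partial>M)"
      by (rule nn_integral_liminf) measurable
    also have "\<dots> \<le> ennreal (C * (1/4)^n)"
    proof (rule Liminf_le)
      show "\<forall>\<^sub>F m in sequentially. (\<integral>\<^sup>+x. ennreal ((cmod (f n x - f m x))\<^sup>2) \<partial>M) \<le> ennreal (C * (1/4)^n)"
        using eventually_ge_at_top[of n]
        by eventually_elim (auto simp: L2_nn[OF L2_diff[OF f f]] intro!: ennreal_leI e)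
    qed simp
    finally show ?thesis .
  qed
  have d: "(\<lambda>x. f n x - g x) \<in> L2 M" for n
    unfolding L2_def using bound[of n] by (auto intro: le_less_trans)
  have "g \<in> L2 M" using L2_diff[OF f[of 0] d[of 0]] by simp
  moreover have "sqn M (\<lambda>x. f n x - g x) \<le> C * (1/4)^n" for n
    using bound[of n] unfolding L2_nn[OF d] using C by (subst (asm) ennreal_le_iff) auto
  ultimately show ?thesis by blast
qed

text \<open>The projection argument for a subspace that need not be closed. The residuals of a
  minimising sequence converge to some \<open>R\<close> orthogonal to \<open>T\<close>. By
  \<open>orth\<close>, \<open>R\<close> is orthogonal to v, hence to every residual and so to
  itself: \<open>R\<close> has norm 0, and the distance from v to \<open>T\<close> is 0.\<close>

lemma closure_of_orthogonal:
  assumes T: "T \<subseteq> LL M" "T \<noteq> {}" "\<And>p q s t. p \<in> T \<Longrightarrow> q \<in> T \<Longrightarrow> plin s p t q \<in> T"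
    and v: "v \<in> LL M" and orth: "\<And>r. r \<in> LL M \<Longrightarrow> (\<And>q. q \<in> T \<Longrightarrow> ip2 M q r = 0) \<Longrightarrow> ip2 M v r = 0"
    and e: "e > 0"
  shows "\<exists>p\<in>T. sq2 M (plin 1 v (-1) p) < e"
proof (rule ccontr)
  assume neg: "\<not> ?thesis"
  define S where "S = (\<lambda>p. sq2 M (plin 1 v (-1) p)) ` T"
  have S: "S \<noteq> {}" "bdd_below S" using T(2) by (auto simp: S_def intro!: bdd_belowI[of _ 0] sq2_nonneg)
  define d where "d = Inf S"
  have d: "d \<ge> e" unfolding d_def using S neg by (intro cInf_greatest) (auto simp: S_def not_less)
  have dle: "d \<le> sq2 M (plin 1 v (-1) p)" if "p \<in> T" for p
    unfolding d_def using S that by (intro cInf_lower) (auto simp: S_def)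
  have "\<exists>p\<in>T. sq2 M (plin 1 v (-1) p) < d + (1/4)^n" for n :: nat
  proof -
    have "Inf S < d + (1/4)^n" by (simp add: d_def)
    then show ?thesis using cInf_less_iff[OF S] by (auto simp: S_def)
  qed
  then obtain p where p: "\<And>n. p n \<in> T" "\<And>n::nat. sq2 M (plin 1 v (-1) (p n)) < d + (1/4)^n" by metis
  define r where "r n = plin 1 v (-1) (p n)" for n
  have pL: "p n \<in> LL M" for n using p(1) T(1) by blast
  have r: "r n \<in> LL M" for n unfolding r_def by (intro plin_LL v pL)
  \<comment> \<open>The midpoint of \<open>p n\<close> and \<open>p m\<close> lies in
    \<open>T\<close>, so its residual has square at least d; the parallelogram identity turns this
    into a bound on the difference.\<close>
  have cau: "sq2 M (plin 1 (r n) (-1) (r m)) \<le> 4 * (1/4)^n" if "n \<le> m" for n m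
  proof -
    have "plin (1/2) (r n) (1/2) (r m) = plin 1 v (-1) (plin (1/2) (p n) (1/2) (p m))"
      by (auto simp: plin_def r_def algebra_simps)
    then have "d \<le> sq2 M (plin (1/2) (r n) (1/2) (r m))" using dle[OF T(3)[OF p(1) p(1)]] by simp
    then have "4 * d \<le> sq2 M (r n) + sq2 M (r m) + 2 * Re (ip2 M (r n) (r m))"
      unfolding sq2_plin[OF r r] by (simp add: power2_eq_square)
    moreover have "sq2 M (plin 1 (r n) (-1) (r m)) = sq2 M (r n) + sq2 M (r m) - 2 * Re (ip2 M (r n) (r m))"
      unfolding sq2_plin[OF r r] by simp
    moreover have "(1/4::real)^m \<le> (1/4)^n" using that by (intro power_decreasing) auto
    ultimately show ?thesis using p(2)[of n] p(2)[of m] unfolding r_def[symmetric] by linarith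
  qed
  have c1: "sqn M (\<lambda>x. fst (r n) x - fst (r m) x) \<le> 4 * (1/4)^n" and c2: "sqn M (\<lambda>x. snd (r n) x - snd (r m) x) \<le> 4 * (1/4)^n"
    if "n \<le> m" for n m
    using cau[OF that] sqn_nonneg[of M "\<lambda>x. fst (r n) x - fst (r m) x"] sqn_nonneg[of M "\<lambda>x. snd (r n) x - snd (r m) x"]
    by (simp_all add: sq2_def plin_def)
  obtain g where g: "g \<in> L2 M" "\<And>n. sqn M (\<lambda>x. fst (r n) x - g x) \<le> 4 * (1/4)^n"
    using L2_complete[of "\<lambda>n. fst (r n)" M 4] r c1 by (auto simp: mem_Times_iff)
  obtain h where h: "h \<in> L2 M" "\<And>n. sqn M (\<lambda>x. snd (r n) x - h x) \<le> 4 * (1/4)^n"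
    using L2_complete[of "\<lambda>n. snd (r n)" M 4] r c2 by (auto simp: mem_Times_iff)
  define R where "R = (g, h)"
  have R: "R \<in> LL M" using g h by (simp add: R_def)
  have conv: "sq2 M (plin 1 (r n) (-1) R) \<le> 8 * (1/4)^n" for n
    using g(2)[of n] h(2)[of n] by (simp add: sq2_def plin_def R_def)
  have pow0: "(\<lambda>n. K * (1/4::real)^n) \<longlonglongrightarrow> 0" for K
    using tendsto_mult[OF tendsto_const[of K] LIMSEQ_power_zero[of "1/4::real"]] by simp
  have lim: "ip2 M q R = 0" if q: "q \<in> LL M" and z: "\<And>n. (cmod (ip2 M (r n) q))\<^sup>2 \<le> (1/4)^n * sq2 M q" for q
  proof -
    \<comment> \<open>18 = 2 * 1 + 2 * 8, from writing \<open>R\<close> as \<open>r n\<close> minus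
      the error \<open>r n - R\<close>.\<close>
    have "(cmod (ip2 M R q))\<^sup>2 \<le> (18 * sq2 M q) * (1/4)^n" for n
    proof -
      have "ip2 M R q = ip2 M (r n) q + (- ip2 M (plin 1 (r n) (-1) R) q)"
        using ip2_lin[OF r R q, of 1 _ "-1"] by simp
      then have "(cmod (ip2 M R q))\<^sup>2 \<le> 2 * (cmod (ip2 M (r n) q))\<^sup>2 + 2 * (cmod (ip2 M (plin 1 (r n) (-1) R) q))\<^sup>2"
        using cmod_add_sq by (metis norm_minus_cancel)
      also have "(cmod (ip2 M (plin 1 (r n) (-1) R) q))\<^sup>2 \<le> 8 * (1/4)^n * sq2 M q"
        using ip2_Cauchy_Schwarz[OF plin_LL[OF r R] q] conv[of n] sq2_nonneg[of M q] by (meson mult_right_mono order_trans)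
      finally show ?thesis using z[of n] by (simp add: algebra_simps)
    qed
    then have "(cmod (ip2 M R q))\<^sup>2 \<le> 0" by (intro LIMSEQ_le_const[OF pow0]) auto
    then show ?thesis using ip2_cnj[of M q R] by simp
  qed
  have orR: "ip2 M q R = 0" if q: "q \<in> T" for q
  proof (rule lim)
    show qL: "q \<in> LL M" using q T(1) by blast
    fix n
    have "(cmod (ip2 M (r n) q))\<^sup>2 \<le> (sq2 M (r n) - d) * sq2 M q"
    proof (rule ip2_le_of_min[OF r qL])
      fix t
      have "plin 1 (r n) t q = plin 1 v (-1) (plin 1 (p n) (-t) q)" by (auto simp: plin_def r_def algebra_simps)
      then show "d \<le> sq2 M (plin 1 (r n) t q)" using dle[OF T(3)[OF p(1) q]] by simp
    qed
    also have "\<dots> \<le> (1/4)^n * sq2 M q" using p(2)[of n] by (intro mult_right_mono sq2_nonneg) (simp add: r_def)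
    finally show "(cmod (ip2 M (r n) q))\<^sup>2 \<le> (1/4)^n * sq2 M q" .
  qed
  have rn: "ip2 M (r n) R = 0" for n
    unfolding r_def using ip2_lin[OF v pL R] orth[OF R orR] orR[OF p(1)] by simp
  have "ip2 M R R = 0"
  proof (rule lim[OF R])
    fix n show "(cmod (ip2 M (r n) R))\<^sup>2 \<le> (1/4)^n * sq2 M R" using rn[of n] sq2_nonneg[of M R] by simp
  qed
  then have R0: "sq2 M R = 0" by (simp add: ip2_self)
  have "d \<le> 8 * (1/4)^n" for n
  proof -
    have "d \<le> sq2 M (r n)" using dle[OF p(1)] by (simp add: r_def)
    also have "\<dots> = sq2 M (plin 1 (r n) (-1) R)"
      using sq2_plin[OF r R, of 1 n "-1"] rn[of n] R0 by simp
    finally show ?thesis using conv[of n] by simp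
  qed
  then have "d \<le> 0" by (intro LIMSEQ_le_const[OF pow0]) auto
  then show False using d e by simp
qed

section \<open>Compactly supported elements\<close>

lemma eventually_left_end:
  assumes "d \<in> Iab a b" shows "\<forall>\<^sub>F x in left_end a. x \<in> Iab a b \<and> x < d"
proof (cases "a = -\<infinity>")
  case True
  have "x \<in> Iab a b \<and> x < d" if "x < d" for x
    using assms that True unfolding Iab_def by (auto intro: less_trans[of _ "ereal d"])
  then show ?thesis using True unfolding left_end_def by (auto simp: eventually_at_bot_dense)
next
  case False
  then obtain r where r: "a = ereal r" using assms by (cases a) (auto simp: Iab_def)
  have "r < d" using assms r by (auto simp: Iab_def)
  moreover have "x \<in> Iab a b \<and> x < d" if "r < x" "x < d" for x
    using assms that r unfolding Iab_def by (auto intro: less_trans[of _ "ereal d"])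
  ultimately show ?thesis using r unfolding left_end_def by (auto simp: eventually_at_right_field)
qed

lemma eventually_right_end:
  assumes "d \<in> Iab a b" shows "\<forall>\<^sub>F x in right_end b. x \<in> Iab a b \<and> d < x"
proof (cases "b = \<infinity>")
  case True
  have "x \<in> Iab a b \<and> d < x" if "d < x" for x
    using assms that True unfolding Iab_def by (auto intro: less_trans[of _ "ereal d"])
  then show ?thesis using True unfolding right_end_def by (auto simp: eventually_at_top_dense)
next
  case False
  then obtain r where r: "b = ereal r" using assms by (cases b) (auto simp: Iab_def)
  have "d < r" using assms r by (auto simp: Iab_def)
  moreover have "x \<in> Iab a b \<and> d < x" if "x < r" "d < x" for x
    using assms that r unfolding Iab_def by (auto intro: less_trans[of _ "ereal d"])
  ultimately show ?thesis using r unfolding right_end_def by (auto simp: eventually_at_left_field)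
qed

lemma left_end_neq_bot: "left_end a \<noteq> bot"
  by (simp add: left_end_def trivial_limit_at_right_real)

lemma right_end_neq_bot: "right_end b \<noteq> bot"
  by (simp add: right_end_def trivial_limit_at_left_real)

text \<open>Dominated convergence works with sequences. Falling eventually below every point of
  \<open>Iab a b\<close> describes the approach to a finite and to an infinite end alike.\<close>

lemma tendsto_left_end_sequentially:
  fixes f :: "real \<Rightarrow> complex"
  assumes d: "d \<in> Iab a b" and f: "\<And>S. (\<And>e. e \<in> Iab a b \<Longrightarrow> \<forall>\<^sub>F n in sequentially. S n < e) \<Longrightarrow> (\<lambda>n. f (S n)) \<longlonglongrightarrow> l"
  shows "(f \<longlongrightarrow> l) (left_end a)"
proof -
  have *: "(\<lambda>n. f (S n)) \<longlonglongrightarrow> l" if "filterlim S (left_end a) sequentially" for S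
  proof (rule f)
    fix e assume "e \<in> Iab a b"
    from filterlim_iff[THEN iffD1, OF that, rule_format, OF eventually_left_end[OF this]]
    show "\<forall>\<^sub>F n in sequentially. S n < e" by eventually_elim simp
  qed
  show ?thesis
  proof (cases "a = -\<infinity>")
    case True
    then have l: "left_end a = at_bot" by (simp add: left_end_def)
    show ?thesis unfolding l
      by (rule tendsto_at_botI_sequentially) (use * in \<open>simp add: l\<close>)
  next
    case False
    then obtain r where r: "a = ereal r" using d by (cases a) (auto simp: Iab_def)
    have l: "left_end a = at_right r" using r by (simp add: left_end_def)
    show ?thesis unfolding l
    proof (rule tendsto_at_right_sequentially[of r "r + 1"])
      fix S :: "nat \<Rightarrow> real" assume S: "\<And>n. r < S n" "S \<longlonglongrightarrow> r"
      then have "filterlim S (left_end a) sequentially" unfolding l filterlim_at by (auto intro!: always_eventually)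
      then show "(\<lambda>n. f (S n)) \<longlonglongrightarrow> l" by (rule *)
    qed simp
  qed
qed

lemma tendsto_right_end_sequentially:
  fixes f :: "real \<Rightarrow> complex"
  assumes d: "d \<in> Iab a b" and f: "\<And>S. (\<And>e. e \<in> Iab a b \<Longrightarrow> \<forall>\<^sub>F n in sequentially. e < S n) \<Longrightarrow> (\<lambda>n. f (S n)) \<longlonglongrightarrow> l"
  shows "(f \<longlongrightarrow> l) (right_end b)"
proof -
  have *: "(\<lambda>n. f (S n)) \<longlonglongrightarrow> l" if "filterlim S (right_end b) sequentially" for S
  proof (rule f)
    fix e assume "e \<in> Iab a b"
    from filterlim_iff[THEN iffD1, OF that, rule_format, OF eventually_right_end[OF this]]
    show "\<forall>\<^sub>F n in sequentially. e < S n" by eventually_elim simp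
  qed
  show ?thesis
  proof (cases "b = \<infinity>")
    case True
    then have l: "right_end b = at_top" by (simp add: right_end_def)
    show ?thesis unfolding l
      by (rule tendsto_at_topI_sequentially) (use * in \<open>simp add: l\<close>)
  next
    case False
    then obtain r where r: "b = ereal r" using d by (cases b) (auto simp: Iab_def)
    have l: "right_end b = at_left r" using r by (simp add: right_end_def)
    show ?thesis unfolding l
    proof (rule tendsto_at_left_sequentially[of "r - 1" r])
      fix S :: "nat \<Rightarrow> real" assume S: "\<And>n. S n < r" "S \<longlonglongrightarrow> r"
      then have "filterlim S (right_end b) sequentially" unfolding l filterlim_at by (auto intro!: always_eventually)
      then show "(\<lambda>n. f (S n)) \<longlonglongrightarrow> l" by (rule *)
    qed simp
  qed
qed

section \<open>Compactly supported elements and their adjoint\<close>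

context measure_sl_gap
begin

lemma AE_I: "AE t in \<rho>. t \<in> I"
proof -
  have "- I \<in> null_sets \<rho>" using H1 open_Iab[of a b] by (auto simp: locfin_def null_sets_def)
  then have "AE t in \<rho>. t \<notin> - I" by (rule AE_not_in)
  then show ?thesis by simp
qed

text \<open>Local moments become integrals over the line, to which the L2 lemmas apply; half-open
  like all integrals of the system.\<close>

definition restr :: "real \<Rightarrow> real \<Rightarrow> (real \<Rightarrow> complex) \<Rightarrow> real \<Rightarrow> complex" where
  "restr x y f t = (if x \<le> t \<and> t < y then f t else 0)"

lemma restr_L2: assumes "bm x y f" "x \<in> I" "y \<in> I" shows "restr x y f \<in> L2 \<rho>"
proof -
  have e: "restr x y f = (\<lambda>t. indicator {x..<y} t *\<^sub>R f t)" by (auto simp: restr_def indicator_def fun_eq_iff)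
  obtain B where B: "\<forall>t\<in>{x..y}. cmod (f t) \<le> B" using assms(1) by (auto simp: bm_def)
  show ?thesis
  proof (rule L2_bound)
    show "restr x y f \<in> borel_measurable \<rho>"
      unfolding e using bm_integrable[OF assms] by (auto simp: set_integrable_def)
    have "emeasure \<rho> {x..<y} < \<infinity>" by (rule locfin_finite[OF H1 assms(2,3)]) auto
    then show "integrable \<rho> (\<lambda>t. B\<^sup>2 * indicator {x..<y} t)" by (intro integrable_mult_right integrable_real_indicator) auto
    show "AE t in \<rho>. (cmod (restr x y f t))\<^sup>2 \<le> B\<^sup>2 * indicator {x..<y} t"
      using B by (intro AE_I2) (auto simp: restr_def intro!: power_mono)
  qed
qed

lemma restr_L2_L2: assumes "u \<in> L2 \<rho>" shows "restr x y u \<in> L2 \<rho>"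
proof (rule L2_bound)
  have e: "restr x y u = (\<lambda>t. indicator {x..<y} t *\<^sub>R u t)" by (auto simp: restr_def indicator_def fun_eq_iff)
  show "restr x y u \<in> borel_measurable \<rho>" unfolding e
    by (intro borel_measurable_scaleR borel_measurable_indicator L2_measurable[OF assms]) simp
  show "integrable \<rho> (\<lambda>t. (cmod (u t))\<^sup>2)" by (rule L2_sq_integrable[OF assms])
qed (auto simp: restr_def)

lemma L2_loc: assumes w: "w \<in> L2 \<rho>" and x: "x \<in> I" "y \<in> I" shows "set_integrable \<rho> {x..y} w"
proof -
  obtain z where z: "z \<in> I" "y < z" using Iab_upper[OF x(2)] by auto
  have "integrable \<rho> (\<lambda>t. restr x z (\<lambda>_. 1) t * w t)"
    by (intro L2_mult_integrable restr_L2 bm_const x z w)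
  moreover have "(\<lambda>t. restr x z (\<lambda>_. 1) t * w t) = (\<lambda>t. indicator {x..<z} t *\<^sub>R w t)" by (auto simp: restr_def indicator_def fun_eq_iff)
  ultimately have "set_integrable \<rho> {x..<z} w" by (simp add: set_integrable_def)
  then show ?thesis by (rule set_integrable_subset) (use z in auto)
qed

lemma LINT_restr: "(LINT t:{x..<y}|\<rho>. f t * g t) = (\<integral>t. restr x y f t * g t \<partial>\<rho>)"
  unfolding set_lebesgue_integral_def by (intro Bochner_Integration.integral_cong) (auto simp: restr_def indicator_def)

text \<open>A part of \<open>T0\<close> with less freedom: the first component is itself the
  representative, not merely a.e. equal to it, and the quasi-derivative has to vanish together with
  f. It is large enough for \<open>adj_T0c\<close>.\<close>

definition T0c :: "cpair set" where
  "T0c = {p \<in> LL \<rho>. \<exists>k. sys (fst p) k (snd p) \<and>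
     (\<exists>x\<in>I. \<exists>y\<in>I. x \<le> y \<and> (\<forall>t\<in>I. t \<le> x \<or> y \<le> t \<longrightarrow> fst p t = 0 \<and> k t = 0))}"

lemma T0c_plin: assumes "p \<in> T0c" "q \<in> T0c" shows "plin s p t q \<in> T0c"
proof -
  obtain k x y where p: "p \<in> LL \<rho>" "sys (fst p) k (snd p)" "x \<in> I" "y \<in> I" "x \<le> y"
    "\<And>t. t \<in> I \<Longrightarrow> t \<le> x \<or> y \<le> t \<Longrightarrow> fst p t = 0 \<and> k t = 0" using assms(1) by (auto simp: T0c_def)
  obtain k' x' y' where q: "q \<in> LL \<rho>" "sys (fst q) k' (snd q)" "x' \<in> I" "y' \<in> I" "x' \<le> y'"
    "\<And>t. t \<in> I \<Longrightarrow> t \<le> x' \<or> y' \<le> t \<Longrightarrow> fst q t = 0 \<and> k' t = 0" using assms(2) by (auto simp: T0c_def)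
  have "plin s p t q \<in> LL \<rho>" by (rule plin_LL[OF p(1) q(1)])
  moreover have "sys (fst (plin s p t q)) (\<lambda>r. s * k r + t * k' r) (snd (plin s p t q))"
    using sys_lin[OF p(2) q(2), of s t] by (simp add: plin_def)
  moreover have "min x x' \<in> I" "max y y' \<in> I" using p(3,4) q(3,4) by (auto simp: min_def max_def)
  moreover have "min x x' \<le> max y y'" using p(5) by auto
  moreover have "\<forall>r\<in>I. r \<le> min x x' \<or> max y y' \<le> r \<longrightarrow> fst (plin s p t q) r = 0 \<and> s * k r + t * k' r = 0"
    using p(6) q(6) by (auto simp: plin_def)
  ultimately show ?thesis unfolding T0c_def by blast
qed

lemma sys_cong:
  assumes "sys f k w" "\<And>t. t \<in> I \<Longrightarrow> f t = g t" "\<And>t. t \<in> I \<Longrightarrow> k t = l t" shows "sys g l w"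
  unfolding sys_def
proof (intro ballI impI)
  fix x y assume xy: "x \<in> I" "y \<in> I" "x \<le> y"
  show "seg x y g l w"
    by (rule seg_cong[OF sysD[OF assms(1) xy] _ xy(3)]) (use assms(2,3) Iab_convex[OF xy(1,2)] in auto)
qed

text \<open>Solve with zero data at x; by \<open>glue\<close> the two vanishing moments of the
  source return the solution to zero at y.\<close>

lemma T0c_I:
  assumes B: "basis \<alpha> \<beta> u k v l" and g: "g \<in> L2 \<rho>" and xy: "x \<in> I" "y \<in> I" "x \<le> y"
    and s: "\<And>t. t < x \<or> y \<le> t \<Longrightarrow> g t = 0"
    and i: "(\<integral>t. g t * u t \<partial>\<rho>) = 0" "(\<integral>t. g t * v t \<partial>\<rho>) = 0"
  obtains f h where "sys f h g" "(f, g) \<in> T0c" "\<And>t. t \<in> I \<Longrightarrow> t \<le> x \<or> y \<le> t \<Longrightarrow> f t = 0 \<and> h t = 0" "\<And>t. t \<notin> I \<Longrightarrow> f t = 0"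
proof -
  obtain f0 h where f0: "sys f0 h g" "f0 x = 0" "h x = 0" using sys_exists[OF xy(1) L2_loc[OF g], of 0 0] by blast
  have "sys u k (\<lambda>_. 0)" using B by (simp add: basis_def)
  then have z: "sys (\<lambda>_. 0) (\<lambda>_. 0) (\<lambda>_. 0)" using sys_lin[of u k "\<lambda>_. 0" u k "\<lambda>_. 0" 0 0] by simp
  have gc: "restr x y g = g" using s by (auto simp: restr_def fun_eq_iff)
  have out: "\<forall>t\<in>I. (t \<le> x \<longrightarrow> f0 t = 0 \<and> h t = 0) \<and> (y \<le> t \<longrightarrow> f0 t = 0 \<and> h t = 0)"
    by (rule glue[OF B f0(1) xy _ _ z]) (use s f0 i in \<open>auto simp: LINT_restr gc\<close>)
  define f where "f = restr x y f0"
  have eq: "f0 t = f t" if "t \<in> I" for t using out that by (auto simp: f_def restr_def)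
  have f: "sys f h g" by (rule sys_cong[OF f0(1)]) (use eq in auto)
  have "f \<in> L2 \<rho>" unfolding f_def using bm_sys[OF f0(1) xy(1,2)] xy by (intro restr_L2) auto
  moreover have "\<forall>t\<in>I. t \<le> x \<or> y \<le> t \<longrightarrow> f t = 0 \<and> h t = 0" using out eq by fastforce
  ultimately have "(f, g) \<in> T0c" unfolding T0c_def using f g xy by auto
  moreover have "f t = 0 \<and> h t = 0" if "t \<in> I" "t \<le> x \<or> y \<le> t" for t
    using out eq[OF that(1)] that by auto
  moreover have "f t = 0" if "t \<notin> I" for t
    using Iab_convex[OF xy(1,2), of t] that unfolding f_def restr_def by auto
  ultimately show ?thesis using that[of f h] f by blast
qed

text \<open>Variation of constants: tested against \<open>T0c\<close>, the difference of \<open>U\<close> and a solution \<open>V\<close> with source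
  \<open>w\<close> annihilates the common kernel of the two functionals given by the basis, so it is a combination of
  the (conjugated) basis.\<close>

lemma adj_T0c:
  assumes U: "U \<in> L2 \<rho>" and w: "w \<in> L2 \<rho>" and adj: "\<And>f g. (f, g) \<in> T0c \<Longrightarrow> inner2 \<rho> g U = inner2 \<rho> f w"
  shows "\<exists>f k. sys f k w \<and> (AE t in \<rho>. U t = f t)"
proof -
  obtain \<alpha> \<beta> u k v l where B: "basis \<alpha> \<beta> u k v l" by (rule basis_exists)
  then have al: "\<alpha> \<in> I" "\<beta> \<in> I" "\<alpha> < \<beta>" and su: "sys u k (\<lambda>_. 0)" and sv: "sys v l (\<lambda>_. 0)" by (auto simp: basis_def)
  obtain V K where V: "sys V K w" using sys_exists[OF al(1) L2_loc[OF w]] by blast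
  obtain h1 where h1: "bm \<alpha> \<beta> h1" "(LINT t:{\<alpha>..<\<beta>}|\<rho>. h1 t * u t) = 1" "(LINT t:{\<alpha>..<\<beta>}|\<rho>. h1 t * v t) = 0"
    using B unfolding basis_def by blast
  obtain h2 where h2: "bm \<alpha> \<beta> h2" "(LINT t:{\<alpha>..<\<beta>}|\<rho>. h2 t * u t) = 0" "(LINT t:{\<alpha>..<\<beta>}|\<rho>. h2 t * v t) = 1"
    using B unfolding basis_def by blast
  define g1 g2 where "g1 = restr \<alpha> \<beta> h1" and "g2 = restr \<alpha> \<beta> h2"
  have gL: "g1 \<in> L2 \<rho>" "g2 \<in> L2 \<rho>" using h1 h2 al by (auto simp: g1_def g2_def intro: restr_L2)
  have gi: "(\<integral>t. g1 t * u t \<partial>\<rho>) = 1" "(\<integral>t. g1 t * v t \<partial>\<rho>) = 0" "(\<integral>t. g2 t * u t \<partial>\<rho>) = 0" "(\<integral>t. g2 t * v t \<partial>\<rho>) = 1"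
    using h1 h2 by (simp_all add: g1_def g2_def LINT_restr)
  define e where "e t = cnj (U t) - cnj (V t)" for t
  \<comment> \<open>\<open>g1\<close>, \<open>g2\<close> are dual to u, v, so these are the only
    possible coefficients of e. They do not depend on the interval [x, y) below, since
    \<open>g1\<close> and \<open>g2\<close> live on [\<alpha>, \<beta>).\<close>
  define c1 c2 where "c1 = (\<integral>t. g1 t * e t \<partial>\<rho>)" and "c2 = (\<integral>t. g2 t * e t \<partial>\<rho>)"
  have main: "AE t in \<rho>. x \<le> t \<and> t < y \<longrightarrow> e t = c1 * u t + c2 * v t"
    if xy: "x \<in> I" "y \<in> I" "x \<le> \<alpha>" "\<beta> \<le> y" for x y
  proof -
    have xley: "x \<le> y" using xy al by simp
    have cL: "restr x y u \<in> L2 \<rho>" "restr x y v \<in> L2 \<rho>" "restr x y V \<in> L2 \<rho>"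
      using bm_sys[OF su xy(1,2)] bm_sys[OF sv xy(1,2)] bm_sys[OF V xy(1,2)] xy
      by (auto intro!: restr_L2)
    have cU: "restr x y U \<in> L2 \<rho>" by (rule restr_L2_L2[OF U])
    have eL: "restr x y e \<in> L2 \<rho>"
    proof -
      have "restr x y e = (\<lambda>t. cnj (restr x y U t) - cnj (restr x y V t))" by (auto simp: restr_def e_def fun_eq_iff)
      then show ?thesis using cL cU by (auto intro!: L2_diff L2_cnj)
    qed
    have loc: "(\<integral>t. g t * f t \<partial>\<rho>) = (\<integral>t. g t * restr x y f t \<partial>\<rho>)" if "\<And>t. t < x \<or> y \<le> t \<Longrightarrow> g t = 0" for g f :: "real \<Rightarrow> complex"
      using that by (intro Bochner_Integration.integral_cong) (auto simp: restr_def not_less not_le)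
    \<comment> \<open>By \<open>T0c_I\<close> such a g is the image of a compactly supported f, so
      the Lagrange identity against the conjugate of V has no boundary terms; the hypothesis
      \<open>adj\<close> gives the same relation for U.\<close>
    have ann: "(\<integral>t. g t * restr x y e t \<partial>\<rho>) = 0"
      if g: "g \<in> L2 \<rho>" "\<And>t. t < x \<or> y \<le> t \<Longrightarrow> g t = 0" "(\<integral>t. g t * u t \<partial>\<rho>) = 0" "(\<integral>t. g t * v t \<partial>\<rho>) = 0" for g
    proof -
      obtain f h where f: "sys f h g" "(f, g) \<in> T0c" "\<And>t. t \<in> I \<Longrightarrow> t \<le> x \<or> y \<le> t \<Longrightarrow> f t = 0 \<and> h t = 0" "\<And>t. t \<notin> I \<Longrightarrow> f t = 0"
        using T0c_I[OF B g(1) xy(1,2) xley g(2,3,4)] by metis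
      have fz: "f t = 0" if "t < x \<or> y \<le> t" for t using f(3)[of t] f(4)[of t] that by (cases "t \<in> I") auto
      have fL: "f \<in> L2 \<rho>" using f(2) by (simp add: T0c_def)
      have "0 = (LINT t:{x..<y}|\<rho>. g t * cnj (V t) - f t * cnj (w t))"
        using Lagrange[OF sysD[OF f(1) xy(1,2) xley] sysD[OF sys_cnj[OF V] xy(1,2) xley] xley] f(3)[OF xy(1)] f(3)[OF xy(2)] by simp
      also have "\<dots> = (\<integral>t. g t * restr x y (\<lambda>t. cnj (V t)) t - f t * cnj (w t) \<partial>\<rho>)"
        unfolding set_lebesgue_integral_def using g(2) fz
        by (intro Bochner_Integration.integral_cong) (auto simp: restr_def indicator_def)
      also have "\<dots> = (\<integral>t. g t * restr x y (\<lambda>t. cnj (V t)) t \<partial>\<rho>) - inner2 \<rho> f w"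
        unfolding inner2_def
        by (intro Bochner_Integration.integral_diff L2_mult_integrable g L2_cnj w fL restr_L2 bm_cnj xy)
          (use bm_sys[OF V xy(1,2)] in simp)
      also have "inner2 \<rho> f w = inner2 \<rho> g U" using adj[OF f(2)] by simp
      also have "inner2 \<rho> g U = (\<integral>t. g t * restr x y (\<lambda>t. cnj (U t)) t \<partial>\<rho>)"
        unfolding inner2_def by (rule loc[OF g(2)])
      finally have "(\<integral>t. g t * restr x y (\<lambda>t. cnj (U t)) t \<partial>\<rho>) - (\<integral>t. g t * restr x y (\<lambda>t. cnj (V t)) t \<partial>\<rho>) = 0" by simp
      moreover have "(\<integral>t. g t * restr x y e t \<partial>\<rho>) = (\<integral>t. g t * restr x y (\<lambda>t. cnj (U t)) t - g t * restr x y (\<lambda>t. cnj (V t)) t \<partial>\<rho>)"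
        by (intro Bochner_Integration.integral_cong) (auto simp: restr_def e_def algebra_simps)
      moreover have "\<dots> = (\<integral>t. g t * restr x y (\<lambda>t. cnj (U t)) t \<partial>\<rho>) - (\<integral>t. g t * restr x y (\<lambda>t. cnj (V t)) t \<partial>\<rho>)"
        by (intro Bochner_Integration.integral_diff L2_mult_integrable g restr_L2_L2 L2_cnj U restr_L2 bm_cnj xy)
          (use bm_sys[OF V xy(1,2)] in simp)
      ultimately show ?thesis by simp
    qed
    define E where "E t = 1 * restr x y e t + 1 * ((- c1) * restr x y u t + (- c2) * restr x y v t)" for t
    have EL: "E \<in> L2 \<rho>" unfolding E_def[abs_def] by (intro L2_add L2_cmult eL cL)
    define g0 where "g0 t = cnj (E t)" for t
    have g0L: "g0 \<in> L2 \<rho>" unfolding g0_def[abs_def] by (rule L2_cnj[OF EL])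
    have g0z: "g0 t = 0" if "t < x \<or> y \<le> t" for t using that by (auto simp: g0_def E_def restr_def)
    have gz: "g1 t = 0" "g2 t = 0" if "t < x \<or> y \<le> t" for t using that xy by (auto simp: g1_def g2_def restr_def)
    define a1 a2 where "a1 = (\<integral>t. g0 t * restr x y u t \<partial>\<rho>)" and "a2 = (\<integral>t. g0 t * restr x y v t \<partial>\<rho>)"
    \<comment> \<open>\<open>g0\<close> is the conjugate of the residual \<open>E\<close>;
      subtracting multiples of \<open>g1\<close> and \<open>g2\<close> removes its two moments.
      Since e integrates to \<open>c1\<close> and \<open>c2\<close> against them, the vanishing of
      the integral of g * e says that \<open>E\<close> has norm 0.\<close>
    define g where "g t = 1 * g0 t + 1 * ((- a1) * g1 t + (- a2) * g2 t)" for t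
    have gLL: "g \<in> L2 \<rho>" unfolding g_def[abs_def] by (intro L2_add L2_cmult g0L gL)
    have gz': "g t = 0" if "t < x \<or> y \<le> t" for t using g0z[OF that] gz[OF that] by (simp add: g_def)
    have exp: "(\<integral>t. g t * z t \<partial>\<rho>) = (\<integral>t. g0 t * z t \<partial>\<rho>) - a1 * (\<integral>t. g1 t * z t \<partial>\<rho>) - a2 * (\<integral>t. g2 t * z t \<partial>\<rho>)"
      if z: "z \<in> L2 \<rho>" for z
    proof -
      have i: "integrable \<rho> (\<lambda>t. g0 t * z t)" "integrable \<rho> (\<lambda>t. g1 t * z t)" "integrable \<rho> (\<lambda>t. g2 t * z t)"
        by (intro L2_mult_integrable g0L gL z)+
      have "(\<integral>t. g t * z t \<partial>\<rho>) = (\<integral>t. g0 t * z t - a1 * (g1 t * z t) - a2 * (g2 t * z t) \<partial>\<rho>)"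
        by (simp add: g_def algebra_simps)
      also have "\<dots> = (\<integral>t. g0 t * z t \<partial>\<rho>) - a1 * (\<integral>t. g1 t * z t \<partial>\<rho>) - a2 * (\<integral>t. g2 t * z t \<partial>\<rho>)"
        using i by simp
      finally show ?thesis .
    qed
    have l1: "(\<integral>t. g1 t * restr x y u t \<partial>\<rho>) = 1" "(\<integral>t. g1 t * restr x y v t \<partial>\<rho>) = 0" "(\<integral>t. g1 t * restr x y e t \<partial>\<rho>) = c1"
      unfolding c1_def gi(1,2)[symmetric] by (rule loc[OF gz(1), symmetric], assumption)+
    have l2: "(\<integral>t. g2 t * restr x y u t \<partial>\<rho>) = 0" "(\<integral>t. g2 t * restr x y v t \<partial>\<rho>) = 1" "(\<integral>t. g2 t * restr x y e t \<partial>\<rho>) = c2"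
      unfolding c2_def gi(3,4)[symmetric] by (rule loc[OF gz(2), symmetric], assumption)+
    have "(\<integral>t. g t * u t \<partial>\<rho>) = (\<integral>t. g t * restr x y u t \<partial>\<rho>)" "(\<integral>t. g t * v t \<partial>\<rho>) = (\<integral>t. g t * restr x y v t \<partial>\<rho>)"
      by (rule loc[OF gz'], assumption)+
    then have "(\<integral>t. g t * u t \<partial>\<rho>) = 0" "(\<integral>t. g t * v t \<partial>\<rho>) = 0"
      using exp[OF cL(1)] exp[OF cL(2)] l1 l2 by (simp_all add: a1_def a2_def)
    from ann[OF gLL gz' this] have z0: "(\<integral>t. g0 t * restr x y e t \<partial>\<rho>) - a1 * c1 - a2 * c2 = 0"
      unfolding exp[OF eL] l1 l2 by simp
    have "inner2 \<rho> E E = (\<integral>t. g0 t * restr x y e t - c1 * (g0 t * restr x y u t) - c2 * (g0 t * restr x y v t) \<partial>\<rho>)"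
      unfolding inner2_def by (intro Bochner_Integration.integral_cong) (auto simp: E_def g0_def algebra_simps)
    also have "\<dots> = (\<integral>t. g0 t * restr x y e t \<partial>\<rho>) - c1 * a1 - c2 * a2"
      using L2_mult_integrable[OF g0L eL] L2_mult_integrable[OF g0L cL(1)] L2_mult_integrable[OF g0L cL(2)]
      by (simp add: a1_def a2_def)
    finally have "inner2 \<rho> E E = 0" using z0 by (simp add: algebra_simps)
    then have "(\<integral>t. (cmod (E t))\<^sup>2 \<partial>\<rho>) = 0" by (simp add: inner2_self sqn_def)
    then have "AE t in \<rho>. (cmod (E t))\<^sup>2 = 0" using integral_nonneg_eq_0_iff_AE[OF L2_sq_integrable[OF EL]] by simp
    then show ?thesis by eventually_elim (auto simp: E_def restr_def algebra_simps)
  qed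
  obtain Kn where Kn: "\<And>n::nat. fst (Kn n) \<in> I \<or> snd (Kn n) < fst (Kn n)"
    "\<And>n. snd (Kn n) \<in> I \<or> snd (Kn n) < fst (Kn n)" "(\<Union>n. {fst (Kn n)..snd (Kn n)}) = I"
    using Iab_cover[of a b] by metis
  have "AE t in \<rho>. t \<in> {fst (Kn n)..snd (Kn n)} \<longrightarrow> e t = c1 * u t + c2 * v t" for n
  proof (cases "snd (Kn n) < fst (Kn n)")
    case False
    then have "fst (Kn n) \<in> I" "snd (Kn n) \<in> I" using Kn(1)[of n] Kn(2)[of n] by auto
    \<comment> \<open>\<open>main\<close> speaks of half-open intervals, hence a point z beyond the
      right end.\<close>
    then obtain z where z: "z \<in> I" "snd (Kn n) < z" using Iab_upper by metis
    have "min \<alpha> (fst (Kn n)) \<in> I" "max \<beta> z \<in> I" using al z \<open>fst (Kn n) \<in> I\<close> by (auto simp: min_def max_def)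
    from main[OF this] show ?thesis by (rule AE_mp[OF _ AE_I2]) (use z in auto)
  qed auto
  then have "AE t in \<rho>. \<forall>n. t \<in> {fst (Kn n)..snd (Kn n)} \<longrightarrow> e t = c1 * u t + c2 * v t" unfolding AE_all_countable by blast
  then have "AE t in \<rho>. e t = c1 * u t + c2 * v t" using AE_I
  proof eventually_elim
    fix t assume t: "\<forall>n. t \<in> {fst (Kn n)..snd (Kn n)} \<longrightarrow> e t = c1 * u t + c2 * v t" "t \<in> I"
    then obtain n where "t \<in> {fst (Kn n)..snd (Kn n)}" using Kn(3) by blast
    then show "e t = c1 * u t + c2 * v t" using t(1) by blast
  qed
  then have "AE t in \<rho>. U t = 1 * V t + 1 * (cnj c1 * cnj (u t) + cnj c2 * cnj (v t))"
  proof eventually_elim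
    fix t assume "e t = c1 * u t + c2 * v t"
    then have "cnj (e t) = cnj (c1 * u t + c2 * v t)" by simp
    then show "U t = 1 * V t + 1 * (cnj c1 * cnj (u t) + cnj c2 * cnj (v t))" by (simp add: e_def algebra_simps)
  qed
  moreover have "sys (\<lambda>t. 1 * V t + 1 * (cnj c1 * cnj (u t) + cnj c2 * cnj (v t)))
      (\<lambda>t. 1 * K t + 1 * (cnj c1 * cnj (k t) + cnj c2 * cnj (l t))) w"
    using sys_lin[OF V sys_lin[OF sys_cnj[OF su] sys_cnj[OF sv], of "cnj c1" "cnj c2"], of 1 1] by simp
  ultimately show ?thesis by blast
qed

section \<open>The boundary form and self-adjoint restrictions\<close>

abbreviation "TM \<equiv> Tmax a b \<rho> \<sigma> chi c"

lemma basis_zero: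
  "basis \<alpha> \<beta> u k v l \<Longrightarrow> sys f g (\<lambda>_. 0) \<Longrightarrow> AE t in \<rho>. t \<in> {\<alpha>..<\<beta>} \<longrightarrow> f t = 0 \<Longrightarrow> t \<in> I \<Longrightarrow> f t = 0 \<and> g t = 0"
  unfolding basis_def by blast

definition srep :: "cpair \<Rightarrow> (real \<Rightarrow> complex) \<Rightarrow> (real \<Rightarrow> complex) \<Rightarrow> bool" where
  "srep p f k \<longleftrightarrow> sys f k (snd p) \<and> (AE x in \<rho>. fst p x = f x)"

lemma rep_srep: "rep a b \<rho> \<sigma> chi c p f F \<Longrightarrow> srep p f (qder chi c f F)"
  using dom_pair_sys[of f F "snd p"] by (simp add: rep_def srep_def)

lemma srep_rep:
  assumes "srep p f k"
  shows "rep a b \<rho> \<sigma> chi c p f (\<lambda>x. sint chi c x f - k x)" "qder chi c f (\<lambda>x. sint chi c x f - k x) = k"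
  using sys_dom_pair[of f k "snd p"] assms by (simp_all add: rep_def srep_def)

text \<open>The difference solves \<tau> f = 0 and vanishes \<rho>-a.e. Thus f, its quasi-derivative
  and all boundary values are functions of the L2 pair.\<close>

lemma srep_unique:
  assumes f: "srep p f k" and g: "srep p g l" and t: "t \<in> I" shows "f t = g t \<and> k t = l t"
proof -
  obtain \<alpha> \<beta> u k' v l' where B: "basis \<alpha> \<beta> u k' v l'" by (rule basis_exists)
  have "sys (\<lambda>t. f t - g t) (\<lambda>t. k t - l t) (\<lambda>t. 0)"
    using sys_diff[of f k "snd p" g l "snd p"] f g by (simp add: srep_def)
  moreover have "AE t in \<rho>. t \<in> {\<alpha>..<\<beta>} \<longrightarrow> f t - g t = 0"
    using f g unfolding srep_def by (auto elim!: eventually_elim2)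
  ultimately have "f t - g t = 0 \<and> k t - l t = 0" using basis_zero[OF B _ _ t] by blast
  then show ?thesis by simp
qed

lemma Tmax_iff: "p \<in> TM \<longleftrightarrow> p \<in> LL \<rho> \<and> (\<exists>f k. srep p f k)"
proof -
  have "(\<exists>f F. rep a b \<rho> \<sigma> chi c p f F) \<longleftrightarrow> (\<exists>f k. srep p f k)"
    using rep_srep srep_rep(1) by blast
  then show ?thesis by (cases p) (auto simp: Tmax_def)
qed

lemma TM_L2: "p \<in> TM \<Longrightarrow> fst p \<in> L2 \<rho> \<and> snd p \<in> L2 \<rho>"
  by (auto simp: Tmax_iff mem_Times_iff)

lemma srep_cong:
  assumes "srep p f k" "\<And>t. t \<in> I \<Longrightarrow> f t = g t" "\<And>t. t \<in> I \<Longrightarrow> k t = l t" shows "srep p g l"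
proof -
  have "AE t in \<rho>. fst p t = g t"
    using assms(1) AE_I assms(2) unfolding srep_def by (auto elim!: eventually_elim2)
  then show ?thesis using assms sys_cong[of f k "snd p" g l] by (simp add: srep_def)
qed

text \<open>The representative of p, unique on the interval by \<open>srep_unique\<close>; the value
  0 outside makes it Borel measurable on the whole line.\<close>

definition fr :: "cpair \<Rightarrow> real \<Rightarrow> complex" where
  "fr p = (SOME f. (\<exists>k. srep p f k) \<and> (\<forall>t. t \<notin> I \<longrightarrow> f t = 0))"

definition kr :: "cpair \<Rightarrow> real \<Rightarrow> complex" where
  "kr p = (SOME k. srep p (fr p) k)"

lemma fr_kr: assumes "p \<in> TM" shows "srep p (fr p) (kr p)" "t \<notin> I \<Longrightarrow> fr p t = 0"
proof -
  obtain f k where f: "srep p f k" using assms Tmax_iff by blast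
  have "srep p (\<lambda>t. if t \<in> I then f t else 0) k" by (rule srep_cong[OF f]) auto
  then have "\<exists>f. (\<exists>k. srep p f k) \<and> (\<forall>t. t \<notin> I \<longrightarrow> f t = 0)"
    by (intro exI[of _ "\<lambda>t. if t \<in> I then f t else 0"]) auto
  then have *: "(\<exists>k. srep p (fr p) k) \<and> (\<forall>t. t \<notin> I \<longrightarrow> fr p t = 0)" unfolding fr_def by (rule someI_ex)
  then show "srep p (fr p) (kr p)" unfolding kr_def by (metis someI_ex)
  show "t \<notin> I \<Longrightarrow> fr p t = 0" using * by blast
qed

lemma fr_eq: "p \<in> TM \<Longrightarrow> srep p f k \<Longrightarrow> t \<in> I \<Longrightarrow> fr p t = f t \<and> kr p t = k t"
  using srep_unique[OF fr_kr(1)] by blast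

section \<open>The Wronskian on the maximal relation\<close>

definition wr :: "cpair \<Rightarrow> cpair \<Rightarrow> real \<Rightarrow> complex" where
  "wr p q x = fr p x * kr q x - kr p x * fr q x"

lemma wr_antisym: "wr p q x = - wr q p x" by (simp add: wr_def)

text \<open>The pairs (\<open>fr p x\<close>, \<open>kr p x\<close>) are vectors in a plane, and
  this is the three-term relation between the 2 x 2 determinants formed from four of them.\<close>

lemma pluecker: "wr p q x * wr r s x + wr p r x * wr s q x + wr p s x * wr q r x = 0"
  unfolding wr_def by algebra

text \<open>By uniqueness, the quantifier over all representatives reduces to the chosen
  ones.\<close>

lemma W_end_zero_iff:
  assumes p: "p \<in> TM" and q: "q \<in> TM" and L: "\<forall>\<^sub>F x in L. x \<in> I"
  shows "W_end_zero a b \<rho> \<sigma> chi c L p q \<longleftrightarrow> (wr p q \<longlongrightarrow> 0) L"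
proof
  assume W: "W_end_zero a b \<rho> \<sigma> chi c L p q"
  note r = srep_rep[OF fr_kr(1)[OF p]] srep_rep[OF fr_kr(1)[OF q]]
  have "((\<lambda>x. Wr chi c (fr p) (\<lambda>x. sint chi c x (fr p) - kr p x) (fr q) (\<lambda>x. sint chi c x (fr q) - kr q x) x) \<longlongrightarrow> 0) L"
    using W r(1,3) unfolding W_end_zero_def by blast
  then show "(wr p q \<longlongrightarrow> 0) L" unfolding Wr_def r(2,4) wr_def .
next
  assume W: "(wr p q \<longlongrightarrow> 0) L"
  show "W_end_zero a b \<rho> \<sigma> chi c L p q" unfolding W_end_zero_def
  proof (intro allI impI)
    fix f F g G assume rp: "rep a b \<rho> \<sigma> chi c p f F" and rq: "rep a b \<rho> \<sigma> chi c q g G"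
    have "\<forall>\<^sub>F x in L. wr p q x = Wr chi c f F g G x"
      using L by eventually_elim (use fr_eq[OF p rep_srep[OF rp]] fr_eq[OF q rep_srep[OF rq]] in \<open>simp add: wr_def Wr_def\<close>)
    then show "((\<lambda>x. Wr chi c f F g G x) \<longlongrightarrow> 0) L" using W by (simp add: tendsto_cong)
  qed
qed

lemma conjp_conjp [simp]: "conjp (conjp p) = p" by (simp add: conjp_def)

lemma srep_conjp: "srep p f k \<Longrightarrow> srep (conjp p) (\<lambda>t. cnj (f t)) (\<lambda>t. cnj (k t))"
  unfolding srep_def by (auto simp: conjp_def intro: sys_cnj)

lemma conjp_Tmax: "p \<in> TM \<Longrightarrow> conjp p \<in> TM"
proof -
  assume p: "p \<in> TM"
  then obtain f k where "srep p f k" using Tmax_iff by blast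
  then have "srep (conjp p) (\<lambda>t. cnj (f t)) (\<lambda>t. cnj (k t))" by (rule srep_conjp)
  moreover have "conjp p \<in> LL \<rho>" using TM_L2[OF p] by (simp add: conjp_def L2_cnj)
  ultimately show ?thesis unfolding Tmax_iff by blast
qed

lemma wr_conjp: "p \<in> TM \<Longrightarrow> q \<in> TM \<Longrightarrow> x \<in> I \<Longrightarrow> wr (conjp p) (conjp q) x = cnj (wr p q x)"
proof -
  assume p: "p \<in> TM" and q: "q \<in> TM" and x: "x \<in> I"
  note fr_eq[OF conjp_Tmax[OF p] srep_conjp[OF fr_kr(1)[OF p]] x] fr_eq[OF conjp_Tmax[OF q] srep_conjp[OF fr_kr(1)[OF q]] x]
  then show ?thesis by (simp add: wr_def)
qed

text \<open>The sesquilinear defect from symmetry whose vanishing defines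
  \<open>adj\<close>.\<close>

definition Dd :: "cpair \<Rightarrow> cpair \<Rightarrow> complex" where
  "Dd p q = inner2 \<rho> (snd p) (fst q) - inner2 \<rho> (fst p) (snd q)"

text \<open>Dominated convergence; the limit at the left end is 0 because \<rho> does not charge the
  complement of the interval.\<close>

lemma tendsto_initial_integral:
  fixes \<Phi> :: "real \<Rightarrow> complex"
  assumes \<Phi>: "integrable \<rho> \<Phi>"
  shows "((\<lambda>x. LINT t:{..<x}|\<rho>. \<Phi> t) \<longlongrightarrow> 0) (left_end a)"
    and "((\<lambda>x. LINT t:{..<x}|\<rho>. \<Phi> t) \<longlongrightarrow> (\<integral>t. \<Phi> t \<partial>\<rho>)) (right_end b)"
proof -
  have m: "(\<lambda>t. indicator {..<x} t *\<^sub>R \<Phi> t) \<in> borel_measurable \<rho>" for x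
    using \<Phi> by (intro borel_measurable_scaleR borel_measurable_indicator) auto
  show "((\<lambda>x. LINT t:{..<x}|\<rho>. \<Phi> t) \<longlongrightarrow> 0) (left_end a)"
  proof (rule tendsto_left_end_sequentially[OF c])
    fix S :: "nat \<Rightarrow> real" assume S: "\<And>e. e \<in> I \<Longrightarrow> \<forall>\<^sub>F n in sequentially. S n < e"
    have "(\<lambda>n. \<integral>t. indicator {..<S n} t *\<^sub>R \<Phi> t \<partial>\<rho>) \<longlonglongrightarrow> (\<integral>t. 0 \<partial>\<rho>)"
    proof (rule integral_dominated_convergence[where w = "\<lambda>t. norm (\<Phi> t)"])
      show "AE t in \<rho>. (\<lambda>n. indicator {..<S n} t *\<^sub>R \<Phi> t) \<longlonglongrightarrow> 0"
        using AE_I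
      proof eventually_elim
        fix t assume "t \<in> I"
        then show "(\<lambda>n. indicator {..<S n} t *\<^sub>R \<Phi> t) \<longlonglongrightarrow> 0"
          by (intro tendsto_eventually eventually_mono[OF S]) (auto simp: indicator_def)
      qed
    qed (use \<Phi> m in \<open>auto simp: indicator_def\<close>)
    then show "(\<lambda>n. LINT t:{..<S n}|\<rho>. \<Phi> t) \<longlonglongrightarrow> 0" by (simp add: set_lebesgue_integral_def)
  qed
  show "((\<lambda>x. LINT t:{..<x}|\<rho>. \<Phi> t) \<longlongrightarrow> (\<integral>t. \<Phi> t \<partial>\<rho>)) (right_end b)"
  proof (rule tendsto_right_end_sequentially[OF c])
    fix S :: "nat \<Rightarrow> real" assume S: "\<And>e. e \<in> I \<Longrightarrow> \<forall>\<^sub>F n in sequentially. e < S n"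
    have "(\<lambda>n. \<integral>t. indicator {..<S n} t *\<^sub>R \<Phi> t \<partial>\<rho>) \<longlonglongrightarrow> (\<integral>t. \<Phi> t \<partial>\<rho>)"
    proof (rule integral_dominated_convergence[where w = "\<lambda>t. norm (\<Phi> t)"])
      show "AE t in \<rho>. (\<lambda>n. indicator {..<S n} t *\<^sub>R \<Phi> t) \<longlonglongrightarrow> \<Phi> t"
        using AE_I
      proof eventually_elim
        fix t assume "t \<in> I"
        then show "(\<lambda>n. indicator {..<S n} t *\<^sub>R \<Phi> t) \<longlonglongrightarrow> \<Phi> t"
          by (intro tendsto_eventually eventually_mono[OF S]) (auto simp: indicator_def)
      qed
    qed (use \<Phi> m in \<open>auto simp: indicator_def\<close>)
    then show "(\<lambda>n. LINT t:{..<S n}|\<rho>. \<Phi> t) \<longlonglongrightarrow> (\<integral>t. \<Phi> t \<partial>\<rho>)" by (simp add: set_lebesgue_integral_def)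
  qed
qed

text \<open>Up to a constant, the Wronskian is the primitive of an integrable function. The Lagrange
  identity speaks of representatives and \<Phi> of the L2 components, which agree
  \<rho>-a.e.\<close>

lemma wr_limits:
  assumes p: "p \<in> TM" and q: "q \<in> TM"
  obtains C where "(wr p q \<longlongrightarrow> C) (left_end a)"
    "(wr p q \<longlongrightarrow> C + (\<integral>t. snd p t * fst q t - fst p t * snd q t \<partial>\<rho>)) (right_end b)"
proof -
  define \<Phi> where "\<Phi> t = snd p t * fst q t - fst p t * snd q t" for t
  have \<Phi>: "integrable \<rho> \<Phi>"
    unfolding \<Phi>_def[abs_def] using TM_L2[OF p] TM_L2[OF q]
    by (intro Bochner_Integration.integrable_diff L2_mult_integrable) auto
  define A where "A x = (LINT t:{..<x}|\<rho>. \<Phi> t)" for x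
  have si: "set_integrable \<rho> S \<Phi>" if "S \<in> sets borel" for S
    unfolding set_integrable_def using \<Phi> that by (intro integrable_mult_indicator) auto
  have step: "wr p q y - wr p q x = A y - A x" if xy: "x \<in> I" "y \<in> I" "x \<le> y" for x y
  proof -
    have sp: "sys (fr p) (kr p) (snd p)" "AE t in \<rho>. fst p t = fr p t" and sq: "sys (fr q) (kr q) (snd q)" "AE t in \<rho>. fst q t = fr q t"
      using fr_kr(1)[OF p] fr_kr(1)[OF q] by (auto simp: srep_def)
    have bq: "bm x y (fr q)" "bm x y (fr p)" "set_integrable \<rho> {x..y} (snd p)" "set_integrable \<rho> {x..y} (snd q)"
      using bm_sys[OF sq(1) xy(1,2)] bm_sys[OF sp(1) xy(1,2)] by auto
    have i: "set_integrable \<rho> {x..y} (\<lambda>t. fr q t * snd p t - fr p t * snd q t)"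
      by (intro set_integral_diff(1) set_integrable_bm_mult bq) auto
    have i': "set_integrable \<rho> {x..<y} (\<lambda>t. snd p t * fr q t - fr p t * snd q t)"
      by (rule set_integrable_subset[of _ "{x..y}"]) (use i in \<open>auto simp: mult.commute\<close>)
    have "wr p q y - wr p q x = (LINT t:{x..<y}|\<rho>. snd p t * fr q t - fr p t * snd q t)"
      using Lagrange[OF sysD[OF sp(1) xy] sysD[OF sq(1) xy] xy(3)] by (simp add: wr_def)
    also have "\<dots> = (LINT t:{x..<y}|\<rho>. \<Phi> t)"
      unfolding set_lebesgue_integral_def
    proof (rule integral_cong_AE)
      show "(\<lambda>t. indicator {x..<y} t *\<^sub>R (snd p t * fr q t - fr p t * snd q t)) \<in> borel_measurable \<rho>"
        using i' by (auto simp: set_integrable_def)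
      show "(\<lambda>t. indicator {x..<y} t *\<^sub>R \<Phi> t) \<in> borel_measurable \<rho>"
        using si[of "{x..<y}"] by (auto simp: set_integrable_def)
      show "AE t in \<rho>. indicator {x..<y} t *\<^sub>R (snd p t * fr q t - fr p t * snd q t) = indicator {x..<y} t *\<^sub>R \<Phi> t"
        using sp(2) sq(2) by eventually_elim (simp add: \<Phi>_def)
    qed
    also have "\<dots> = A y - A x"
    proof -
      have "{..<y} = {..<x} \<union> {x..<y}" using xy by auto
      moreover have "{..<x} \<inter> {x..<y} = {}" by auto
      ultimately show ?thesis unfolding A_def using set_integral_Un[of "{..<x}" "{x..<y}" \<rho> \<Phi>] si by simp
    qed
    finally show ?thesis .
  qed
  define C where "C = wr p q c - A c"
  have eq: "wr p q x = C + A x" if "x \<in> I" for x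
    using step[OF that c] step[OF c that] by (cases "x \<le> c") (auto simp: C_def algebra_simps)
  have "((\<lambda>x. C + A x) \<longlongrightarrow> C + 0) (left_end a)"
    unfolding A_def by (intro tendsto_add tendsto_const tendsto_initial_integral \<Phi>)
  moreover have "\<forall>\<^sub>F x in left_end a. C + A x = wr p q x"
    using eventually_left_end[OF c] by eventually_elim (simp add: eq)
  ultimately have l: "(wr p q \<longlongrightarrow> C) (left_end a)" by (simp add: tendsto_cong)
  have "((\<lambda>x. C + A x) \<longlongrightarrow> C + (\<integral>t. \<Phi> t \<partial>\<rho>)) (right_end b)"
    unfolding A_def by (intro tendsto_add tendsto_const tendsto_initial_integral \<Phi>)
  moreover have "\<forall>\<^sub>F x in right_end b. C + A x = wr p q x"
    using eventually_right_end[OF c] by eventually_elim (simp add: eq)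
  ultimately have "(wr p q \<longlongrightarrow> C + (\<integral>t. \<Phi> t \<partial>\<rho>)) (right_end b)" by (simp add: tendsto_cong)
  then show ?thesis using that[of C] l unfolding \<Phi>_def by blast
qed

lemma Dd_limits:
  assumes p: "p \<in> TM" and q: "q \<in> TM" and l: "(wr p (conjp q) \<longlongrightarrow> A) (left_end a)" and r: "(wr p (conjp q) \<longlongrightarrow> B) (right_end b)"
  shows "Dd p q = B - A"
proof -
  obtain C where C: "(wr p (conjp q) \<longlongrightarrow> C) (left_end a)"
    "(wr p (conjp q) \<longlongrightarrow> C + (\<integral>t. snd p t * fst (conjp q) t - fst p t * snd (conjp q) t \<partial>\<rho>)) (right_end b)"
    using wr_limits[OF p conjp_Tmax[OF q]] .
  have "C = A" using tendsto_unique[OF left_end_neq_bot C(1) l] .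
  moreover have "C + (\<integral>t. snd p t * fst (conjp q) t - fst p t * snd (conjp q) t \<partial>\<rho>) = B"
    using tendsto_unique[OF right_end_neq_bot C(2) r] .
  moreover have "(\<integral>t. snd p t * fst (conjp q) t - fst p t * snd (conjp q) t \<partial>\<rho>) = Dd p q"
    unfolding Dd_def inner2_def conjp_def fst_conv snd_conv
    using TM_L2[OF p] TM_L2[OF q] by (intro Bochner_Integration.integral_diff L2_mult_integrable L2_cnj) auto
  ultimately show ?thesis by (metis add_diff_cancel_left')
qed

section \<open>The minimal relation\<close>

lemma T0_Tmax: "T0 a b \<rho> \<sigma> chi c \<subseteq> TM" by (auto simp: T0_def)

lemma T0c_T0: "T0c \<subseteq> T0 a b \<rho> \<sigma> chi c"
proof
  fix p assume "p \<in> T0c"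
  then obtain k x y where p: "p \<in> LL \<rho>" "sys (fst p) k (snd p)" "x \<in> I" "y \<in> I"
    "\<forall>t\<in>I. t \<le> x \<or> y \<le> t \<longrightarrow> fst p t = 0 \<and> k t = 0" by (auto simp: T0c_def)
  have s: "srep p (fst p) k" using p(2) by (simp add: srep_def)
  then have "p \<in> TM" using p(1) Tmax_iff by blast
  moreover have "\<forall>t\<in>I. t \<notin> {x..y} \<longrightarrow> fst p t = 0" using p(5) by auto
  ultimately show "p \<in> T0 a b \<rho> \<sigma> chi c" unfolding T0_def using srep_rep(1)[OF s] p(3,4) by blast
qed

text \<open>\<open>T0\<close> only requires f to vanish off [x, y]. Every t outside is the right end
  of an interval on which f vanishes, so \<open>seg_quasi_zero\<close> makes the quasi-derivative
  vanish as well.\<close>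

lemma T0_Dd:
  assumes p: "p \<in> T0 a b \<rho> \<sigma> chi c" and q: "q \<in> TM" shows "Dd p q = 0"
proof -
  have pT: "p \<in> TM" using p T0_Tmax by blast
  obtain f F x y where f: "rep a b \<rho> \<sigma> chi c p f F" "x \<in> I" "y \<in> I" "\<And>t. t \<in> I \<Longrightarrow> t \<notin> {x..y} \<Longrightarrow> f t = 0"
    using p unfolding T0_def by blast
  note s = fr_eq[OF pT rep_srep[OF f(1)]]
  have sys: "sys (fr p) (kr p) (snd p)" using fr_kr(1)[OF pT] by (simp add: srep_def)
  have z: "wr p r t = 0" if t: "t \<in> I" "t \<notin> {x..y}" for t r
  proof -
    have ft: "fr p t' = 0" if "t' \<in> I" "t' \<notin> {x..y}" for t' using s[OF that(1)] f(4)[OF that] by simp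
    have "kr p t = 0"
    proof (cases "t < x")
      case True
      obtain d where d: "d \<in> I" "d < t" using Iab_lower[OF t(1)] by auto
      show ?thesis
        by (rule seg_quasi_zero[OF sysD[OF sys d(1) t(1) less_imp_le[OF d(2)]] ft d(2) order_refl])
          (use True Iab_convex[OF d(1) t(1)] in auto)
    next
      case False
      then have yt: "y < t" using t by auto
      define d where "d = (y + t) / 2"
      have d: "y < d" "d < t" using yt by (auto simp: d_def)
      then have dI: "d \<in> I" using Iab_convex[OF f(3) t(1)] by auto
      show ?thesis
        by (rule seg_quasi_zero[OF sysD[OF sys dI t(1) less_imp_le[OF d(2)]] ft d(2) order_refl])
          (use d Iab_convex[OF dI t(1)] in auto)
    qed
    then show ?thesis using ft[OF t] by (simp add: wr_def)
  qed
  have "(wr p (conjp q) \<longlongrightarrow> 0) (left_end a)"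
    by (intro tendsto_eventually eventually_mono[OF eventually_left_end[OF f(2)]] z) auto
  moreover have "(wr p (conjp q) \<longlongrightarrow> 0) (right_end b)"
    by (intro tendsto_eventually eventually_mono[OF eventually_right_end[OF f(3)]] z) auto
  ultimately show ?thesis using Dd_limits[OF pT q] by fastforce
qed

lemma inner2_norm2_le: "u \<in> L2 \<rho> \<Longrightarrow> v \<in> L2 \<rho> \<Longrightarrow> cmod (inner2 \<rho> u v) \<le> norm2 \<rho> u * norm2 \<rho> v"
proof -
  assume uv: "u \<in> L2 \<rho>" "v \<in> L2 \<rho>"
  have z: "inner2 \<rho> (\<lambda>x. 0) (\<lambda>x. 0) = 0" "sqn \<rho> (\<lambda>x. 0) = 0" by (simp_all add: inner2_def sqn_def)
  have "(cmod (inner2 \<rho> u v))\<^sup>2 \<le> sqn \<rho> u * sqn \<rho> v"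
    using ip2_Cauchy_Schwarz[of "(u, \<lambda>x. 0)" \<rho> "(v, \<lambda>x. 0)"] uv L2_zero z by (simp add: ip2_def sq2_def)
  then have "sqrt ((cmod (inner2 \<rho> u v))\<^sup>2) \<le> sqrt (sqn \<rho> u * sqn \<rho> v)" by (rule real_sqrt_le_mono)
  then show ?thesis by (simp add: norm2_sqn real_sqrt_mult)
qed

text \<open>For fixed q, \<open>Dd\<close> is continuous in p for the graph norm.\<close>

lemma Tmin_Dd:
  assumes p: "p \<in> Tmin a b \<rho> \<sigma> chi c" and q: "q \<in> TM" shows "Dd p q = 0"
proof (rule ccontr)
  assume nz: "Dd p q \<noteq> 0"
  obtain u w where pu: "p = (u, w)" by (cases p)
  have uw: "u \<in> L2 \<rho>" "w \<in> L2 \<rho>" using p by (auto simp: Tmin_def pu)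
  have qL: "fst q \<in> L2 \<rho>" "snd q \<in> L2 \<rho>" using TM_L2[OF q] by auto
  define N where "N = norm2 \<rho> (fst q) + norm2 \<rho> (snd q) + 1"
  have N: "N > 0" "norm2 \<rho> (fst q) \<le> N" "norm2 \<rho> (snd q) \<le> N" by (auto simp: N_def norm2_sqn sqn_nonneg add_nonneg_pos)
  define e where "e = cmod (Dd p q) / N"
  have "e > 0" using nz N by (simp add: e_def)
  moreover have "\<forall>e>0. \<exists>(f, g)\<in>T0 a b \<rho> \<sigma> chi c. norm2 \<rho> (\<lambda>x. u x - f x) + norm2 \<rho> (\<lambda>x. w x - g x) < e"
    using p unfolding Tmin_def pu by auto
  ultimately obtain f g where fg: "(f, g) \<in> T0 a b \<rho> \<sigma> chi c" "norm2 \<rho> (\<lambda>x. u x - f x) + norm2 \<rho> (\<lambda>x. w x - g x) < e"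
    by blast
  have fgL: "f \<in> L2 \<rho>" "g \<in> L2 \<rho>" using TM_L2[of "(f,g)"] fg(1) T0_Tmax by auto
  have "Dd p q = Dd p q - Dd (f, g) q" using T0_Dd[OF fg(1) q] by simp
  also have "\<dots> = inner2 \<rho> (\<lambda>x. w x - g x) (fst q) - inner2 \<rho> (\<lambda>x. u x - f x) (snd q)"
    using uw fgL qL by (simp add: Dd_def pu inner2_diff)
  also have "cmod \<dots> \<le> cmod (inner2 \<rho> (\<lambda>x. w x - g x) (fst q)) + cmod (inner2 \<rho> (\<lambda>x. u x - f x) (snd q))"
    by (rule norm_triangle_ineq4)
  also have "\<dots> \<le> norm2 \<rho> (\<lambda>x. w x - g x) * norm2 \<rho> (fst q) + norm2 \<rho> (\<lambda>x. u x - f x) * norm2 \<rho> (snd q)"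
    using uw fgL qL by (intro add_mono inner2_norm2_le L2_diff)
  also have "\<dots> \<le> norm2 \<rho> (\<lambda>x. w x - g x) * N + norm2 \<rho> (\<lambda>x. u x - f x) * N"
    using N by (intro add_mono mult_left_mono) (auto simp: norm2_sqn sqn_nonneg)
  also have "\<dots> = (norm2 \<rho> (\<lambda>x. u x - f x) + norm2 \<rho> (\<lambda>x. w x - g x)) * N" by (simp add: algebra_simps)
  also have "\<dots> < e * N" using fg(2) N(1) by (rule mult_strict_right_mono)
  also have "\<dots> = cmod (Dd p q)" using N by (simp add: e_def)
  finally show False by simp
qed

text \<open>If (r1, r2) is orthogonal to \<open>T0c\<close>, then (r2, - r1) is in its adjoint,
  hence in \<open>Tmax\<close>, and the vanishing of \<open>Dd v\<close> there says that v is
  orthogonal to (r1, r2). So v lies in the closure of \<open>T0c\<close>.\<close>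

lemma Tmin_of_Dd:
  assumes v: "v \<in> TM" and D: "\<And>q. q \<in> TM \<Longrightarrow> Dd v q = 0" shows "v \<in> Tmin a b \<rho> \<sigma> chi c"
proof -
  have vL: "v \<in> LL \<rho>" using v Tmax_iff by blast
  have z: "((\<lambda>x. 0), (\<lambda>x. 0)) \<in> T0c"
  proof -
    obtain \<alpha> \<beta> u k w l where B: "basis \<alpha> \<beta> u k w l" by (rule basis_exists)
    then have "sys u k (\<lambda>_. 0)" by (simp add: basis_def)
    then have "sys (\<lambda>_. 0) (\<lambda>_. 0) (\<lambda>_. 0)" using sys_lin[of u k "\<lambda>_. 0" u k "\<lambda>_. 0" 0 0] by simp
    then show ?thesis unfolding T0c_def using L2_zero c by auto
  qed
  have clo: "\<exists>p\<in>T0c. sq2 \<rho> (plin 1 v (-1) p) < e" if "e > 0" for e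
  proof (rule closure_of_orthogonal[OF _ _ _ vL _ that])
    show "T0c \<subseteq> LL \<rho>" by (auto simp: T0c_def)
    show "T0c \<noteq> {}" using z by blast
    show "\<And>p q s t. p \<in> T0c \<Longrightarrow> q \<in> T0c \<Longrightarrow> plin s p t q \<in> T0c" by (rule T0c_plin)
    fix r assume r: "r \<in> LL \<rho>" and orth: "\<And>q. q \<in> T0c \<Longrightarrow> ip2 \<rho> q r = 0"
    let ?w = "\<lambda>x. - fst r x"
    have rL: "fst r \<in> L2 \<rho>" "snd r \<in> L2 \<rho>" using r by (auto simp: mem_Times_iff)
    have wL: "?w \<in> L2 \<rho>" using L2_cmult[OF rL(1), of "-1"] by simp
    have neg: "inner2 \<rho> h ?w = - inner2 \<rho> h (fst r)" for h by (simp add: inner2_def)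
    have "\<exists>f k. sys f k ?w \<and> (AE t in \<rho>. snd r t = f t)"
    proof (rule adj_T0c[OF rL(2) wL])
      fix f g assume "(f, g) \<in> T0c"
      from orth[OF this] show "inner2 \<rho> g (snd r) = inner2 \<rho> f ?w" unfolding neg ip2_def by (simp add: add_eq_0_iff)
    qed
    then have "(snd r, ?w) \<in> TM" unfolding Tmax_iff srep_def using rL wL by auto
    from D[OF this] show "ip2 \<rho> v r = 0" unfolding Dd_def fst_conv snd_conv neg ip2_def by (simp add: add.commute)
  qed
  show ?thesis unfolding Tmin_def
  proof (cases v, simp, intro conjI allI impI)
    fix u w assume vu: "v = (u, w)"
    then show "u \<in> L2 \<rho>" "w \<in> L2 \<rho>" using vL by auto
    fix e :: real assume e: "e > 0"
    then obtain p where p: "p \<in> T0c" "sq2 \<rho> (plin 1 v (-1) p) < (e/2)\<^sup>2" using clo[of "(e/2)\<^sup>2"] by auto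
    have "sqn \<rho> (\<lambda>x. u x - fst p x) < (e/2)\<^sup>2" "sqn \<rho> (\<lambda>x. w x - snd p x) < (e/2)\<^sup>2"
      using p(2) sqn_nonneg[of \<rho> "\<lambda>x. u x - fst p x"] sqn_nonneg[of \<rho> "\<lambda>x. w x - snd p x"]
      by (simp_all add: sq2_def plin_def vu)
    then have "sqrt (sqn \<rho> (\<lambda>x. u x - fst p x)) < sqrt ((e/2)\<^sup>2)" "sqrt (sqn \<rho> (\<lambda>x. w x - snd p x)) < sqrt ((e/2)\<^sup>2)"
      by (simp_all only: real_sqrt_less_iff)
    then have "norm2 \<rho> (\<lambda>x. u x - fst p x) + norm2 \<rho> (\<lambda>x. w x - snd p x) < e"
      using e by (simp add: norm2_sqn)
    then show "\<exists>x\<in>T0 a b \<rho> \<sigma> chi c. case x of (f, g) \<Rightarrow> norm2 \<rho> (\<lambda>x. u x - f x) + norm2 \<rho> (\<lambda>x. w x - g x) < e"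
      using p(1) T0c_T0 by (intro bexI[of _ p]) (auto simp: case_prod_beta)
  qed
qed

section \<open>Self-adjoint restrictions\<close>

lemma adj_iff: "p \<in> adj \<rho> S \<longleftrightarrow> p \<in> LL \<rho> \<and> (\<forall>q\<in>S. Dd q p = 0)"
  by (cases p) (auto simp: adj_def Dd_def)

text \<open>The form \<open>W\<close> at the limit-circle end satisfies the Pluecker identity, so modulo its radical the
  space \<open>TM\<close> is two-dimensional and a Lagrangian subspace is the kernel of one functional.\<close>

lemma selfadjoint_iff:
  fixes L :: "real filter" and s :: complex
  assumes L: "L \<noteq> bot" and ev: "\<forall>\<^sub>F x in L. x \<in> I"
    and conv: "\<And>p q. p \<in> TM \<Longrightarrow> q \<in> TM \<Longrightarrow> \<exists>l. (wr p q \<longlongrightarrow> l) L"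
    and Dl: "\<And>p q l. p \<in> TM \<Longrightarrow> q \<in> TM \<Longrightarrow> (wr p (conjp q) \<longlongrightarrow> l) L \<Longrightarrow> Dd p q = s * l"
    and s: "s \<noteq> 0" and nz: "\<exists>p\<in>TM. \<exists>q\<in>TM. \<not> (wr p q \<longlongrightarrow> 0) L"
  shows "(S \<subseteq> TM \<and> adj \<rho> S = S) \<longleftrightarrow>
       (\<exists>v \<in> TM - Tmin a b \<rho> \<sigma> chi c. W_end_zero a b \<rho> \<sigma> chi c L v (conjp v) \<and>
          S = {p \<in> TM. W_end_zero a b \<rho> \<sigma> chi c L p (conjp v)})"
proof -
  define B where "B p q = Lim L (wr p q)" for p q
  have B: "(wr p q \<longlongrightarrow> B p q) L" if "p \<in> TM" "q \<in> TM" for p q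
  proof -
    obtain l where "(wr p q \<longlongrightarrow> l) L" using conv[OF \<open>p \<in> TM\<close> \<open>q \<in> TM\<close>] by blast
    then show ?thesis unfolding B_def using tendsto_Lim[OF L] by metis
  qed
  have Beq: "B p q = l" if "p \<in> TM" "q \<in> TM" "(wr p q \<longlongrightarrow> l) L" for p q l
    using tendsto_unique[OF L B[OF that(1,2)] that(3)] .
  have W: "W_end_zero a b \<rho> \<sigma> chi c L p q \<longleftrightarrow> B p q = 0" if "p \<in> TM" "q \<in> TM" for p q
    unfolding W_end_zero_iff[OF that ev] using B[OF that] Beq[OF that] by metis
  have D: "Dd p q = s * B p (conjp q)" if "p \<in> TM" "q \<in> TM" for p q
    using Dl[OF that B[OF that(1) conjp_Tmax[OF that(2)]]] .
  have D0: "Dd p q = 0 \<longleftrightarrow> B p (conjp q) = 0" if "p \<in> TM" "q \<in> TM" for p q using D[OF that] s by simp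
  have anti: "B p q = - B q p" if "p \<in> TM" "q \<in> TM" for p q
  proof (rule Beq[OF that])
    have "(wr p q \<longlongrightarrow> - B q p) L \<longleftrightarrow> ((\<lambda>x. - wr q p x) \<longlongrightarrow> - B q p) L"
      by (intro tendsto_cong always_eventually allI) (rule wr_antisym)
    then show "(wr p q \<longlongrightarrow> - B q p) L" using tendsto_minus[OF B[OF that(2,1)]] by simp
  qed
  have cnjB: "B (conjp p) (conjp q) = cnj (B p q)" if "p \<in> TM" "q \<in> TM" for p q
  proof (rule Beq[OF conjp_Tmax conjp_Tmax, OF that])
    have "((\<lambda>x. cnj (wr p q x)) \<longlongrightarrow> cnj (B p q)) L" by (intro tendsto_cnj B that)
    moreover have "\<forall>\<^sub>F x in L. cnj (wr p q x) = wr (conjp p) (conjp q) x"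
      using ev by eventually_elim (simp add: wr_conjp[OF that])
    ultimately show "(wr (conjp p) (conjp q) \<longlongrightarrow> cnj (B p q)) L" by (simp add: tendsto_cong)
  qed
  have plk: "B p q * B r t + B p r * B t q + B p t * B q r = 0" if "p \<in> TM" "q \<in> TM" "r \<in> TM" "t \<in> TM" for p q r t
  proof -
    have "((\<lambda>x. wr p q x * wr r t x + wr p r x * wr t q x + wr p t x * wr q r x) \<longlongrightarrow> B p q * B r t + B p r * B t q + B p t * B q r) L"
      by (intro tendsto_add tendsto_mult B that)
    then have "((\<lambda>x. 0) \<longlongrightarrow> B p q * B r t + B p r * B t q + B p t * B q r) L" by (simp add: pluecker)
    then show ?thesis using tendsto_unique[OF L _ tendsto_const] by blast
  qed
  have TL: "p \<in> LL \<rho>" if "p \<in> TM" for p using that Tmax_iff by blast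
  have adjS: "adj \<rho> {p \<in> TM. B p (conjp v) = 0} = {p \<in> TM. B p (conjp v) = 0}" (is "adj \<rho> ?S = ?S")
    if v: "v \<in> TM" "v \<notin> Tmin a b \<rho> \<sigma> chi c" "B v (conjp v) = 0" for v
  proof
    have vc: "conjp v \<in> TM" using conjp_Tmax v by blast
    \<comment> \<open>v outside \<open>Tmin\<close> is not in the radical of \<open>B\<close>; h is
      a partner that detects it, and the conjugate of h detects \<open>conjp v\<close>.\<close>
    obtain h where h: "h \<in> TM" "B v h \<noteq> 0"
    proof -
      obtain q where "q \<in> TM" "Dd v q \<noteq> 0" using Tmin_of_Dd[OF v(1)] v(2) by blast
      then show ?thesis using that[of "conjp q"] D0[OF v(1)] conjp_Tmax by blast
    qed
    have hc: "conjp h \<in> TM" using conjp_Tmax h by blast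
    have nzc: "B (conjp v) (conjp h) \<noteq> 0" using cnjB[OF v(1) h(1)] h(2) by simp
    have Bv: "B g v = 0" if g: "g \<in> TM" "B g (conjp v) = 0" for g
      using plk[OF g(1) v(1) vc hc] g(2) v(3) nzc by simp
    show "?S \<subseteq> adj \<rho> ?S"
    proof
      fix p assume p: "p \<in> ?S"
      have "Dd q p = 0" if q: "q \<in> ?S" for q
      proof -
        have pc: "conjp p \<in> TM" using p conjp_Tmax by blast
        have "B (conjp p) (conjp v) = 0" using cnjB[of p v] Bv[of p] p v by simp
        \<comment> \<open>The same identity for q, p*, v*, h*: both q and p* are B-orthogonal to v*,
          so only this product survives.\<close>
        then have "B q (conjp p) * B (conjp v) (conjp h) = 0"
          using plk[of q "conjp p" "conjp v" "conjp h"] q pc vc hc by simp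
        then have "B q (conjp p) = 0" using nzc by simp
        then show ?thesis using D0[of q p] p q by simp
      qed
      then show "p \<in> adj \<rho> ?S" unfolding adj_iff using p TL by blast
    qed
    show "adj \<rho> ?S \<subseteq> ?S"
    proof
      fix q assume q: "q \<in> adj \<rho> ?S"
      \<comment> \<open>Since \<open>T0c\<close> lies in \<open>?S\<close>, the adjoint of
        \<open>?S\<close> lies in that of \<open>T0c\<close> and thus in \<open>Tmax\<close>;
        testing with v itself then gives the boundary condition.\<close>
      have T0S: "T0c \<subseteq> ?S"
      proof
        fix p assume "p \<in> T0c"
        then have "p \<in> T0 a b \<rho> \<sigma> chi c" using T0c_T0 by blast
        then have "p \<in> TM" "Dd p v = 0" using T0_Tmax T0_Dd v(1) by blast+
        then show "p \<in> ?S" using D0[OF _ v(1)] by blast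
      qed
      have qL: "fst q \<in> L2 \<rho>" "snd q \<in> L2 \<rho>" using q by (auto simp: adj_iff mem_Times_iff)
      have "\<exists>f k. sys f k (snd q) \<and> (AE t in \<rho>. fst q t = f t)"
      proof (rule adj_T0c[OF qL])
        fix f g assume "(f, g) \<in> T0c"
        then have "Dd (f, g) q = 0" using q T0S adj_iff by blast
        then show "inner2 \<rho> g (fst q) = inner2 \<rho> f (snd q)" by (simp add: Dd_def)
      qed
      then have qT: "q \<in> TM" unfolding Tmax_iff srep_def using qL by (auto simp: mem_Times_iff)
      have "v \<in> ?S" using v by simp
      moreover have "\<forall>p\<in>?S. Dd p q = 0" using q unfolding adj_iff by (rule conjunct2)
      ultimately have "Dd v q = 0" by (rule bspec[rotated])
      then have "B v (conjp q) = 0" using D0[OF v(1) qT] by simp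
      then have "cnj (B v (conjp q)) = 0" by simp
      then have "B (conjp v) q = 0" using cnjB[OF v(1) conjp_Tmax[OF qT]] by simp
      then have "B q (conjp v) = 0" using anti[OF qT vc] by simp
      then show "q \<in> ?S" using qT by simp
    qed
  qed
  show ?thesis
  proof
    assume "\<exists>v \<in> TM - Tmin a b \<rho> \<sigma> chi c. W_end_zero a b \<rho> \<sigma> chi c L v (conjp v) \<and>
          S = {p \<in> TM. W_end_zero a b \<rho> \<sigma> chi c L p (conjp v)}"
    then obtain v where v: "v \<in> TM" "v \<notin> Tmin a b \<rho> \<sigma> chi c" "B v (conjp v) = 0" "S = {p \<in> TM. W_end_zero a b \<rho> \<sigma> chi c L p (conjp v)}"
      using W conjp_Tmax by blast
    have "S = {p \<in> TM. B p (conjp v) = 0}" using v(4) W[OF _ conjp_Tmax[OF v(1)]] by blast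
    then show "S \<subseteq> TM \<and> adj \<rho> S = S" using adjS[OF v(1,2,3)] by auto
  next
    assume S: "S \<subseteq> TM \<and> adj \<rho> S = S"
    have DS: "Dd p q = 0" if "p \<in> S" "q \<in> S" for p q using that S adj_iff by blast
    \<comment> \<open>If \<open>S\<close> were contained in \<open>Tmin\<close>, every element of
      \<open>Tmax\<close> would be in the adjoint of \<open>S\<close>, so \<open>Tmax\<close> would
      lie in \<open>Tmin\<close> and \<open>B\<close> would vanish, contrary to
      \<open>nz\<close>.\<close>
    obtain v where v: "v \<in> S" "v \<notin> Tmin a b \<rho> \<sigma> chi c"
    proof (rule ccontr)
      assume "\<not> thesis"
      then have SM: "S \<subseteq> Tmin a b \<rho> \<sigma> chi c" using that by blast
      have "TM \<subseteq> adj \<rho> S" unfolding subset_iff adj_iff using TL Tmin_Dd SM by blast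
      then have TMm: "TM \<subseteq> Tmin a b \<rho> \<sigma> chi c" using S SM by blast
      obtain p q where pq: "p \<in> TM" "q \<in> TM" "\<not> (wr p q \<longlongrightarrow> 0) L" using nz by blast
      have "Dd p (conjp q) = 0" using Tmin_Dd[of p "conjp q"] TMm pq conjp_Tmax by blast
      then have "B p q = 0" using D0[OF pq(1) conjp_Tmax[OF pq(2)]] by simp
      then show False using B[OF pq(1,2)] pq(3) by simp
    qed
    have vT: "v \<in> TM" using v S by blast
    have v0: "B v (conjp v) = 0" using DS[OF v(1) v(1)] D0[OF vT vT] by simp
    let ?S = "{p \<in> TM. B p (conjp v) = 0}"
    have SS: "S \<subseteq> ?S" using DS[OF _ v(1)] D0[OF _ vT] S by blast
    moreover have "?S \<subseteq> S"
    proof -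
      \<comment> \<open>Taking adjoints reverses the inclusion of \<open>S\<close> in
        \<open>?S\<close>, so two self-adjoint relations, one inside the other, coincide.\<close>
      have "?S = adj \<rho> ?S" using adjS[OF vT v(2) v0] by simp
      also have "\<dots> \<subseteq> adj \<rho> S" using SS unfolding subset_iff adj_iff by blast
      finally show ?thesis using S by simp
    qed
    ultimately have "S = ?S" by blast
    also have "?S = {p \<in> TM. W_end_zero a b \<rho> \<sigma> chi c L p (conjp v)}" using W[OF _ conjp_Tmax[OF vT]] by blast
    finally show "\<exists>v \<in> TM - Tmin a b \<rho> \<sigma> chi c. W_end_zero a b \<rho> \<sigma> chi c L v (conjp v) \<and>
          S = {p \<in> TM. W_end_zero a b \<rho> \<sigma> chi c L p (conjp v)}"
      using v vT v0 W[OF vT conjp_Tmax[OF vT]] by blast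
  qed
qed

end

section \<open>The limit point and limit circle cases\<close>

lemma eventually_left_endD:
  assumes c: "c \<in> Iab a b" and P: "\<forall>\<^sub>F x in left_end a. P x"
  shows "\<exists>d\<in>Iab a b. \<forall>x\<in>Iab a b. x < d \<longrightarrow> P x"
proof (cases "a = -\<infinity>")
  case True
  then obtain N where N: "\<And>x. x < N \<Longrightarrow> P x" using P by (auto simp: left_end_def eventually_at_bot_dense)
  have "min N c \<in> Iab a b" using c True unfolding Iab_def by (auto simp: min_def intro: less_le_trans le_less_trans[of _ "ereal c"])
  then show ?thesis using N by (intro bexI[of _ "min N c"]) auto
next
  case False
  then obtain r where r: "a = ereal r" using c by (cases a) (auto simp: Iab_def)
  then obtain d where d: "d > r" "\<And>x. r < x \<Longrightarrow> x < d \<Longrightarrow> P x" using P by (auto simp: left_end_def eventually_at_right_field)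
  have "min d c \<in> Iab a b" using c d r unfolding Iab_def by (auto simp: min_def intro: le_less_trans[of _ "ereal c"])
  then show ?thesis using d r by (intro bexI[of _ "min d c"]) (auto simp: Iab_def)
qed

lemma eventually_right_endD:
  assumes c: "c \<in> Iab a b" and P: "\<forall>\<^sub>F x in right_end b. P x"
  shows "\<exists>d\<in>Iab a b. \<forall>x\<in>Iab a b. d < x \<longrightarrow> P x"
proof (cases "b = \<infinity>")
  case True
  then obtain N where N: "\<And>x. N < x \<Longrightarrow> P x" using P by (auto simp: right_end_def eventually_at_top_dense)
  have "max N c \<in> Iab a b" using c True unfolding Iab_def by (auto simp: max_def intro: less_le_trans[of _ "ereal c"])
  then show ?thesis using N by (intro bexI[of _ "max N c"]) auto
next
  case False
  then obtain r where r: "b = ereal r" using c by (cases b) (auto simp: Iab_def)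
  then obtain d where d: "d < r" "\<And>x. d < x \<Longrightarrow> x < r \<Longrightarrow> P x" using P by (auto simp: right_end_def eventually_at_left_field)
  have "max d c \<in> Iab a b" using c d r unfolding Iab_def by (auto simp: max_def intro: less_le_trans[of _ "ereal c"])
  then show ?thesis using d r by (intro bexI[of _ "max d c"]) (auto simp: Iab_def)
qed

lemma borel_measurable_locally:
  fixes f :: "real \<Rightarrow> complex"
  assumes "\<And>x y. x \<in> Iab a b \<Longrightarrow> y \<in> Iab a b \<Longrightarrow> bm x y f" and "\<And>t. t \<notin> Iab a b \<Longrightarrow> f t = 0"
  shows "f \<in> borel_measurable borel"
proof -
  obtain K where K: "\<And>n::nat. fst (K n) \<in> Iab a b \<or> snd (K n) < fst (K n)"
    "\<And>n. snd (K n) \<in> Iab a b \<or> snd (K n) < fst (K n)" "(\<Union>n. {fst (K n)..snd (K n)}) = Iab a b"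
    using Iab_cover[of a b] by metis
  show ?thesis
  proof (rule measurable_piecewise_restrict[where C = "insert (- Iab a b) (range (\<lambda>n. {fst (K n)..snd (K n)}))"])
    show "space borel \<subseteq> \<Union> (insert (- Iab a b) (range (\<lambda>n. {fst (K n)..snd (K n)})))" using K(3) by blast
    fix \<Omega> assume \<Omega>: "\<Omega> \<in> insert (- Iab a b) (range (\<lambda>n. {fst (K n)..snd (K n)}))"
    have "- Iab a b \<in> sets borel" using open_Iab[of a b] by auto
    then show s: "\<Omega> \<inter> space borel \<in> sets borel" using \<Omega> by auto
    have "(\<lambda>t. indicator \<Omega> t *\<^sub>R f t) \<in> borel_measurable borel"
    proof (cases "\<Omega> = - Iab a b")
      case True
      then have "(\<lambda>t. indicator \<Omega> t *\<^sub>R f t) = (\<lambda>t. 0)" using assms(2) by (auto simp: indicator_def fun_eq_iff)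
      then show ?thesis by simp
    next
      case False
      then obtain n where n: "\<Omega> = {fst (K n)..snd (K n)}" using \<Omega> by auto
      show ?thesis
      proof (cases "snd (K n) < fst (K n)")
        case True then show ?thesis by (simp add: n)
      next
        case False
        then show ?thesis using assms(1)[of "fst (K n)" "snd (K n)"] K(1)[of n] K(2)[of n] by (simp add: n bm_def set_borel_measurable_def)
      qed
    qed
    then show "f \<in> borel_measurable (restrict_space borel \<Omega>)"
      using s by (subst borel_measurable_restrict_space_iff) auto
  qed auto
qed

text \<open>Gronwall by absorption. Multiply \<open>le\<close> by \<psi> and integrate over
  \<open>A x\<close>: as \<open>m\<close> is monotone along the nested sets and \<phi> \<psi> has
  integral at most \<epsilon>/2, this gives m x <= (K + m x)/2, hence m x <= K. Sets
  \<open>A x\<close> instead of intervals let one proof serve both ends.\<close>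

lemma absorb_half:
  fixes u :: "real \<Rightarrow> complex" and \<phi> \<psi> :: "real \<Rightarrow> real"
  assumes sub: "\<And>x. x \<in> E \<Longrightarrow> A x \<subseteq> E \<and> A x \<in> sets M" and nest: "\<And>x y. x \<in> E \<Longrightarrow> y \<in> A x \<Longrightarrow> A y \<subseteq> A x"
    and pos: "\<And>t. \<phi> t \<ge> 0" "\<And>t. \<psi> t \<ge> 0" "\<epsilon> > 0" "K \<ge> 0"
    and iu: "\<And>x. x \<in> E \<Longrightarrow> set_integrable M (A x) (\<lambda>t. cmod (u t) * \<psi> t)"
    and i: "set_integrable M E (\<lambda>t. \<phi> t * \<psi> t)" and half: "(LINT t:E|M. \<phi> t * \<psi> t) \<le> \<epsilon> / 2"
    and le: "\<And>x. x \<in> E \<Longrightarrow> cmod (u x) \<le> \<phi> x / \<epsilon> * (K + (LINT t:A x|M. cmod (u t) * \<psi> t))"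
    and x: "x \<in> E"
  shows "cmod (u x) \<le> 2 * K / \<epsilon> * \<phi> x"
proof -
  define m where "m x = (LINT t:A x|M. cmod (u t) * \<psi> t)" for x
  have mpos: "m x \<ge> 0" for x unfolding m_def set_lebesgue_integral_def using pos by (intro Bochner_Integration.integral_nonneg) auto
  have mono: "m y \<le> m x" if "y \<in> A x" for y
  proof -
    have y: "y \<in> E" using sub[OF x] that by blast
    show ?thesis unfolding m_def set_lebesgue_integral_def
      using iu[OF x] iu[OF y] nest[OF x that] pos unfolding set_integrable_def
      by (intro integral_mono) (auto simp: indicator_def)
  qed
  have iA: "set_integrable M (A x) (\<lambda>t. \<phi> t * \<psi> t)" by (rule set_integrable_subset[OF i]) (use sub[OF x] in auto)
  have "m x \<le> (LINT t:A x|M. (K + m x) / \<epsilon> * (\<phi> t * \<psi> t))"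
    unfolding m_def[of x]
  proof (rule set_integral_mono[OF iu[OF x]], fold m_def)
    show "set_integrable M (A x) (\<lambda>t. (K + m x) / \<epsilon> * (\<phi> t * \<psi> t))" using iA by simp
    fix t assume t: "t \<in> A x"
    then have "t \<in> E" using sub[OF x] by blast
    then have "cmod (u t) \<le> \<phi> t / \<epsilon> * (K + m t)" using le m_def by simp
    also have "\<dots> \<le> \<phi> t / \<epsilon> * (K + m x)" using mono[OF t] pos by (intro mult_left_mono) auto
    finally have "cmod (u t) * \<psi> t \<le> \<phi> t / \<epsilon> * (K + m x) * \<psi> t" using pos by (intro mult_right_mono) auto
    then show "cmod (u t) * \<psi> t \<le> (K + m x) / \<epsilon> * (\<phi> t * \<psi> t)" by (simp add: ac_simps)
  qed
  also have "\<dots> = (K + m x) / \<epsilon> * (LINT t:A x|M. \<phi> t * \<psi> t)" by simp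
  finally have 1: "m x \<le> (K + m x) / \<epsilon> * (LINT t:A x|M. \<phi> t * \<psi> t)" .
  have "(LINT t:A x|M. \<phi> t * \<psi> t) \<le> (LINT t:E|M. \<phi> t * \<psi> t)"
    unfolding set_lebesgue_integral_def
    using i iA sub[OF x] pos unfolding set_integrable_def by (intro integral_mono) (auto simp: indicator_def)
  also have "\<dots> \<le> \<epsilon> / 2" by (rule half)
  finally have "(LINT t:A x|M. \<phi> t * \<psi> t) \<le> \<epsilon> / 2" .
  then have "m x \<le> (K + m x) / \<epsilon> * (\<epsilon> / 2)"
    using pos mpos[of x] by (intro order_trans[OF 1] mult_left_mono) auto
  then have "m x \<le> K" using pos(3) by simp
  then have "\<phi> x / \<epsilon> * (K + m x) \<le> \<phi> x / \<epsilon> * (2 * K)" using pos by (intro mult_left_mono) auto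
  then show ?thesis using le[OF x] by (simp add: m_def ac_simps)
qed

section \<open>Domination of solutions near an end\<close>

context measure_sl_gap
begin

lemma fr_measurable: "p \<in> TM \<Longrightarrow> fr p \<in> borel_measurable borel"
  by (rule borel_measurable_locally[of a b]) (use fr_kr[of p] bm_sys in \<open>auto simp: srep_def\<close>)

lemma fr_L2: assumes "p \<in> TM" shows "fr p \<in> L2 \<rho>"
proof (rule L2_bound)
  show "fr p \<in> borel_measurable \<rho>" using fr_measurable[OF assms] by (simp cong: measurable_cong_sets)
  show "integrable \<rho> (\<lambda>t. (cmod (fst p t))\<^sup>2)" using TM_L2[OF assms] by (intro L2_sq_integrable) auto
  show "AE t in \<rho>. (cmod (fr p t))\<^sup>2 \<le> (cmod (fst p t))\<^sup>2" using fr_kr(1)[OF assms] unfolding srep_def by (auto elim!: eventually_mono)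
qed

lemma bm_abs: "bm x y f \<Longrightarrow> x \<in> I \<Longrightarrow> y \<in> I \<Longrightarrow> set_integrable \<rho> {x..<y} w \<Longrightarrow> set_integrable \<rho> {x..<y} (\<lambda>t. cmod (f t) * cmod (w t))"
proof -
  assume *: "bm x y f" "x \<in> I" "y \<in> I" "set_integrable \<rho> {x..<y} w"
  have e1: "(\<lambda>t. indicator {x..y} t *\<^sub>R (indicator {x..<y} t *\<^sub>R w t)) = (\<lambda>t. indicator {x..<y} t *\<^sub>R w t)"
    and e2: "(\<lambda>t. norm (indicator {x..y} t *\<^sub>R (f t * (indicator {x..<y} t *\<^sub>R w t)))) = (\<lambda>t. indicator {x..<y} t *\<^sub>R (cmod (f t) * cmod (w t)))"
    by (auto simp: indicator_def fun_eq_iff norm_mult)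
  have "set_integrable \<rho> {x..y} (\<lambda>t. indicator {x..<y} t *\<^sub>R w t)"
    using *(4) unfolding set_integrable_def e1 .
  then have "set_integrable \<rho> {x..y} (\<lambda>t. f t * (indicator {x..<y} t *\<^sub>R w t))" by (rule set_integrable_bm_mult[OF sets_rho *(1)])
  then have "integrable \<rho> (\<lambda>t. norm (indicator {x..y} t *\<^sub>R (f t * (indicator {x..<y} t *\<^sub>R w t))))"
    unfolding set_integrable_def by (rule integrable_norm)
  then show ?thesis unfolding set_integrable_def e2 .
qed

definition maj :: "cpair \<Rightarrow> cpair \<Rightarrow> real \<Rightarrow> real" where
  "maj p q t = cmod (fr p t) + cmod (fr q t)"

text \<open>A bound for |z f| + |\<tau> f| with f either of the two representatives: the factor
  beside |u| in the Lagrange integrand for W(u, f).\<close>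

definition maj_src :: "complex \<Rightarrow> cpair \<Rightarrow> cpair \<Rightarrow> real \<Rightarrow> real" where
  "maj_src z p q t = cmod z * (cmod (fr p t) + cmod (fr q t)) + cmod (snd p t) + cmod (snd q t)"

lemma maj_integrable:
  assumes "p \<in> TM" "q \<in> TM"
  shows "integrable \<rho> (\<lambda>t. maj p q t * maj_src z p q t)"
proof -
  have fL: "fr p \<in> L2 \<rho>" "fr q \<in> L2 \<rho>" "snd p \<in> L2 \<rho>" "snd q \<in> L2 \<rho>" using assms fr_L2 TM_L2 by auto
  have prodL: "integrable \<rho> (\<lambda>t. cmod (h t) * cmod (g t))" if "h \<in> L2 \<rho>" "g \<in> L2 \<rho>" for h g
    using integrable_norm[OF L2_mult_integrable[OF that]] by (simp add: norm_mult)
  show ?thesis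
    unfolding maj_def maj_src_def distrib_left distrib_right
    by (intro Bochner_Integration.integrable_add)
      (use prodL fL in \<open>auto simp: mult.left_commute[of _ "cmod z"] mult.assoc intro!: integrable_mult_right\<close>)
qed

text \<open>By the Pluecker identity \<open>u W(f, g) = f W(u, g) - g W(u, f)\<close>, where \<open>W(u, g)\<close> and \<open>W(u, f)\<close> are controlled
  by an integral of \<open>u\<close> against square integrable functions. So if \<open>W(f, g)\<close> stays away from zero near an
  end, then \<open>u\<close> is dominated by \<open>f\<close> and \<open>g\<close> there.\<close>

lemma solution_bound:
  assumes p: "p \<in> TM" and q: "q \<in> TM" and u: "sys u ku (\<lambda>t. z * u t)" and \<epsilon>: "\<epsilon> > 0"
    and d: "d \<in> I" and E: "E = {x\<in>I. d \<le> x} \<or> E = {x\<in>I. x < d}"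
    and W: "\<And>x. x \<in> E \<Longrightarrow> cmod (wr p q x) \<ge> \<epsilon>"
    and half: "(LINT t:E|\<rho>. maj p q t * maj_src z p q t) \<le> \<epsilon> / 2"
  shows "\<exists>K. \<forall>x\<in>E. cmod (u x) \<le> K * maj p q x"
proof -
  define \<phi> \<psi> where "\<phi> = maj p q" and "\<psi> = maj_src z p q"
  note \<phi>_def = \<phi>_def maj_def[abs_def] and \<psi>_def = \<psi>_def maj_src_def[abs_def]
  \<comment> \<open>The interval between x and the base point d, over which the Lagrange identity
    compares W(u, f) at x and at d.\<close>
  define A where "A x = (if x < d then {x..<d} else {d..<x})" for x
  have Es: "E \<in> sets borel"
  proof -
    have "{x\<in>I. d \<le> x} = I \<inter> {d..}" "{x\<in>I. x < d} = I \<inter> {..<d}" by auto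
    then show ?thesis using E open_Iab[of a b] by auto
  qed
  have EI: "E \<subseteq> I" using E by auto
  have AE: "A x \<subseteq> E" if "x \<in> E" for x
    using E that Iab_convex[OF d, of x] Iab_convex[OF _ d, of x] unfolding A_def by fastforce
  have nest: "A y \<subseteq> A x" if "x \<in> E" "y \<in> A x" for x y
    using E that unfolding A_def by (auto split: if_splits)
  have sp: "sys (fr p) (kr p) (snd p)" and sq: "sys (fr q) (kr q) (snd q)" using fr_kr(1) p q by (auto simp: srep_def)
  define P where "P x = u x * kr p x - ku x * fr p x" for x
  define Q where "Q x = u x * kr q x - ku x * fr q x" for x
  have fL: "fr p \<in> L2 \<rho>" "fr q \<in> L2 \<rho>" "snd p \<in> L2 \<rho>" "snd q \<in> L2 \<rho>" using p q fr_L2 TM_L2 by auto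
  have "integrable \<rho> (\<lambda>t. \<phi> t * \<psi> t)" unfolding \<phi>_def(1) \<psi>_def(1) by (rule maj_integrable[OF p q])
  then have i: "set_integrable \<rho> E (\<lambda>t. \<phi> t * \<psi> t)"
    unfolding set_integrable_def using Es by (intro integrable_mult_indicator) auto
  have psipos: "\<psi> t \<ge> 0" for t by (simp add: \<psi>_def)
  have phipos: "\<phi> t \<ge> 0" for t by (simp add: \<phi>_def)
  have seg_iu: "set_integrable \<rho> {x..<y} (\<lambda>t. cmod (u t) * \<psi> t)" if xy: "x \<in> I" "y \<in> I" for x y
  proof -
    have b: "bm x y u" "bm x y (fr p)" "bm x y (fr q)" using bm_sys[OF u xy] bm_sys[OF sp xy] bm_sys[OF sq xy] by auto
    have w: "set_integrable \<rho> {x..<y} (snd p)" "set_integrable \<rho> {x..<y} (snd q)"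
      by (rule set_integrable_subset[OF L2_loc[OF _ xy]]; use fL in auto)+
    have "set_integrable \<rho> {x..<y} (\<lambda>t. cmod z * (cmod (u t) * cmod (fr p t)) + cmod z * (cmod (u t) * cmod (fr q t))
      + cmod (u t) * cmod (snd p t) + cmod (u t) * cmod (snd q t))"
      by (intro set_integral_add(1) set_integrable_mult_right bm_abs b xy w bm_integrable)
    then show ?thesis by (simp add: \<psi>_def algebra_simps)
  qed
  have iu: "set_integrable \<rho> (A x) (\<lambda>t. cmod (u t) * \<psi> t)" if "x \<in> E" for x
    using seg_iu[OF d, of x] seg_iu[OF _ d, of x] EI that unfolding A_def by auto
  \<comment> \<open>The Wronskians \<open>P\<close> and \<open>Q\<close> of u obey the same
    estimate; \<open>R\<close> stands for either of them.\<close>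
  have step: "cmod (R x) \<le> cmod (R d) + (LINT t:A x|\<rho>. cmod (u t) * \<psi> t)"
    if x: "x \<in> E" and R: "(R = P \<and> f = fr p \<and> w = snd p \<and> k = kr p) \<or> (R = Q \<and> f = fr q \<and> w = snd q \<and> k = kr q)" for x R f w k
  proof -
    have xI: "x \<in> I" using x EI by auto
    have sf: "sys f k w" using R sp sq by auto
    have Rt: "R t = u t * k t - ku t * f t" for t using R by (auto simp: P_def Q_def)
    have L: "cmod (R t - R s) \<le> (LINT r:{s..<t}|\<rho>. cmod (u r) * \<psi> r)" if st: "s \<in> I" "t \<in> I" "s \<le> t" for s t
    proof -
      have "R t - R s = (LINT r:{s..<t}|\<rho>. z * u r * f r - u r * w r)"
        using Lagrange[OF sysD[OF u st] sysD[OF sf st] st(3)] by (simp add: Rt)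
      also have "cmod \<dots> \<le> (LINT r:{s..<t}|\<rho>. cmod (u r) * \<psi> r)"
        unfolding set_lebesgue_integral_def
      proof (rule integral_norm_bound[THEN order_trans], rule integral_mono')
        show "integrable \<rho> (\<lambda>r. indicator {s..<t} r *\<^sub>R (cmod (u r) * \<psi> r))" using seg_iu[OF st(1,2)] by (simp add: set_integrable_def)
        fix r
        have "cmod (z * u r * f r - u r * w r) \<le> cmod (u r) * (cmod z * cmod (f r) + cmod (w r))"
          using norm_triangle_ineq4[of "z * u r * f r" "u r * w r"] by (simp add: norm_mult algebra_simps)
        also have "\<dots> \<le> cmod (u r) * \<psi> r"
        proof -
          have "cmod z * cmod (f r) \<le> cmod z * (cmod (fr p r) + cmod (fr q r))" using R by (intro mult_left_mono) auto
          moreover have "cmod (w r) \<le> cmod (snd p r) + cmod (snd q r)" using R by auto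
          ultimately have "cmod z * cmod (f r) + cmod (w r) \<le> \<psi> r" by (simp add: \<psi>_def)
          then show ?thesis by (intro mult_left_mono) auto
        qed
        finally show "norm (indicator {s..<t} r *\<^sub>R (z * u r * f r - u r * w r)) \<le> indicator {s..<t} r *\<^sub>R (cmod (u r) * \<psi> r)"
          by (auto simp: indicator_def)
      qed (auto simp: psipos)
      finally show ?thesis .
    qed
    show ?thesis
    proof (cases "x < d")
      case True
      have "cmod (R x) \<le> cmod (R d) + cmod (R d - R x)" using norm_triangle_sub[of "R x" "R d"] by (simp add: norm_minus_commute)
      then show ?thesis using L[OF xI d] True by (simp add: A_def)
    next
      case False
      have "cmod (R x) \<le> cmod (R d) + cmod (R x - R d)" using norm_triangle_sub[of "R x" "R d"] by simp
      then show ?thesis using L[OF d xI] False by (simp add: A_def)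
    qed
  qed
  define K where "K = cmod (P d) + cmod (Q d)"
  have le: "cmod (u x) \<le> \<phi> x / \<epsilon> * (K + (LINT t:A x|\<rho>. cmod (u t) * \<psi> t))" if x: "x \<in> E" for x
  proof -
    define m where "m = (LINT t:A x|\<rho>. cmod (u t) * \<psi> t)"
    have "u x * wr p q x = fr p x * Q x - fr q x * P x" unfolding wr_def P_def Q_def by algebra
    then have "cmod (u x) * cmod (wr p q x) = cmod (fr p x * Q x - fr q x * P x)" by (metis norm_mult)
    also have "\<dots> \<le> cmod (fr p x) * cmod (Q x) + cmod (fr q x) * cmod (P x)" by (metis norm_triangle_ineq4 norm_mult)
    also have "\<dots> \<le> cmod (fr p x) * (K + m) + cmod (fr q x) * (K + m)"
    proof -
      have "cmod (P x) \<le> cmod (P d) + m" "cmod (Q x) \<le> cmod (Q d) + m"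
        using step[OF x, of P "fr p" "snd p" "kr p"] step[OF x, of Q "fr q" "snd q" "kr q"] by (simp_all add: m_def)
      then have "cmod (P x) \<le> K + m" "cmod (Q x) \<le> K + m"
        using norm_ge_zero[of "P d"] norm_ge_zero[of "Q d"] unfolding K_def by linarith+
      then show ?thesis by (intro add_mono mult_left_mono) auto
    qed
    also have "\<dots> = \<phi> x * (K + m)" by (simp add: \<phi>_def algebra_simps)
    finally have "cmod (u x) * cmod (wr p q x) \<le> \<phi> x * (K + m)" .
    moreover have "cmod (u x) * \<epsilon> \<le> cmod (u x) * cmod (wr p q x)" using W[OF x] by (intro mult_left_mono) auto
    ultimately have "cmod (u x) * \<epsilon> \<le> \<phi> x * (K + m)" by simp
    then show ?thesis using \<epsilon> unfolding m_def[symmetric] by (simp add: field_simps)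
  qed
  have K: "K \<ge> 0" by (simp add: K_def)
  have "cmod (u x) \<le> 2 * K / \<epsilon> * \<phi> x" if "x \<in> E" for x
    by (rule absorb_half[where E=E and A=A and M=\<rho>, OF _ nest phipos psipos \<epsilon> K iu i half[folded \<phi>_def(1) \<psi>_def(1)] le that]) (use AE in \<open>auto simp: A_def\<close>)
  then show ?thesis unfolding \<phi>_def(1) by blast
qed

lemma dominated_L2:
  assumes p: "p \<in> TM" and q: "q \<in> TM" and K: "\<And>x. x \<in> E \<Longrightarrow> cmod (u x) \<le> K * maj p q x"
  shows "set_nn_integral \<rho> E (\<lambda>t. ennreal ((cmod (u t))\<^sup>2)) < \<infinity>"
proof -
  have i: "integrable \<rho> (\<lambda>t. K\<^sup>2 * (2 * (cmod (fr p t))\<^sup>2 + 2 * (cmod (fr q t))\<^sup>2))"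
    by (intro integrable_mult_right Bochner_Integration.integrable_add L2_sq_integrable fr_L2 p q)
  have "set_nn_integral \<rho> E (\<lambda>t. ennreal ((cmod (u t))\<^sup>2)) \<le> (\<integral>\<^sup>+t. ennreal (norm (K\<^sup>2 * (2 * (cmod (fr p t))\<^sup>2 + 2 * (cmod (fr q t))\<^sup>2))) \<partial>\<rho>)"
  proof (rule nn_integral_mono)
    fix t
    show "ennreal ((cmod (u t))\<^sup>2) * indicator E t \<le> ennreal (norm (K\<^sup>2 * (2 * (cmod (fr p t))\<^sup>2 + 2 * (cmod (fr q t))\<^sup>2)))"
    proof (cases "t \<in> E")
      case True
      have "(cmod (u t))\<^sup>2 \<le> (K * (cmod (fr p t) + cmod (fr q t)))\<^sup>2" using K[OF True] by (intro power_mono) (auto simp: maj_def)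
      also have "\<dots> = K\<^sup>2 * (cmod (fr p t) + cmod (fr q t))\<^sup>2" by (simp add: power_mult_distrib)
      also have "\<dots> \<le> K\<^sup>2 * (2 * (cmod (fr p t))\<^sup>2 + 2 * (cmod (fr q t))\<^sup>2)"
        using sum_squares_bound[of "cmod (fr p t)" "cmod (fr q t)"] by (intro mult_left_mono) (auto simp: power2_sum)
      finally show ?thesis using True by (auto intro!: ennreal_leI)
    qed auto
  qed
  also have "\<dots> < \<infinity>" using i unfolding integrable_iff_bounded by blast
  finally show ?thesis .
qed

lemma bm_nn_finite:
  assumes "bm x y u" "x \<in> I" "y \<in> I" shows "set_nn_integral \<rho> {x..<y} (\<lambda>t. ennreal ((cmod (u t))\<^sup>2)) < \<infinity>"
proof -
  have "(\<integral>\<^sup>+t. ennreal ((cmod (restr x y u t))\<^sup>2) \<partial>\<rho>) < \<infinity>" using restr_L2[OF assms] by (simp add: L2_def)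
  moreover have "(\<integral>\<^sup>+t. ennreal ((cmod (restr x y u t))\<^sup>2) \<partial>\<rho>) = set_nn_integral \<rho> {x..<y} (\<lambda>t. ennreal ((cmod (u t))\<^sup>2))"
    by (intro nn_integral_cong) (auto simp: restr_def indicator_def)
  ultimately show ?thesis by simp
qed

text \<open>A solution is known to be Borel only on the interval, so measurability is asked of the
  cut-off functions.\<close>

lemma set_nn_Un:
  assumes "set_nn_integral \<rho> A g < \<infinity>" "set_nn_integral \<rho> B g < \<infinity>" "C \<subseteq> A \<union> B"
    and "(\<lambda>t. g t * indicator A t) \<in> borel_measurable \<rho>" "(\<lambda>t. g t * indicator B t) \<in> borel_measurable \<rho>"
  shows "set_nn_integral \<rho> C g < (\<infinity>::ennreal)"
proof -
  have "set_nn_integral \<rho> C g \<le> (\<integral>\<^sup>+t. g t * indicator A t + g t * indicator B t \<partial>\<rho>)"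
    using assms(3) by (intro nn_integral_mono) (auto simp: indicator_def)
  also have "\<dots> = set_nn_integral \<rho> A g + set_nn_integral \<rho> B g" using assms(4,5) by (rule nn_integral_add)
  finally show ?thesis using assms(1,2) by (simp add: less_top ennreal_add_eq_top order_le_less_trans) 
qed

lemma sys_sq_measurable:
  assumes "sys u k w" "A \<in> sets borel" "A \<subseteq> I" shows "(\<lambda>t. ennreal ((cmod (u t))\<^sup>2) * indicator A t) \<in> borel_measurable \<rho>"
proof -
  have [measurable]: "(\<lambda>t. if t \<in> I then u t else 0) \<in> borel_measurable borel"
  proof (rule borel_measurable_locally[of a b])
    fix x y assume xy: "x \<in> I" "y \<in> I"
    show "bm x y (\<lambda>t. if t \<in> I then u t else 0)"
      by (rule bm_cong[of x y u]) (use bm_sys[OF assms(1) xy] Iab_convex[OF xy] in auto)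
  qed simp
  note [measurable] = assms(2)
  have "(\<lambda>t. ennreal ((cmod (if t \<in> I then u t else 0))\<^sup>2) * indicator A t) \<in> borel_measurable borel" by measurable
  also have "(\<lambda>t. ennreal ((cmod (if t \<in> I then u t else 0))\<^sup>2) * indicator A t) = (\<lambda>t. ennreal ((cmod (u t))\<^sup>2) * indicator A t)"
    using assms(3) by (auto simp: indicator_def fun_eq_iff)
  finally show ?thesis by (simp cong: measurable_cong_sets)
qed

lemma tail_small:
  assumes p: "integrable \<rho> (\<Phi> :: real \<Rightarrow> real)" and e: "e > 0"
  shows "\<forall>\<^sub>F d in left_end a. (LINT t:{x\<in>I. x < d}|\<rho>. \<Phi> t) < e" "\<forall>\<^sub>F d in right_end b. (LINT t:{x\<in>I. d \<le> x}|\<rho>. \<Phi> t) < e"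
proof -
  have ip: "integrable \<rho> (\<lambda>t. complex_of_real (\<Phi> t))" using p by simp
  have m: "\<Phi> \<in> borel_measurable \<rho>" using p by auto
  have Ib: "I \<in> sets borel" using open_Iab[of a b] by auto
  have e1: "(LINT t:{x\<in>I. x < d}|\<rho>. \<Phi> t) = (LINT t:{..<d}|\<rho>. \<Phi> t)" for d
  proof -
    have "{x\<in>I. x < d} = I \<inter> {..<d}" by auto
    then have [simp]: "{x\<in>I. x < d} \<in> sets borel" using Ib by simp
    show ?thesis unfolding set_lebesgue_integral_def
    proof (rule integral_cong_AE)
      show "AE t in \<rho>. indicator {x\<in>I. x < d} t *\<^sub>R \<Phi> t = indicator {..<d} t *\<^sub>R \<Phi> t"
        using AE_I by eventually_elim (auto simp: indicator_def)
    qed (rule borel_measurable_scaleR[OF borel_measurable_indicator m], simp)+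
  qed
  have si: "set_integrable \<rho> A \<Phi>" if "A \<in> sets borel" for A
    unfolding set_integrable_def using p that by (intro integrable_mult_indicator) auto
  have e2: "(LINT t:{x\<in>I. d \<le> x}|\<rho>. \<Phi> t) = (\<integral>t. \<Phi> t \<partial>\<rho>) - (LINT t:{..<d}|\<rho>. \<Phi> t)" for d
  proof -
    have "{x\<in>I. d \<le> x} = I \<inter> {d..}" by auto
    then have [simp]: "{x\<in>I. d \<le> x} \<in> sets borel" using Ib by simp
    have "(LINT t:{x\<in>I. d \<le> x}|\<rho>. \<Phi> t) = (LINT t:{d..}|\<rho>. \<Phi> t)" unfolding set_lebesgue_integral_def
    proof (rule integral_cong_AE)
      show "AE t in \<rho>. indicator {x\<in>I. d \<le> x} t *\<^sub>R \<Phi> t = indicator {d..} t *\<^sub>R \<Phi> t"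
        using AE_I by eventually_elim (auto simp: indicator_def)
    qed (rule borel_measurable_scaleR[OF borel_measurable_indicator m], simp)+
    moreover have "(LINT t:{..<d} \<union> {d..}|\<rho>. \<Phi> t) = (LINT t:{..<d}|\<rho>. \<Phi> t) + (LINT t:{d..}|\<rho>. \<Phi> t)"
      by (rule set_integral_Un) (auto intro: si)
    moreover have "{..<d} \<union> {d..} = UNIV" by auto
    ultimately show ?thesis by (simp add: set_lebesgue_integral_def)
  qed
  have cr: "(LINT t:A|\<rho>. complex_of_real (\<Phi> t)) = of_real (LINT t:A|\<rho>. \<Phi> t)" for A by (rule set_integral_complex_of_real)
  have "((\<lambda>x. complex_of_real (LINT t:{..<x}|\<rho>. \<Phi> t)) \<longlongrightarrow> 0) (left_end a)"
    using tendsto_initial_integral(1)[OF ip] unfolding cr .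
  then have "\<forall>\<^sub>F d in left_end a. dist (complex_of_real (LINT t:{..<d}|\<rho>. \<Phi> t)) 0 < e" using e by (rule tendstoD)
  then show "\<forall>\<^sub>F d in left_end a. (LINT t:{x\<in>I. x < d}|\<rho>. \<Phi> t) < e"
    unfolding e1 by eventually_elim (auto simp: dist_norm)
  have "((\<lambda>x. complex_of_real (LINT t:{..<x}|\<rho>. \<Phi> t)) \<longlongrightarrow> of_real (\<integral>t. \<Phi> t \<partial>\<rho>)) (right_end b)"
    using tendsto_initial_integral(2)[OF ip] unfolding cr by simp
  then have "\<forall>\<^sub>F d in right_end b. dist (complex_of_real (LINT t:{..<d}|\<rho>. \<Phi> t)) (of_real (\<integral>t. \<Phi> t \<partial>\<rho>)) < e" using e by (rule tendstoD)
  then show "\<forall>\<^sub>F d in right_end b. (LINT t:{x\<in>I. d \<le> x}|\<rho>. \<Phi> t) < e"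
    unfolding e2 by eventually_elim (auto simp: dist_of_real dist_real_def)
qed

text \<open>Near the end u is dominated by \<open>maj\<close>; on the compact remainder [x, y) it is
  bounded.\<close>

lemma solution_L2:
  assumes p: "p \<in> TM" and q: "q \<in> TM" and sol: "is_solution a b \<rho> \<sigma> chi c z u" and \<epsilon>: "\<epsilon> > 0"
    and d: "d \<in> I" and E: "E = {x\<in>I. d \<le> x} \<or> E = {x\<in>I. x < d}"
    and W: "\<And>x. x \<in> E \<Longrightarrow> cmod (wr p q x) \<ge> \<epsilon>" and half: "(LINT t:E|\<rho>. maj p q t * maj_src z p q t) \<le> \<epsilon> / 2"
    and xy: "x \<in> I" "y \<in> I" and E': "E' \<subseteq> {x..<y} \<union> E"
  shows "set_nn_integral \<rho> E' (\<lambda>x. ennreal ((cmod (u x))\<^sup>2)) < \<infinity>"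
proof -
  obtain ku where u: "sys u ku (\<lambda>t. z * u t)" using sol dom_pair_sys unfolding is_solution_def by blast
  obtain K where K: "\<And>x. x \<in> E \<Longrightarrow> cmod (u x) \<le> K * maj p q x"
    using solution_bound[OF p q u \<epsilon> d E W half] by blast
  have "{x\<in>I. d \<le> x} = I \<inter> {d..}" "{x\<in>I. x < d} = I \<inter> {..<d}" by auto
  then have Es: "E \<in> sets borel" "E \<subseteq> I" using E open_Iab[of a b] by auto
  have sub: "{x..<y} \<subseteq> I" using Iab_convex[OF xy] by auto
  show ?thesis
  proof (rule set_nn_Un[OF _ _ E'])
    show "set_nn_integral \<rho> {x..<y} (\<lambda>x. ennreal ((cmod (u x))\<^sup>2)) < \<infinity>" using bm_nn_finite[OF _ xy] bm_sys[OF u xy] by blast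
    show "set_nn_integral \<rho> E (\<lambda>x. ennreal ((cmod (u x))\<^sup>2)) < \<infinity>" by (rule dominated_L2[OF p q K])
  qed (use sys_sq_measurable[OF u _ sub] sys_sq_measurable[OF u Es] in auto)
qed

text \<open>A limit C \<noteq> 0 keeps |W(p, q)| above |C|/2 near b, so \<open>solution_L2\<close>
  applies to every solution. The neighbourhood of b depends on z through \<open>maj_src\<close> and
  is chosen after z.\<close>

lemma not_lc_right:
  assumes nlc: "\<not> lc_right a b \<rho> \<sigma> chi c" and p: "p \<in> TM" and q: "q \<in> TM" and C: "(wr p q \<longlongrightarrow> C) (right_end b)"
  shows "C = 0"
proof (rule ccontr)
  assume "C \<noteq> 0"
  define \<epsilon> where "\<epsilon> = cmod C / 2"
  have \<epsilon>: "\<epsilon> > 0" "\<epsilon> < cmod C" using \<open>C \<noteq> 0\<close> by (auto simp: \<epsilon>_def)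
  have evW: "\<forall>\<^sub>F x in right_end b. \<epsilon> < cmod (wr p q x)" using order_tendstoD(1)[OF tendsto_norm[OF C] \<epsilon>(2)] .
  have "lc_right a b \<rho> \<sigma> chi c" unfolding lc_right_def
  proof (intro allI impI ballI)
    fix z u d assume sol: "is_solution a b \<rho> \<sigma> chi c z u" and d: "d \<in> I"
    have "\<forall>\<^sub>F x in right_end b. (LINT t:{y\<in>I. x \<le> y}|\<rho>. maj p q t * maj_src z p q t) < \<epsilon> / 2"
      using \<epsilon> by (intro tail_small maj_integrable p q) auto
    from eventually_conj[OF this evW] obtain d0 where d0: "d0 \<in> I"
      "\<And>x. x \<in> I \<Longrightarrow> d0 < x \<Longrightarrow> (LINT t:{y\<in>I. x \<le> y}|\<rho>. maj p q t * maj_src z p q t) < \<epsilon> / 2 \<and> \<epsilon> < cmod (wr p q x)"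
      using eventually_right_endD[OF c] by blast
    obtain d1 where d1: "d1 \<in> I" "d0 < d1" using Iab_upper[OF d0(1)] by auto
    let ?E = "{x\<in>I. d1 \<le> x}"
    have "\<epsilon> \<le> cmod (wr p q x)" if "x \<in> ?E" for x using d0(2)[of x] d1(2) that by (auto simp: less_imp_le)
    then show "set_nn_integral \<rho> {x \<in> I. d < x} (\<lambda>x. ennreal ((cmod (u x))\<^sup>2)) < \<infinity>"
      using d0(2)[OF d1] by (intro solution_L2[OF p q sol \<epsilon>(1) d1(1), of ?E d d1]) (auto simp: d d1(1))
  qed
  then show False using nlc by blast
qed

lemma not_lc_left:
  assumes nlc: "\<not> lc_left a b \<rho> \<sigma> chi c" and p: "p \<in> TM" and q: "q \<in> TM" and C: "(wr p q \<longlongrightarrow> C) (left_end a)"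
  shows "C = 0"
proof (rule ccontr)
  assume "C \<noteq> 0"
  define \<epsilon> where "\<epsilon> = cmod C / 2"
  have \<epsilon>: "\<epsilon> > 0" "\<epsilon> < cmod C" using \<open>C \<noteq> 0\<close> by (auto simp: \<epsilon>_def)
  have evW: "\<forall>\<^sub>F x in left_end a. \<epsilon> < cmod (wr p q x)" using order_tendstoD(1)[OF tendsto_norm[OF C] \<epsilon>(2)] .
  have "lc_left a b \<rho> \<sigma> chi c" unfolding lc_left_def
  proof (intro allI impI ballI)
    fix z u d assume sol: "is_solution a b \<rho> \<sigma> chi c z u" and d: "d \<in> I"
    have "\<forall>\<^sub>F x in left_end a. (LINT t:{y\<in>I. y < x}|\<rho>. maj p q t * maj_src z p q t) < \<epsilon> / 2"
      using \<epsilon> by (intro tail_small maj_integrable p q) auto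
    from eventually_conj[OF this evW] obtain d0 where d0: "d0 \<in> I"
      "\<And>x. x \<in> I \<Longrightarrow> x < d0 \<Longrightarrow> (LINT t:{y\<in>I. y < x}|\<rho>. maj p q t * maj_src z p q t) < \<epsilon> / 2 \<and> \<epsilon> < cmod (wr p q x)"
      using eventually_left_endD[OF c] by blast
    obtain d1 where d1: "d1 \<in> I" "d1 < d0" using Iab_lower[OF d0(1)] by auto
    let ?E = "{x\<in>I. x < d1}"
    have "\<epsilon> \<le> cmod (wr p q x)" if "x \<in> ?E" for x using d0(2)[of x] d1(2) that by (auto simp: less_imp_le)
    then show "set_nn_integral \<rho> {x \<in> I. x < d} (\<lambda>x. ennreal ((cmod (u x))\<^sup>2)) < \<infinity>"
      using d0(2)[OF d1] by (intro solution_L2[OF p q sol \<epsilon>(1) d1(1), of ?E d1 d]) (auto simp: d d1(1))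
  qed
  then show False using nlc by blast
qed

text \<open>A source on [\<alpha>, \<beta>) with the right two moments steers the data of z at
  \<alpha> to zero at \<beta>.\<close>

lemma switch_off:
  assumes B: "basis \<alpha> \<beta> u k v l" and z: "sys z m (\<lambda>_. 0)"
  obtains f g w where "sys f g w" "w \<in> L2 \<rho>" "\<And>t. t \<in> I \<Longrightarrow> t \<le> \<alpha> \<Longrightarrow> f t = z t \<and> g t = m t" "\<And>t. t \<in> I \<Longrightarrow> \<beta> \<le> t \<Longrightarrow> f t = 0 \<and> g t = 0"
proof -
  have al: "\<alpha> \<in> I" "\<beta> \<in> I" "\<alpha> \<le> \<beta>" using B by (auto simp: basis_def)
  obtain h where h: "bm \<alpha> \<beta> h" "(LINT t:{\<alpha>..<\<beta>}|\<rho>. h t * u t) = - (z \<alpha> * k \<alpha> - m \<alpha> * u \<alpha>)" "(LINT t:{\<alpha>..<\<beta>}|\<rho>. h t * v t) = - (z \<alpha> * l \<alpha> - m \<alpha> * v \<alpha>)"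
    using B unfolding basis_def by blast
  define w where "w = restr \<alpha> \<beta> h"
  have w: "w \<in> L2 \<rho>" unfolding w_def by (rule restr_L2[OF h(1) al(1,2)])
  obtain f g where f: "sys f g w" "f \<alpha> = z \<alpha>" "g \<alpha> = m \<alpha>" using sys_exists[OF al(1) L2_loc[OF w]] by blast
  have "\<forall>t\<in>I. (t \<le> \<alpha> \<longrightarrow> f t = z t \<and> g t = m t) \<and> (\<beta> \<le> t \<longrightarrow> f t = 0 \<and> g t = 0)"
  proof (rule glue[OF B f(1) al _ _ z f(2,3)])
    have "restr \<alpha> \<beta> (restr \<alpha> \<beta> h) = restr \<alpha> \<beta> h" by (auto simp: restr_def fun_eq_iff)
    then show "(LINT t:{\<alpha>..<\<beta>}|\<rho>. w t * u t) = - (z \<alpha> * k \<alpha> - m \<alpha> * u \<alpha>)" "(LINT t:{\<alpha>..<\<beta>}|\<rho>. w t * v t) = - (z \<alpha> * l \<alpha> - m \<alpha> * v \<alpha>)"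
      using h(2,3) by (simp_all add: LINT_restr w_def)
  qed (auto simp: w_def restr_def)
  then show ?thesis using that[OF f(1) w] by blast
qed

lemma sys_TM:
  assumes f: "sys f g w" and w: "w \<in> L2 \<rho>" and fin: "set_nn_integral \<rho> I (\<lambda>t. ennreal ((cmod (f t))\<^sup>2)) < \<infinity>"
  defines "p \<equiv> ((\<lambda>t. if t \<in> I then f t else 0), w)"
  shows "p \<in> TM" "srep p f g"
proof -
  have "(\<lambda>t. if t \<in> I then f t else 0) \<in> borel_measurable borel"
  proof (rule borel_measurable_locally[of a b])
    fix x y assume xy: "x \<in> I" "y \<in> I"
    show "bm x y (\<lambda>t. if t \<in> I then f t else 0)"
      by (rule bm_cong[of x y f]) (use bm_sys[OF f xy] Iab_convex[OF xy] in auto)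
  qed simp
  moreover have "(\<integral>\<^sup>+t. ennreal ((cmod (if t \<in> I then f t else 0))\<^sup>2) \<partial>\<rho>) = set_nn_integral \<rho> I (\<lambda>t. ennreal ((cmod (f t))\<^sup>2))"
    by (intro nn_integral_cong) (auto simp: indicator_def)
  ultimately have "(\<lambda>t. if t \<in> I then f t else 0) \<in> L2 \<rho>" unfolding L2_def using fin by (simp cong: measurable_cong_sets)
  moreover show s: "srep p f g" unfolding srep_def p_def using f AE_I by (auto elim!: eventually_mono)
  ultimately show "p \<in> TM" unfolding Tmax_iff using w by (auto simp: p_def)
qed

lemma I_borel: "I \<in> sets borel" using open_Iab[of a b] by auto

text \<open>Switching off u and v to the right of \<alpha> keeps their Wronskian 1 near a. The
  results are square integrable: near a by the limit circle hypothesis with z = 0, on [\<alpha>,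
  \<beta>) by boundedness, and zero afterwards.\<close>

lemma lc_left_nonzero:
  assumes lc: "lc_left a b \<rho> \<sigma> chi c" shows "\<exists>p\<in>TM. \<exists>q\<in>TM. \<not> (wr p q \<longlongrightarrow> 0) (left_end a)"
proof -
  obtain \<alpha> \<beta> u k v l where B: "basis \<alpha> \<beta> u k v l" by (rule basis_exists)
  then have al: "\<alpha> \<in> I" "\<beta> \<in> I" "\<alpha> < \<beta>" and su: "sys u k (\<lambda>_. 0)" and sv: "sys v l (\<lambda>_. 0)" and W: "\<And>x. x \<in> I \<Longrightarrow> u x * l x - k x * v x = 1"
    by (auto simp: basis_def)
  have ex: "\<exists>p\<in>TM. \<forall>t\<in>I. t < \<alpha> \<longrightarrow> fr p t = z t \<and> kr p t = m t" if z: "sys z m (\<lambda>_. 0)" for z m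
  proof -
    obtain f g w where f: "sys f g w" "w \<in> L2 \<rho>" "\<And>t. t \<in> I \<Longrightarrow> t \<le> \<alpha> \<Longrightarrow> f t = z t \<and> g t = m t" "\<And>t. t \<in> I \<Longrightarrow> \<beta> \<le> t \<Longrightarrow> f t = 0 \<and> g t = 0"
      using switch_off[OF B z] by metis
    have "is_solution a b \<rho> \<sigma> chi c 0 z" unfolding is_solution_def using sys_dom_pair(1,2)[OF z] by auto
    then have "set_nn_integral \<rho> {x\<in>I. x < \<alpha>} (\<lambda>x. ennreal ((cmod (z x))\<^sup>2)) < \<infinity>" using lc al(1) unfolding lc_left_def by blast
    also have "set_nn_integral \<rho> {x\<in>I. x < \<alpha>} (\<lambda>x. ennreal ((cmod (z x))\<^sup>2)) = set_nn_integral \<rho> {x\<in>I. x < \<alpha>} (\<lambda>x. ennreal ((cmod (f x))\<^sup>2))"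
      using f(3) by (intro nn_integral_cong) (auto simp: indicator_def)
    finally have 1: "set_nn_integral \<rho> {x\<in>I. x < \<alpha>} (\<lambda>x. ennreal ((cmod (f x))\<^sup>2)) < \<infinity>" .
    have "set_nn_integral \<rho> {\<alpha>..<\<beta>} (\<lambda>x. ennreal ((cmod (f x))\<^sup>2)) < \<infinity>" using bm_nn_finite bm_sys[OF f(1) al(1,2)] al by blast
    also have "set_nn_integral \<rho> {\<alpha>..<\<beta>} (\<lambda>x. ennreal ((cmod (f x))\<^sup>2)) = set_nn_integral \<rho> {x\<in>I. \<alpha> \<le> x} (\<lambda>x. ennreal ((cmod (f x))\<^sup>2))"
    proof (rule nn_integral_cong)
      fix x
      show "ennreal ((cmod (f x))\<^sup>2) * indicator {\<alpha>..<\<beta>} x = ennreal ((cmod (f x))\<^sup>2) * indicator {x\<in>I. \<alpha> \<le> x} x"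
        using f(4)[of x] Iab_convex[OF al(1,2), of x] by (cases "\<beta> \<le> x") (auto simp: indicator_def)
    qed
    finally have 2: "set_nn_integral \<rho> {x\<in>I. \<alpha> \<le> x} (\<lambda>x. ennreal ((cmod (f x))\<^sup>2)) < \<infinity>" .
    have s: "{x\<in>I. x < \<alpha>} = I \<inter> {..<\<alpha>}" "{x\<in>I. \<alpha> \<le> x} = I \<inter> {\<alpha>..}" by auto
    have "set_nn_integral \<rho> I (\<lambda>x. ennreal ((cmod (f x))\<^sup>2)) < \<infinity>"
      by (rule set_nn_Un[OF 1 2]) (use sys_sq_measurable[OF f(1)] I_borel in \<open>auto simp: s\<close>)
    note p = sys_TM[OF f(1,2) this]
    show ?thesis by (rule bexI[OF _ p(1)]) (use fr_eq[OF p] f(3) in auto)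
  qed
  obtain p where p: "p \<in> TM" "\<And>t. t \<in> I \<Longrightarrow> t < \<alpha> \<Longrightarrow> fr p t = u t \<and> kr p t = k t" using ex[OF su] by blast
  obtain q where q: "q \<in> TM" "\<And>t. t \<in> I \<Longrightarrow> t < \<alpha> \<Longrightarrow> fr q t = v t \<and> kr q t = l t" using ex[OF sv] by blast
  have "(wr p q \<longlongrightarrow> 1) (left_end a)"
    by (rule tendsto_eventually, rule eventually_mono[OF eventually_left_end[OF al(1)]]) (use p q W in \<open>auto simp: wr_def\<close>)
  then have "\<not> (wr p q \<longlongrightarrow> 0) (left_end a)" using tendsto_unique[OF left_end_neq_bot] by (metis zero_neq_one)
  then show ?thesis using p q by blast
qed

lemma lc_right_nonzero:
  assumes lc: "lc_right a b \<rho> \<sigma> chi c" shows "\<exists>p\<in>TM. \<exists>q\<in>TM. \<not> (wr p q \<longlongrightarrow> 0) (right_end b)"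
proof -
  obtain \<alpha> \<beta> u k v l where B: "basis \<alpha> \<beta> u k v l" by (rule basis_exists)
  then have al: "\<alpha> \<in> I" "\<beta> \<in> I" "\<alpha> < \<beta>" and su: "sys u k (\<lambda>_. 0)" and sv: "sys v l (\<lambda>_. 0)" and W: "\<And>x. x \<in> I \<Longrightarrow> u x * l x - k x * v x = 1"
    by (auto simp: basis_def)
  have ex: "\<exists>p\<in>TM. \<forall>t\<in>I. \<beta> < t \<longrightarrow> fr p t = z t \<and> kr p t = m t" if z: "sys z m (\<lambda>_. 0)" for z m
  proof -
    obtain f0 g0 w0 where f0: "sys f0 g0 w0" "w0 \<in> L2 \<rho>" "\<And>t. t \<in> I \<Longrightarrow> t \<le> \<alpha> \<Longrightarrow> f0 t = z t \<and> g0 t = m t" "\<And>t. t \<in> I \<Longrightarrow> \<beta> \<le> t \<Longrightarrow> f0 t = 0 \<and> g0 t = 0"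
      using switch_off[OF B z] by metis
    \<comment> \<open>\<open>switch_off\<close> cuts on the right; subtracting its result from z
      gives a function that vanishes on the left and equals z on the right.\<close>
    define f g w where "f t = z t - f0 t" and "g t = m t - g0 t" and "w t = 0 - w0 t" for t
    have f: "sys f g w" "w \<in> L2 \<rho>" "\<And>t. t \<in> I \<Longrightarrow> t \<le> \<alpha> \<Longrightarrow> f t = 0" "\<And>t. t \<in> I \<Longrightarrow> \<beta> \<le> t \<Longrightarrow> f t = z t \<and> g t = m t"
      using sys_diff[OF z f0(1)] L2_diff[OF L2_zero f0(2)] f0(3,4) by (auto simp: f_def[abs_def] g_def[abs_def] w_def[abs_def])
    have "is_solution a b \<rho> \<sigma> chi c 0 z" unfolding is_solution_def using sys_dom_pair(1,2)[OF z] by auto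
    then have "set_nn_integral \<rho> {x\<in>I. \<beta> < x} (\<lambda>x. ennreal ((cmod (z x))\<^sup>2)) < \<infinity>" using lc al(2) unfolding lc_right_def by blast
    also have "set_nn_integral \<rho> {x\<in>I. \<beta> < x} (\<lambda>x. ennreal ((cmod (z x))\<^sup>2)) = set_nn_integral \<rho> {x\<in>I. \<beta> < x} (\<lambda>x. ennreal ((cmod (f x))\<^sup>2))"
      using f(4) by (intro nn_integral_cong) (auto simp: indicator_def)
    finally have 1: "set_nn_integral \<rho> {x\<in>I. \<beta> < x} (\<lambda>x. ennreal ((cmod (f x))\<^sup>2)) < \<infinity>" .
    \<comment> \<open>\<open>bm_nn_finite\<close> covers half-open intervals; a point beyond \<beta>
      includes a possible atom at \<beta>.\<close>
    obtain \<gamma> where g: "\<gamma> \<in> I" "\<beta> < \<gamma>" using Iab_upper[OF al(2)] by auto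
    have 2: "set_nn_integral \<rho> {\<alpha>..<\<gamma>} (\<lambda>x. ennreal ((cmod (f x))\<^sup>2)) < \<infinity>" using bm_nn_finite bm_sys[OF f(1) al(1) g(1)] al g by blast
    have "set_nn_integral \<rho> {x\<in>I. x \<le> \<beta>} (\<lambda>x. ennreal ((cmod (f x))\<^sup>2)) \<le> set_nn_integral \<rho> {\<alpha>..<\<gamma>} (\<lambda>x. ennreal ((cmod (f x))\<^sup>2))"
    proof (rule nn_integral_mono)
      fix x
      show "ennreal ((cmod (f x))\<^sup>2) * indicator {x\<in>I. x \<le> \<beta>} x \<le> ennreal ((cmod (f x))\<^sup>2) * indicator {\<alpha>..<\<gamma>} x"
        using f(3)[of x] g(2) by (cases "x \<le> \<alpha>") (auto simp: indicator_def)
    qed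
    then have 3: "set_nn_integral \<rho> {x\<in>I. x \<le> \<beta>} (\<lambda>x. ennreal ((cmod (f x))\<^sup>2)) < \<infinity>" using 2 by (rule le_less_trans)
    have s: "{x\<in>I. \<beta> < x} = I \<inter> {\<beta><..}" "{x\<in>I. x \<le> \<beta>} = I \<inter> {..\<beta>}" by auto
    have "set_nn_integral \<rho> I (\<lambda>x. ennreal ((cmod (f x))\<^sup>2)) < \<infinity>"
      by (rule set_nn_Un[OF 1 3]) (use sys_sq_measurable[OF f(1)] I_borel in \<open>auto simp: s\<close>)
    note p = sys_TM[OF f(1,2) this]
    show ?thesis by (rule bexI[OF _ p(1)]) (use fr_eq[OF p] f(4) in auto)
  qed
  obtain p where p: "p \<in> TM" "\<And>t. t \<in> I \<Longrightarrow> \<beta> < t \<Longrightarrow> fr p t = u t \<and> kr p t = k t" using ex[OF su] by blast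
  obtain q where q: "q \<in> TM" "\<And>t. t \<in> I \<Longrightarrow> \<beta> < t \<Longrightarrow> fr q t = v t \<and> kr q t = l t" using ex[OF sv] by blast
  have "(wr p q \<longlongrightarrow> 1) (right_end b)"
    by (rule tendsto_eventually, rule eventually_mono[OF eventually_right_end[OF al(2)]]) (use p q W in \<open>auto simp: wr_def\<close>)
  then have "\<not> (wr p q \<longlongrightarrow> 0) (right_end b)" using tendsto_unique[OF right_end_neq_bot] by (metis zero_neq_one)
  then show ?thesis using p q by blast
qed

section \<open>One limit circle and one limit point end\<close>

lemma selfadjoint_lc_left:
  assumes lc: "lc_left a b \<rho> \<sigma> chi c" and lp: "\<not> lc_right a b \<rho> \<sigma> chi c"
  shows "(S \<subseteq> TM \<and> adj \<rho> S = S) \<longleftrightarrow>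
       (\<exists>v \<in> TM - Tmin a b \<rho> \<sigma> chi c. W_end_zero a b \<rho> \<sigma> chi c (left_end a) v (conjp v) \<and>
          S = {p \<in> TM. W_end_zero a b \<rho> \<sigma> chi c (left_end a) p (conjp v)})"
\<comment> \<open>The limit at b is 0, so \<open>Dd\<close> is minus the limit at a.\<close>
proof (rule selfadjoint_iff[where s = "-1", OF left_end_neq_bot _ _ _ _ lc_left_nonzero[OF lc]])
  show "\<forall>\<^sub>F x in left_end a. x \<in> I" by (rule eventually_mono[OF eventually_left_end[OF c]]) simp
  show "\<exists>l. (wr p q \<longlongrightarrow> l) (left_end a)" if "p \<in> TM" "q \<in> TM" for p q using wr_limits[OF that] by blast
  show "Dd p q = - 1 * l" if pq: "p \<in> TM" "q \<in> TM" "(wr p (conjp q) \<longlongrightarrow> l) (left_end a)" for p q l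
  proof -
    obtain r where r: "(wr p (conjp q) \<longlongrightarrow> r) (right_end b)" using wr_limits[OF pq(1) conjp_Tmax[OF pq(2)]] by blast
    then have "r = 0" using not_lc_right[OF lp pq(1) conjp_Tmax[OF pq(2)]] by blast
    then show ?thesis using Dd_limits[OF pq r] by simp
  qed
qed simp

lemma selfadjoint_lc_right:
  assumes lc: "lc_right a b \<rho> \<sigma> chi c" and lp: "\<not> lc_left a b \<rho> \<sigma> chi c"
  shows "(S \<subseteq> TM \<and> adj \<rho> S = S) \<longleftrightarrow>
       (\<exists>v \<in> TM - Tmin a b \<rho> \<sigma> chi c. W_end_zero a b \<rho> \<sigma> chi c (right_end b) v (conjp v) \<and>
          S = {p \<in> TM. W_end_zero a b \<rho> \<sigma> chi c (right_end b) p (conjp v)})"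
proof (rule selfadjoint_iff[where s = 1, OF right_end_neq_bot _ _ _ _ lc_right_nonzero[OF lc]])
  show "\<forall>\<^sub>F x in right_end b. x \<in> I" by (rule eventually_mono[OF eventually_right_end[OF c]]) simp
  show "\<exists>l. (wr p q \<longlongrightarrow> l) (right_end b)" if "p \<in> TM" "q \<in> TM" for p q using wr_limits[OF that] by blast
  show "Dd p q = 1 * r" if pq: "p \<in> TM" "q \<in> TM" "(wr p (conjp q) \<longlongrightarrow> r) (right_end b)" for p q r
  proof -
    obtain l where l: "(wr p (conjp q) \<longlongrightarrow> l) (left_end a)" using wr_limits[OF pq(1) conjp_Tmax[OF pq(2)]] by blast
    then have "l = 0" using not_lc_left[OF lp pq(1) conjp_Tmax[OF pq(2)]] by blast
    then show ?thesis using Dd_limits[OF pq(1,2) l pq(3)] by simp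
  qed
qed simp

end

theorem theorem6p4:
  fixes a b :: ereal and \<rho> :: "real measure" and \<sigma> chi :: rmeas and c :: real
    and S :: lrel
  assumes ab: "a < b" and c: "c \<in> Iab a b"
    and H1: "locfin a b \<rho>"
    and H2: "real_meas a b chi"
    and H3: "real_meas a b \<sigma>" "supp_real a b \<sigma> = Iab a b"
    and H4: "\<forall>x\<in>Iab a b. sval \<sigma> {x} * sval chi {x} = 0 \<and> sval \<sigma> {x} * measure \<rho> {x} = 0"
    and H5: "\<forall>\<alpha> \<beta>. \<alpha> \<in> supp_pos a b \<rho> \<and> \<beta> \<in> supp_pos a b \<rho> \<and> \<alpha> < \<beta> \<and>
               {\<alpha><..<\<beta>} \<inter> supp_pos a b \<rho> = {} \<longrightarrow>
               (\<forall>f\<in>Dtau a b \<rho> \<sigma> chi c. (f \<longlongrightarrow> 0) (at_left \<alpha>) \<and> (f \<longlongrightarrow> 0) (at_right \<beta>) \<longrightarrow>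
                  (\<forall>x\<in>{\<alpha><..<\<beta>}. f x = 0))"
    and H6: "\<exists>x\<in>supp_pos a b \<rho>. \<exists>y\<in>supp_pos a b \<rho>. x \<noteq> y"
    and S: "lin_rel \<rho> S"
  shows
   "(lc_left a b \<rho> \<sigma> chi c \<and> \<not> lc_right a b \<rho> \<sigma> chi c \<longrightarrow>
      ((S \<subseteq> Tmax a b \<rho> \<sigma> chi c \<and> adj \<rho> S = S) \<longleftrightarrow>
       (\<exists>v \<in> Tmax a b \<rho> \<sigma> chi c - Tmin a b \<rho> \<sigma> chi c.
          W_end_zero a b \<rho> \<sigma> chi c (left_end a) v (conjp v) \<and>
          S = {p \<in> Tmax a b \<rho> \<sigma> chi c. W_end_zero a b \<rho> \<sigma> chi c (left_end a) p (conjp v)})))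
    \<and>
    (lc_right a b \<rho> \<sigma> chi c \<and> \<not> lc_left a b \<rho> \<sigma> chi c \<longrightarrow>
      ((S \<subseteq> Tmax a b \<rho> \<sigma> chi c \<and> adj \<rho> S = S) \<longleftrightarrow>
       (\<exists>v \<in> Tmax a b \<rho> \<sigma> chi c - Tmin a b \<rho> \<sigma> chi c.
          W_end_zero a b \<rho> \<sigma> chi c (right_end b) v (conjp v) \<and>
          S = {p \<in> Tmax a b \<rho> \<sigma> chi c. W_end_zero a b \<rho> \<sigma> chi c (right_end b) p (conjp v)})))"
proof -
  interpret measure_sl_gap a b \<rho> \<sigma> chi c
    using c H1 H2 H3 H4 H5 H6 by unfold_locales auto
  show ?thesis using selfadjoint_lc_left[of S] selfadjoint_lc_right[of S] by blast
qed

end
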